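(* In the regression setup described in the context, assume that $(X_i,\varepsilon_i)_{i\ge1}$ is ergodic, that $\mathbb{E}\|U_1\|^2<\infty$, that $h_n\to0$, $nh_n\to\infty$ and $nh_n\,\lambda_{\max}(\operatorname{Cov}(\overline U_n))\to0$ with $\overline U_n=\frac1n\sum_{i=1}^nU_i$, that $c_2(K)=\int K^2(u)\,du<\infty$, that $\mu\in\mathcal{D}$, that $\mathbb{E}\|X_1\|^4<\infty$, that $0<\mathbb{E}[\varepsilon_1^2\mid X_1]<\infty$ almost surely, and that the support of $X_1$ has nonempty interior in $\mathbb{R}^p$. Let $\alpha\in(0,1)$. (a) For each $j=1,\dots,p+1$, writing $\beta_{(j)}$ and $\widehat\beta_{n,(j)}$ for the $j$-th components of $\beta$ and $\widehat\beta_n$, $$\left(\widehat\beta_{n,(j)}-z_{1-\alpha/2}\sqrt{\frac{(\widehat\Sigma_{\beta,n})_{jj}}{nh_n}},\ \ \widehat\beta_{n,(j)}+z_{1-\alpha/2}\sqrt{\frac{(\widehat\Sigma_{\beta,n})_{jj}}{nh_n}}\right)$$ is an asymptotic $(1-\alpha)100\%$ confidence interval for $\beta_{(j)}$ (its coverage probability tends to $1-\alpha$), where $z_{1-\alpha/2}$ is the $(1-\alpha/2)$-quantile of the standard normal distribution. (b) Let $R\in\mathbb{R}^{k\times(p+1)}$ have full row rank $k\le p+1$, let $r\in\mathbb{R}^k$, and let $$W_n=nh_n\,(R\widehat\beta_n-r)^\top\big(R\,\widehat\Sigma_{\beta,n}R^\top\big)^{-1}(R\widehat\beta_n-r).$$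 If $R\beta=r$, then $W_n\Rightarrow\chi^2_k$; consequently the test of $H_0:R\beta=r$ versus $H_1:R\beta\ne r$ that rejects $H_0$ when $W_n>\chi^2_{k,1-\alpha}$ (equivalently when $1-F_{\chi^2_k}(W_n)<\alpha$) has asymptotic level $\alpha$.
   Context: Regression setup. Let $p\ge1$, $m=p+1$, $q_1=m(m+1)/2$, $q=q_1+m$. $(X_i,\varepsilon_i)_{i\ge1}$ is a stationary sequence with $X_i=(X_{i,1},\dots,X_{i,p})^\top\in\mathbb{R}^p$, $\varepsilon_i\in\mathbb{R}$, $\mathbb{E}[\varepsilon_1\mid X_1]=0$, $\mathbb{E}\|X_1\|^2<\infty$, and $Y_i=\beta_0+\beta_1X_{i,1}+\cdots+\beta_pX_{i,p}+\varepsilon_i$. Put $\widetilde X_i=(1,X_i^\top)^\top\in\mathbb{R}^{m}$, $\beta=(\beta_0,\dots,\beta_p)^\top$, $\Sigma=\mathbb{E}[\widetilde X_1\widetilde X_1^\top]$, $\Gamma=\mathbb{E}[\widetilde X_1Y_1]$, $\mu=(\operatorname{Vech}(\Sigma)^\top,\Gamma^\top)^\top\in\mathbb{R}^q$, where $\operatorname{Vech}$ stacks the lower-triangular entries of a symmetric matrix. For $\mathbf{x}\in\mathbb{R}^q$, let $\Sigma(\mathbf{x})$ (symmetric $m\times m$) and $\Gamma(\mathbf{x})\in\mathbb{R}^m$ be determined by $\mathbf{x}=(\operatorname{Vech}(\Sigma(\mathbf{x}))^\top,\Gamma(\mathbf{x})^\top)^\top$; let $\Delta(\mathbf{x})=\det\Sigma(\mathbf{x})$,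 $\mathcal{D}=\{\mathbf{x}\in\mathbb{R}^q:\Delta(\mathbf{x})>0\}$, and $g:\mathcal{D}\to\mathbb{R}^{p+1}$, $g(\mathbf{x})=\Sigma(\mathbf{x})^{-1}\Gamma(\mathbf{x})$; $\nabla g$ is its $(p+1)\times q$ Jacobian. If $\mu\in\mathcal{D}$ then $\beta=g(\mu)$. Let $U_i=(\operatorname{Vech}(\widetilde X_i\widetilde X_i^\top)^\top,(\widetilde X_iY_i)^\top)^\top\in\mathbb{R}^q$, so $\mathbb{E}[U_1]=\mu$. Smoothing. $(V_i)_{i\ge1}$ is i.i.d., real, independent of $(U_i)_{i\ge1}$, with bounded density $f$ continuous at $0$ and $f(0)>0$; $K$ is a symmetric bounded probability density on $\mathbb{R}$; $(h_n)$ are positive bandwidths. Define $$\widehat\mu_n=\frac{1}{n\,\mathbb{E}[K(V_1/h_n)]}\sum_{i=1}^nU_i\,K(V_i/h_n),\qquad \widehat\beta_n=g(\widehat\mu_n)\ \text{ whenever }\widehat\mu_n\in\mathcal{D},$$ $$\widehat\Sigma_{\mu,n}=\frac{c_2(K)}{f(0)}\cdot\frac1n\sum_{i=1}^nU_iU_i^\top,\qquad \widehat\Sigma_{\beta,n}=\nabla g(\widehat\mu_n)\,\widehat\Sigma_{\mu,n}\,\nabla g(\widehat\mu_n)^\top.$$ Quantities are defined arbitrarily (measurably) on the events where the formulas make no sense; these events have probability tending to $0$. $\lambda_{\max}$ is the largest eigenvalue, $\Rightarrow$ is convergence in distribution, $\chi^2_{k,1-\alpha}$ and $F_{\chi^2_k}$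 are the $(1-\alpha)$-quantile and the distribution function of the $\chi^2_k$ law. *)

theory Defs
  imports "HOL-Probability.Probability" "HOL-Library.Option_ord"
begin

text \<open>
  Positions (i, j) with j \<le> i of the lower triangle of a matrix indexed by a linearly ordered
  type.  This is the index type of \<open>Vech\<close>; for an m-element index type it has m(m+1)/2 elements.
\<close>

typedef (overloaded) ('n::linorder) ltri = "{ij :: 'n \<times> 'n. snd ij \<le> fst ij}"
  by auto

instance ltri :: ("{finite, linorder}") finite
proof
  show "finite (UNIV :: 'a ltri set)"
  proof (rule finite_imageD)
    show "finite (Rep_ltri ` (UNIV :: 'a ltri set))" by simp
    show "inj (Rep_ltri :: 'a ltri \<Rightarrow> _)" by (simp add: inj_def Rep_ltri_inject)
  qed
qed

definition outer :: "real ^ 'n \<Rightarrow> real ^ 'm \<Rightarrow> real ^ 'm ^ 'n" where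
  "outer v w = (\<chi> i j. v $ i * w $ j)"

definition vech :: "real ^ ('n::{finite, linorder}) ^ ('n::{finite, linorder}) \<Rightarrow> real ^ 'n ltri" where
  "vech A = (\<chi> t. A $ fst (Rep_ltri t) $ snd (Rep_ltri t))"

definition stack :: "real ^ 'a \<Rightarrow> real ^ 'b \<Rightarrow> real ^ ('a + 'b)" where
  "stack u v = (\<chi> k. case k of Inl a \<Rightarrow> u $ a | Inr b \<Rightarrow> v $ b)"

definition Sigma_of :: "real ^ ('n ltri + 'n::{finite, linorder}) \<Rightarrow> real ^ ('n::{finite, linorder}) ^ ('n::{finite, linorder})" where
  "Sigma_of x = (\<chi> i j. x $ Inl (Abs_ltri (max i j, min i j)))"

definition Gamma_of :: "real ^ ('n ltri + 'n::{finite, linorder}) \<Rightarrow> real ^ ('n::{finite, linorder})" where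
  "Gamma_of x = (\<chi> i. x $ Inr i)"

definition dom_D :: "(real ^ ('n ltri + 'n::{finite, linorder})) set" where
  "dom_D = {x. det (Sigma_of x) > 0}"

text \<open>Only the values (and the derivative) of \<open>g_map\<close> on the open set \<open>dom_D\<close> are meaningful.\<close>

definition g_map :: "real ^ ('n ltri + 'n::{finite, linorder}) \<Rightarrow> real ^ ('n::{finite, linorder})" where
  "g_map x = matrix_inv (Sigma_of x) *v Gamma_of x"

text \<open>
  \<open>Sigma_of x\<close> and \<open>Gamma_of x\<close> are the unique symmetric matrix and vector that x stacks.
\<close>

lemma Abs_ltri_max_min:
  "Rep_ltri (Abs_ltri (max i j, min i j)) = (max i j, min i (j :: 'n::linorder))"
  by (rule Abs_ltri_inverse) (auto simp: max_def min_def)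

lemma transpose_Sigma_of: "transpose (Sigma_of x) = Sigma_of x"
  by (simp add: transpose_def Sigma_of_def vec_eq_iff max.commute min.commute)

lemma stack_Sigma_of_Gamma_of: "stack (vech (Sigma_of x)) (Gamma_of x) = x"
proof -
  have "Abs_ltri (max (fst (Rep_ltri t)) (snd (Rep_ltri t)), min (fst (Rep_ltri t)) (snd (Rep_ltri t))) = t"
    for t :: "'a ltri"
  proof -
    have "snd (Rep_ltri t) \<le> fst (Rep_ltri t)"
      using Rep_ltri[of t] by auto
    then show ?thesis
      by (simp add: max_def min_def Rep_ltri_inverse)
        (metis Rep_ltri_inverse order.antisym prod.collapse)
  qed
  then show ?thesis
    by (auto simp: stack_def vech_def Sigma_of_def Gamma_of_def vec_eq_iff split: sum.splits)
qed

lemma Sigma_of_stack: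
  assumes "transpose A = A"
  shows "Sigma_of (stack (vech A) b) = A" and "Gamma_of (stack (vech A) b) = b"
proof -
  have sym: "A $ i $ j = A $ j $ i" for i j
    using assms by (metis transpose_def vec_lambda_beta)
  show "Sigma_of (stack (vech A) b) = A"
    by (simp add: stack_def vech_def Sigma_of_def vec_eq_iff Abs_ltri_max_min)
      (auto simp: max_def min_def intro: sym)
  show "Gamma_of (stack (vech A) b) = b"
    by (simp add: Gamma_of_def stack_def vec_eq_iff)
qed

definition cov_mat :: "'w measure \<Rightarrow> ('w \<Rightarrow> real ^ 'n) \<Rightarrow> real ^ 'n ^ 'n" where
  "cov_mat M Z = (\<chi> i j. LINT \<omega>|M. (Z \<omega> $ i - (LINT \<omega>'|M. Z \<omega>' $ i)) * (Z \<omega> $ j - (LINT \<omega>'|M. Z \<omega>' $ j)))"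

text \<open>Meant for symmetric matrices, whose set of real eigenvalues is finite and nonempty.\<close>

definition lambda_max :: "real ^ 'n ^ 'n \<Rightarrow> real" where
  "lambda_max A = Max {l. \<exists>v. v \<noteq> 0 \<and> A *v v = l *\<^sub>R v}"

text \<open>
  Sequences are indexed from 0: \<open>Z i\<close> is the (i+1)-st member of the sequence.
\<close>

definition seq_law :: "'w measure \<Rightarrow> (nat \<Rightarrow> 'w \<Rightarrow> 'a::topological_space) \<Rightarrow> (nat \<Rightarrow> 'a) measure" where
  "seq_law M Z = distr M (\<Pi>\<^sub>M i\<in>UNIV. borel) (\<lambda>\<omega> i. Z i \<omega>)"

definition stationary_seq :: "'w measure \<Rightarrow> (nat \<Rightarrow> 'w \<Rightarrow> 'a::topological_space) \<Rightarrow> bool" where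
  "stationary_seq M Z \<longleftrightarrow> seq_law M (\<lambda>i. Z (Suc i)) = seq_law M Z"

definition ergodic_seq :: "'w measure \<Rightarrow> (nat \<Rightarrow> 'w \<Rightarrow> 'a::topological_space) \<Rightarrow> bool" where
  "ergodic_seq M Z \<longleftrightarrow>
     (\<forall>A \<in> sets (\<Pi>\<^sub>M i\<in>(UNIV :: nat set). (borel :: 'a measure)).
        {s. (\<lambda>i. s (Suc i)) \<in> A} = A \<longrightarrow> measure (seq_law M Z) A \<in> {0, 1})"

text \<open>
  The library's \<open>indep_var\<close> requires both variables to have the same value type, hence the
  formulation by generated sigma-algebras.
\<close>

definition indep_seq ::
  "'w measure \<Rightarrow> (nat \<Rightarrow> 'w \<Rightarrow> 'a::topological_space) \<Rightarrow> (nat \<Rightarrow> 'w \<Rightarrow> 'b::topological_space) \<Rightarrow> bool" where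
  "indep_seq M Z Z' \<longleftrightarrow>
     prob_space.indep_set M
       (sets (vimage_algebra (space M) (\<lambda>\<omega> i. Z i \<omega>) (\<Pi>\<^sub>M i\<in>(UNIV :: nat set). borel)))
       (sets (vimage_algebra (space M) (\<lambda>\<omega> i. Z' i \<omega>) (\<Pi>\<^sub>M i\<in>(UNIV :: nat set). borel)))"

definition law_support :: "'w measure \<Rightarrow> ('w \<Rightarrow> 'a::topological_space) \<Rightarrow> 'a set" where
  "law_support M Z = {x. \<forall>S. open S \<and> x \<in> S \<longrightarrow> measure M {\<omega> \<in> space M. Z \<omega> \<in> S} > 0}"

text \<open>Conditioning on Z is conditioning on this sub-sigma-algebra of M.\<close>

definition sigma_gen :: "'w measure \<Rightarrow> ('w \<Rightarrow> 'a::topological_space) \<Rightarrow> 'w measure" where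
  "sigma_gen M Z = vimage_algebra (space M) Z borel"

definition quantile :: "real measure \<Rightarrow> real \<Rightarrow> real" where
  "quantile N u = Inf {x. u \<le> cdf N x}"

definition chi_squared :: "nat \<Rightarrow> real measure" where
  "chi_squared k =
     distr (\<Pi>\<^sub>M i\<in>{..<k}. std_normal_distribution) borel (\<lambda>z. \<Sum>i<k. (z i)\<^sup>2)"

text \<open>
  The p regressors are indexed by a finite linearly ordered type \<open>'p\<close>, the m = p + 1 coefficients
  by \<open>'p option\<close>, where \<open>None\<close> is the intercept.
\<close>

definition design :: "real ^ 'p \<Rightarrow> real ^ 'p option" where
  "design x = (\<chi> j. case j of None \<Rightarrow> 1 | Some l \<Rightarrow> x $ l)"

definition moment_vec ::
  "real ^ ('p::{finite, linorder}) \<Rightarrow> real \<Rightarrow> real ^ ('p option ltri + 'p option)" where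
  "moment_vec x y = stack (vech (outer (design x) (design x))) (y *\<^sub>R design x)"

definition smooth_mean ::
  "'w measure \<Rightarrow> (nat \<Rightarrow> 'w \<Rightarrow> real ^ 'q) \<Rightarrow> (nat \<Rightarrow> 'w \<Rightarrow> real) \<Rightarrow> (real \<Rightarrow> real) \<Rightarrow> (nat \<Rightarrow> real)
    \<Rightarrow> nat \<Rightarrow> 'w \<Rightarrow> real ^ 'q" where
  "smooth_mean M U V K h n \<omega> =
     (1 / (real n * (LINT \<omega>'|M. K (V 0 \<omega>' / h n)))) *\<^sub>R (\<Sum>i<n. K (V i \<omega> / h n) *\<^sub>R U i \<omega>)"

definition c2 :: "(real \<Rightarrow> real) \<Rightarrow> real" where
  "c2 K = (LINT u|lborel. (K u)\<^sup>2)"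

definition Sigma_mu_hat ::
  "(nat \<Rightarrow> 'w \<Rightarrow> real ^ 'q) \<Rightarrow> (real \<Rightarrow> real) \<Rightarrow> (real \<Rightarrow> real) \<Rightarrow> nat \<Rightarrow> 'w \<Rightarrow> real ^ 'q ^ 'q" where
  "Sigma_mu_hat U K f n \<omega> = (c2 K / f 0) *\<^sub>R ((1 / real n) *\<^sub>R (\<Sum>i<n. outer (U i \<omega>) (U i \<omega>)))"

end

theory Submission
  imports Defs
begin

text \<open>
  With \<open>residual b x = Gamma_of x - Sigma_of x *v b\<close> one has, exactly,
  \<open>g_map x - b = matrix_inv (Sigma_of x) *v residual b x\<close>, and \<open>residual beta \<mu> = 0\<close>.  So the
  estimation error is a matrix converging in probability times a fixed linear image of
  \<open>smooth_mean - \<mu>\<close>, and no delta method is needed beyond the Jacobian in the variance estimator.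

  Averaging first over \<open>V\<close> for fixed \<open>U\<close>, Lindeberg's comparison of characteristic functions
  together with the ergodic theorem for \<open>(w \<bullet> U i)\<^sup>2\<close> gives the limit of the characteristic function
  of \<open>w \<bullet> Z\<close>, where \<open>Z = sqrt (n h) (smooth_mean - \<mu>)\<close>; the condition on \<open>lambda_max\<close> removes
  the centring error.

  No multivariate continuity theorem is used: since \<open>exp (- x\<^sup>2 / 2)\<close> is the characteristic function
  of a standard normal variable, integrating characteristic functions against independent Gaussian
  coefficients yields the Laplace transforms of sums of squares of linear forms in \<open>Z\<close>.  They give
  tightness of \<open>Z\<close> and the chi-squared limit of the Wald statistic, of which the confidence interval
  is the case of a single coordinate.
\<close>

section \<open>Birkhoff's ergodic theorem for stationary ergodic sequences\<close>

text \<open>The sequence \<open>U\<close> is ergodic but its terms may be dependent, so normality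
  has to come from the independent kernel weights. Both the mean and the second moment of
  \<open>K (V / h)\<close> are of order h. The squared mean is therefore of smaller order than the
  second moment and drops out of the variance. This is why the limit variance
  \<open>c2 K / f 0\<close> times the mean of \<open>(w \<bullet> U 0)\<^sup>2\<close> is an
  uncentred second moment, and why \<open>Sigma_mu_hat\<close> averages uncentred products. The
  limit matrix of the smoothed mean is used only through its nonnegative quadratic form; positive
  definiteness is proved after passing to the coefficients. There a moment vector is mapped to the
  noise times a linear form in the design vector, and degeneracy is excluded by the positive
  conditional variance of the noise together with \<open>det \<Sigma> > 0\<close>. The random
  matrices in the Wald statistic are replaced by their limits inside one quadratic form in
  \<open>Z\<close>: the error is at most \<open>(norm Z)\<^sup>2\<close> times the distance of the
  matrices, a tight factor times a vanishing one.\<close>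

abbreviation (input) shift :: "(nat \<Rightarrow> 'a) \<Rightarrow> nat \<Rightarrow> 'a" where
  "shift s \<equiv> \<lambda>i. s (Suc i)"

text \<open>Equals the maximum of the partial sums of \<open>F (s i)\<close> over the first k terms,
  0 \<le> k \<le> n. The recursion through the shifted sequence is the identity on which the maximal
  inequality rests.\<close>

primrec garsia_max :: "('a \<Rightarrow> real) \<Rightarrow> nat \<Rightarrow> (nat \<Rightarrow> 'a) \<Rightarrow> real" where
  "garsia_max F 0 s = 0"
| "garsia_max F (Suc n) s = max 0 (F (s 0) + garsia_max F n (shift s))"

lemma garsia_max_nonneg: "garsia_max F n s \<ge> 0"
  by (cases n) auto

lemma garsia_max_mono: "garsia_max F n s \<le> garsia_max F (Suc n) s"
proof (induction n arbitrary: s)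
  case (Suc n)
  show ?case using Suc[of "shift s"] unfolding garsia_max.simps(2)[of F "Suc n"] garsia_max.simps(2)[of F n s] by linarith
qed simp

lemma sum_le_garsia_max: "(\<Sum>i<n. F (s i)) \<le> garsia_max F n s"
proof (induction n arbitrary: s)
  case (Suc n)
  show ?case
    using Suc[of "shift s"] unfolding sum.lessThan_Suc_shift garsia_max.simps by linarith
qed simp

lemma measurable_shift:
  "shift \<in> measurable (\<Pi>\<^sub>M i\<in>UNIV. borel) (\<Pi>\<^sub>M i\<in>(UNIV::nat set). borel)"
  by (rule measurable_PiM_single') auto

lemma measurable_garsia_max:
  assumes [measurable]: "F \<in> borel_measurable borel"
  shows "garsia_max F n \<in> borel_measurable (\<Pi>\<^sub>M i\<in>(UNIV::nat set). borel)"
proof (induction n)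
  case (Suc n)
  note [measurable] = Suc.IH measurable_shift
  show ?case unfolding garsia_max.simps by measurable
qed simp

context
  fixes N :: "(nat \<Rightarrow> 'a::topological_space) measure"
  assumes prob_N: "prob_space N"
    and sets_N: "sets N = sets (\<Pi>\<^sub>M i\<in>(UNIV::nat set). (borel :: 'a measure))"
    and inv_N: "distr N N shift = N"
begin

lemma shift_measurable: "shift \<in> measurable N N"
  using measurable_shift measurable_cong_sets[OF sets_N sets_N] by blast

lemma integral_shift: 
  fixes g :: "_ \<Rightarrow> real"
  assumes "g \<in> borel_measurable N"
  shows "(LINT s|N. g (shift s)) = (LINT s|N. g s)"
    and "integrable N (\<lambda>s. g (shift s)) \<longleftrightarrow> integrable N g"
  using integral_distr[OF shift_measurable assms] integrable_distr_eq[OF shift_measurable assms]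
  by (simp_all add: inv_N)

lemma integrable_garsia_max:
  assumes F[measurable]: "F \<in> borel_measurable borel" and int: "integrable N (\<lambda>s. F (s 0))"
  shows "integrable N (garsia_max F n)"
proof (induction n)
  case (Suc n)
  have m: "garsia_max F n \<in> borel_measurable N"
    using measurable_garsia_max[OF F] measurable_cong_sets[OF sets_N refl] by blast
  show ?case
    unfolding garsia_max.simps
    by (intro integrable_max Bochner_Integration.integrable_add int) (use Suc integral_shift(2)[OF m] in auto)
qed simp

text \<open>
  Garsia's argument: \<open>F\<close> dominates \<open>garsia_max F n - garsia_max F n \<circ> shift\<close> wherever
  \<open>garsia_max F n\<close> is positive, and the latter difference integrates to 0.
\<close>
lemma maximal_ergodic:
  assumes F[measurable]: "F \<in> borel_measurable borel" and int: "integrable N (\<lambda>s. F (s 0))"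
  shows "(LINT s|N. F (s 0) * indicator {s. garsia_max F (Suc n) s > 0} s) \<ge> 0"
proof -
  have m[measurable]: "garsia_max F n \<in> borel_measurable N" for n
    using measurable_garsia_max[OF F] measurable_cong_sets[OF sets_N refl] by blast
  let ?m = "garsia_max F (Suc n)"
  have iM: "integrable N ?m" by (rule integrable_garsia_max[OF assms])
  have "{s. ?m s > 0} = {s\<in>space N. ?m s > 0}"
    using sets_eq_imp_space_eq[OF sets_N] by (auto simp: space_PiM)
  also have "\<dots> \<in> sets N" by measurable
  finally have meas: "{s. ?m s > 0} \<in> sets N" .
  have iL: "integrable N (\<lambda>s. F (s 0) * indicator {s. ?m s > 0} s)"
    by (rule integrable_real_mult_indicator[OF meas int])
  have iS: "integrable N (\<lambda>s. ?m (shift s))"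
    using iM integral_shift(2)[OF m[of "Suc n"]] by blast
  have "0 = (LINT s|N. ?m s - ?m (shift s))"
    using integral_shift(1)[OF m[of "Suc n"]]
    unfolding Bochner_Integration.integral_diff[OF iM iS] by linarith
  also have "\<dots> \<le> (LINT s|N. F (s 0) * indicator {s. ?m s > 0} s)"
  proof (rule integral_mono[OF _ iL])
    show "integrable N (\<lambda>s. ?m s - ?m (shift s))" by (rule Bochner_Integration.integrable_diff[OF iM iS])
    fix s
    show "?m s - ?m (shift s) \<le> F (s 0) * indicator {s. ?m s > 0} s"
      using garsia_max_mono[of F n "shift s"] garsia_max_nonneg[of F "Suc n" "shift s"]
      by (auto simp: indicator_def max_def split: if_splits simp del: garsia_max.simps)
        (auto simp: max_def)
  qed
  finally show ?thesis .
qed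

text \<open>Shifting changes the partial sums only by the term \<open>F (s 0)\<close>, so
  unboundedness is an invariant event and has probability 0 or 1. Probability 1 would let the
  indicators in \<open>maximal_ergodic\<close> tend to 1 almost surely, making the mean of
  \<open>F\<close> nonnegative.\<close>

lemma partial_sums_bounded_above:
  assumes F[measurable]: "F \<in> borel_measurable borel" and int: "integrable N (\<lambda>s. F (s 0))"
    and neg: "(LINT s|N. F (s 0)) < (0::real)"
    and erg: "\<And>A. A \<in> sets N \<Longrightarrow> shift -` A = A \<Longrightarrow> measure N A \<in> {0, 1}"
  shows "AE s in N. bdd_above (range (\<lambda>n. \<Sum>i<n. F (s i)))"
proof -
  interpret N: prob_space N by (rule prob_N)
  have sp: "space N = UNIV"
    using sets_eq_imp_space_eq[OF sets_N] by (auto simp: space_PiM)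
  have m[measurable]: "garsia_max F n \<in> borel_measurable N" for n
    using measurable_garsia_max[OF F] measurable_cong_sets[OF sets_N refl] by blast
  have comp[measurable]: "(\<lambda>s. s i) \<in> measurable N borel" for i
    using measurable_component_singleton[of i UNIV "\<lambda>_. borel"] measurable_cong_sets[OF sets_N refl]
    by blast
  let ?A = "{s. \<not> bdd_above (range (\<lambda>n. \<Sum>i<n. F (s i)))}"
  \<comment> \<open>Bounds ranging over the naturals turn the event into a countable combination of
    measurable ones.\<close>
  have A_eq: "?A = {s\<in>space N. \<forall>b::nat. \<exists>n. (\<Sum>i<n. F (s i)) > real b}" (is "_ = ?B")
  proof -
    have "bdd_above (range (\<lambda>n. \<Sum>i<n. F (s i))) \<longleftrightarrow> (\<exists>b::nat. \<forall>n. (\<Sum>i<n. F (s i)) \<le> real b)" for s :: "nat \<Rightarrow> 'a"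
      unfolding bdd_above_def by (auto, meson dual_order.trans real_arch_simple)
    then show ?thesis by (auto simp: sp not_le)
  qed
  have "?B \<in> sets N" by measurable
  then have A_sets: "?A \<in> sets N" using A_eq by simp
  have A_inv: "shift -` ?A = ?A"
  proof -
    have "bdd_above (range (\<lambda>n. \<Sum>i<n. F (shift s i))) \<longleftrightarrow> bdd_above (range (\<lambda>n. \<Sum>i<n. F (s i)))" for s
    proof
      assume "bdd_above (range (\<lambda>n. \<Sum>i<n. F (shift s i)))"
      then obtain b where b: "\<And>n. (\<Sum>i<n. F (shift s i)) \<le> b" by (auto simp: bdd_above_def)
      have "(\<Sum>i<n. F (s i)) \<le> max 0 (F (s 0) + b)" for n
        using b[of "n - 1"] by (cases n) (auto simp: sum.lessThan_Suc_shift simp del: sum.lessThan_Suc)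
      then show "bdd_above (range (\<lambda>n. \<Sum>i<n. F (s i)))" by (auto simp: bdd_above_def)
    next
      assume "bdd_above (range (\<lambda>n. \<Sum>i<n. F (s i)))"
      then obtain b where b: "\<And>n. (\<Sum>i<n. F (s i)) \<le> b" by (auto simp: bdd_above_def)
      have "(\<Sum>i<n. F (shift s i)) \<le> b - F (s 0)" for n
        using b[of "Suc n"] by (simp add: sum.lessThan_Suc_shift del: sum.lessThan_Suc)
      then show "bdd_above (range (\<lambda>n. \<Sum>i<n. F (shift s i)))" by (auto simp: bdd_above_def)
    qed
    then show ?thesis by auto
  qed
  have "measure N ?A \<noteq> 1"
  proof
    assume "measure N ?A = 1"
    then have AE_A: "AE s in N. s \<in> ?A"
      using N.prob_eq_1 A_sets by blast
    let ?g = "\<lambda>n s. F (s 0) * indicator {s. garsia_max F (Suc n) s > 0} s"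
    \<comment> \<open>On \<open>?A\<close> some partial sum is positive; from that index on
      \<open>garsia_max\<close> is positive by monotonicity and the indicator is constantly
      1.\<close>
    have "(\<lambda>n. LINT s|N. ?g n s) \<longlonglongrightarrow> (LINT s|N. F (s 0))"
    proof (rule integral_dominated_convergence[where w="\<lambda>s. \<bar>F (s 0)\<bar>"])
      show "AE s in N. (\<lambda>n. ?g n s) \<longlonglongrightarrow> F (s 0)"
        using AE_A
      proof eventually_elim
        case (elim s)
        obtain n where n: "(\<Sum>i<n. F (s i)) > 0"
          using elim unfolding bdd_above_def by (auto simp: not_le)
        have inc: "incseq (\<lambda>n. garsia_max F n s)" by (intro incseq_SucI garsia_max_mono)
        have "garsia_max F (Suc k) s > 0" if "k \<ge> n" for k
          using sum_le_garsia_max[of F s n] n incseqD[OF inc, of n "Suc k"] that by linarith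
        then have "eventually (\<lambda>k. ?g k s = F (s 0)) sequentially"
          unfolding eventually_sequentially by (intro exI[of _ n]) (auto simp del: garsia_max.simps)
        then show ?case by (rule tendsto_eventually)
      qed
      show "?g n \<in> borel_measurable N" for n
      proof -
        have "{s\<in>space N. garsia_max F (Suc n) s > 0} \<in> sets N" by measurable
        then have [measurable]: "{s. garsia_max F (Suc n) s > 0} \<in> sets N" by (simp add: sp del: garsia_max.simps)
        show ?thesis by measurable
      qed
    qed (use int in \<open>auto simp: indicator_def abs_mult simp del: garsia_max.simps\<close>)
    then have "(LINT s|N. F (s 0)) \<ge> 0"
      by (rule LIMSEQ_le_const) (use maximal_ergodic[OF F int] in auto)
    with neg show False by simp
  qed
  with erg[OF A_sets A_inv] have "measure N ?A = 0" by simp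
  then have "AE s in N. s \<notin> ?A"
    using N.prob_eq_0 A_sets by blast
  then show ?thesis by eventually_elim auto
qed

end

text \<open>An upper bound b of the centred sums contributes at most b / n to the average.\<close>

lemma limsup_average_le:
  fixes a :: "nat \<Rightarrow> real"
  assumes "bdd_above (range (\<lambda>n. \<Sum>i<n. a i - c))" and "e > 0"
  shows "eventually (\<lambda>n. (\<Sum>i<n. a i) / real n < c + e) sequentially"
proof -
  obtain b where b: "\<And>n. (\<Sum>i<n. a i - c) \<le> b" using assms(1) by (auto simp: bdd_above_def)
  have "eventually (\<lambda>n. real n > b / e) sequentially"
    using filterlim_at_top_dense filterlim_real_sequentially by blast
  then show ?thesis
    using eventually_gt_at_top[of 0]
  proof eventually_elim
    case (elim n)
    have "(\<Sum>i<n. a i) - real n * c \<le> b" using b[of n] by (simp add: sum_subtractf)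
    moreover have "b < real n * e" using elim assms(2) by (simp add: field_simps)
    ultimately have "(\<Sum>i<n. a i) < (c + e) * real n" by (simp add: algebra_simps)
    then show ?case using elim by (simp add: divide_less_eq)
  qed
qed

section \<open>Pathwise averages of a stationary ergodic process\<close>

context
  fixes M :: "'w measure" and Z :: "nat \<Rightarrow> 'w \<Rightarrow> 'a::topological_space"
  assumes prob: "prob_space M"
    and Z_meas[measurable]: "\<And>i. Z i \<in> borel_measurable M"
    and stat: "stationary_seq M Z"
begin

lemma seq_measurable: "(\<lambda>x i. Z i x) \<in> measurable M (\<Pi>\<^sub>M i\<in>(UNIV::nat set). borel)"
  by (rule measurable_PiM_single') auto

lemma stationary_distr_eq: "distr M borel (Z i) = distr M borel (Z 0)"
proof (induction i)
  case (Suc i)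
  let ?P = "\<Pi>\<^sub>M i\<in>(UNIV::nat set). (borel::'a measure)"
  have m1: "(\<lambda>x i. Z (Suc i) x) \<in> measurable M ?P" by (rule measurable_PiM_single') auto
  have c: "(\<lambda>s. s i) \<in> measurable ?P borel" by simp
  have "distr M borel (Z (Suc i)) = distr (seq_law M (\<lambda>i. Z (Suc i))) borel (\<lambda>s. s i)"
    unfolding seq_law_def by (subst distr_distr[OF c m1]) (simp add: comp_def)
  also have "\<dots> = distr (seq_law M Z) borel (\<lambda>s. s i)"
    using stat by (simp add: stationary_seq_def)
  also have "\<dots> = distr M borel (Z i)"
    unfolding seq_law_def by (subst distr_distr[OF c seq_measurable]) (simp add: comp_def)
  finally show ?case using Suc by simp
qed simp

lemma ergodic_partial_sums_bounded:
  assumes erg: "ergodic_seq M Z"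
    and F: "F \<in> borel_measurable borel" and int: "integrable M (\<lambda>x. F (Z 0 x))"
    and neg: "(LINT x|M. F (Z 0 x)) < (0::real)"
  shows "AE x in M. bdd_above (range (\<lambda>n. \<Sum>i<n. F (Z i x)))"
proof -
  let ?P = "\<Pi>\<^sub>M i\<in>(UNIV::nat set). (borel::'a measure)"
  let ?N = "seq_law M Z"
  have sN: "sets ?N = sets ?P" by (simp add: seq_law_def)
  have pN: "prob_space ?N"
    unfolding seq_law_def by (rule prob_space.prob_space_distr[OF prob seq_measurable])
  have spN: "space ?N = UNIV"
    using sets_eq_imp_space_eq[OF sN] by (auto simp: space_PiM)
  have c0: "(\<lambda>s. F (s 0)) \<in> borel_measurable ?P" using F by measurable
  have "distr ?N ?N shift = distr ?N ?P shift"
    by (rule distr_cong) (auto simp: sN)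
  also have "\<dots> = seq_law M (\<lambda>i. Z (Suc i))"
    unfolding seq_law_def by (subst distr_distr[OF measurable_shift seq_measurable]) (simp add: comp_def)
  also have "\<dots> = ?N" using stat by (simp add: stationary_seq_def)
  finally have inv: "distr ?N ?N shift = ?N" .
  have "AE s in ?N. bdd_above (range (\<lambda>n. \<Sum>i<n. F (s i)))"
  proof (rule partial_sums_bounded_above[OF pN sN inv F])
    show "integrable ?N (\<lambda>s. F (s 0))"
      unfolding seq_law_def using int by (subst integrable_distr_eq[OF seq_measurable c0])
    show "(LINT s|?N. F (s 0)) < 0"
      unfolding seq_law_def using neg by (subst integral_distr[OF seq_measurable c0])
    fix A assume "A \<in> sets ?N" "shift -` A = A"
    then show "measure ?N A \<in> {0, 1}"
      using erg unfolding ergodic_seq_def sN[symmetric] by (auto simp: vimage_def)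
  qed
  then show ?thesis
    unfolding seq_law_def by (rule AE_distrD[OF seq_measurable])
qed

lemma ergodic_average_less:
  assumes erg: "ergodic_seq M Z"
    and F: "F \<in> borel_measurable borel" and int: "integrable M (\<lambda>x. F (Z 0 x))" and e: "e > (0::real)"
  shows "AE x in M. eventually (\<lambda>n. (\<Sum>i<n. F (Z i x)) / real n < (LINT x|M. F (Z 0 x)) + e) sequentially"
proof -
  interpret prob_space M by (rule prob)
  \<comment> \<open>Half of \<open>e\<close> makes the mean of the centred variable strictly
    negative; the other half absorbs the bounded sums in \<open>limsup_average_le\<close>.\<close>
  let ?c = "(LINT x|M. F (Z 0 x)) + e / 2"
  have "AE x in M. bdd_above (range (\<lambda>n. \<Sum>i<n. F (Z i x) - ?c))"
    by (rule ergodic_partial_sums_bounded[OF erg]) (use F int e in \<open>auto simp: prob_space\<close>)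
  then show ?thesis
  proof eventually_elim
    case (elim x)
    from limsup_average_le[OF elim, of "e / 2"] e show ?case
      by (auto simp: algebra_simps)
  qed
qed

text \<open>The one-sided estimate is applied to \<open>F\<close> and to its negative. Margins 1 /
  (k + 1) keep the number of exceptional null sets countable.\<close>

theorem ergodic_theorem:
  assumes erg: "ergodic_seq M Z"
    and F: "F \<in> borel_measurable borel" and int: "integrable M (\<lambda>y. F (Z 0 y))"
  shows "AE y in M. (\<lambda>n. (\<Sum>i<n. F (Z i y)) / real n) \<longlonglongrightarrow> (LINT y|M. F (Z 0 y) :: real)"
proof -
  let ?I = "LINT y|M. F (Z 0 y)"
  have "AE y in M. \<forall>k. eventually (\<lambda>n. (\<Sum>i<n. F (Z i y)) / real n < ?I + 1 / real (Suc k)) sequentially"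
    unfolding AE_all_countable by (intro allI ergodic_average_less[OF erg F int]) auto
  moreover have "AE y in M. \<forall>k. eventually (\<lambda>n. (\<Sum>i<n. - F (Z i y)) / real n < (LINT y|M. - F (Z 0 y)) + 1 / real (Suc k)) sequentially"
    unfolding AE_all_countable
    by (intro allI ergodic_average_less[where F="\<lambda>x. - F x", OF erg]) (use F int in auto)
  ultimately show ?thesis
  proof eventually_elim
    case (elim y)
    show ?case
    proof (rule order_tendstoI)
      fix a assume "a < ?I"
      then obtain k where k: "1 / real (Suc k) < ?I - a"
        using reals_Archimedean[of "?I - a"] by (auto simp: inverse_eq_divide)
      from elim(2)[rule_format, of k] show "eventually (\<lambda>n. a < (\<Sum>i<n. F (Z i y)) / real n) sequentially"
        by eventually_elim (use k in \<open>auto simp: sum_negf\<close>)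
    next
      fix a assume "a > ?I"
      then obtain k where k: "1 / real (Suc k) < a - ?I"
        using reals_Archimedean[of "a - ?I"] by (auto simp: inverse_eq_divide)
      from elim(1)[rule_format, of k] show "eventually (\<lambda>n. a > (\<Sum>i<n. F (Z i y)) / real n) sequentially"
        by eventually_elim (use k in auto)
    qed
  qed
qed

end

section \<open>Events of high probability and weak convergence\<close>

text \<open>
  Only the witnessing event has to be measurable, not \<open>P n\<close>: this spares measurability proofs for
  matrix-valued estimators.
\<close>
abbreviation likely :: "'w measure \<Rightarrow> real \<Rightarrow> ('w \<Rightarrow> bool) \<Rightarrow> bool" where
  "likely M e P \<equiv> \<exists>E\<in>sets M. measure M E > 1 - e \<and> (\<forall>\<omega>\<in>E. P \<omega>)"

definition whp :: "'w measure \<Rightarrow> (nat \<Rightarrow> 'w \<Rightarrow> bool) \<Rightarrow> bool" where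
  "whp M P \<longleftrightarrow> (\<forall>e>0. \<forall>\<^sub>F n in sequentially. likely M e (P n))"

definition tight_seq :: "'w measure \<Rightarrow> (nat \<Rightarrow> 'w \<Rightarrow> 'b::real_normed_vector) \<Rightarrow> bool" where
  "tight_seq M Z \<longleftrightarrow> (\<forall>e>0. \<exists>r. \<forall>\<^sub>F n in sequentially. likely M e (\<lambda>\<omega>. norm (Z n \<omega>) \<le> r))"

lemma whp_mono:
  assumes "whp M P" and "\<forall>\<^sub>F n in sequentially. \<forall>x\<in>space M. P n x \<longrightarrow> Q n x"
  shows "whp M Q"
  unfolding whp_def
proof (intro allI impI)
  fix e :: real assume "e > 0"
  with assms(1) have "\<forall>\<^sub>F n in sequentially. likely M e (\<lambda>x. P n x)"
    by (simp add: whp_def)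
  with assms(2) show "\<forall>\<^sub>F n in sequentially. likely M e (\<lambda>x. Q n x)"
    by eventually_elim (use sets.sets_into_space in blast)
qed

context prob_space
begin

lemma prob_Int_greater:
  assumes "E \<in> events" "F \<in> events" "prob E > 1 - a" "prob F > 1 - b"
  shows "prob (E \<inter> F) > 1 - (a + b)"
proof -
  have "prob (E \<union> F) + prob (E \<inter> F) = prob E + prob F"
    using assms by (simp add: finite_measure_Union' Int_commute finite_measure_Diff')
  moreover have "prob (E \<union> F) \<le> 1" by simp
  ultimately show ?thesis using assms by linarith
qed

lemma whp_conj:
  assumes "whp M P" "whp M Q"
  shows "whp M (\<lambda>n x. P n x \<and> Q n x)"
  unfolding whp_def
proof (intro allI impI)
  fix e :: real assume "e > 0"
  then have "e / 2 > 0" by simp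
  with assms have "\<forall>\<^sub>F n in sequentially. likely M (e / 2) (\<lambda>x. P n x)"
    "\<forall>\<^sub>F n in sequentially. likely M (e / 2) (\<lambda>x. Q n x)"
    by (simp_all only: whp_def)
  then show "\<forall>\<^sub>F n in sequentially. likely M e (\<lambda>x. P n x \<and> Q n x)"
  proof eventually_elim
    case (elim n)
    then obtain E F where EF: "E \<in> events" "F \<in> events" "prob E > 1 - e / 2" "prob F > 1 - e / 2"
      "\<forall>x\<in>E. P n x" "\<forall>x\<in>F. Q n x" by blast
    show ?case
      using prob_Int_greater[OF EF(1-4)] EF by (intro bexI[of _ "E \<inter> F"]) auto
  qed
qed

lemma whp_AE_tendsto:
  fixes Z :: "nat \<Rightarrow> 'a \<Rightarrow> 'b::{second_countable_topology, metric_space}"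
  assumes [measurable]: "\<And>n. Z n \<in> borel_measurable M"
    and lim: "AE x in M. (\<lambda>n. Z n x) \<longlonglongrightarrow> c" and e: "e > 0"
  shows "whp M (\<lambda>n x. dist (Z n x) c < e)"
  unfolding whp_def
proof (intro allI impI)
  let ?E = "\<lambda>n. {x\<in>space M. dist (Z n x) c < e}"
  fix d :: real assume d: "d > 0"
  have ev[measurable]: "?E n \<in> events" for n by measurable
  have "(\<lambda>n. LINT x|M. indicator (?E n) x :: real) \<longlonglongrightarrow> (LINT x|M. 1)"
  proof (rule integral_dominated_convergence[where w="\<lambda>_. 1"])
    show "AE x in M. (\<lambda>n. indicator (?E n) x :: real) \<longlonglongrightarrow> 1"
      using lim AE_space
    proof eventually_elim
      case (elim x)
      have "eventually (\<lambda>n. dist (Z n x) c < e) sequentially"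
        using elim(1) e by (rule tendstoD)
      then show ?case
        by (intro tendsto_eventually) (auto elim!: eventually_mono simp: elim(2))
    qed
  qed auto
  then have "(\<lambda>n. prob (?E n)) \<longlonglongrightarrow> 1" by (simp add: prob_space)
  then have "eventually (\<lambda>n. prob (?E n) > 1 - d) sequentially"
    by (rule order_tendstoD) (use d in auto)
  then show "\<forall>\<^sub>F n in sequentially. likely M d (\<lambda>x. dist (Z n x) c < e)"
    by eventually_elim (use ev in blast)
qed

text \<open>Slutsky's principle in the form required for quadratic forms: the square is there
  because \<open>\<bar>z \<bullet> (Q *v z)\<bar>\<close> is at most
  \<open>(norm z)\<^sup>2 * norm Q\<close>.\<close>

lemma whp_tight_mult:
  fixes Z :: "nat \<Rightarrow> 'a \<Rightarrow> 'b::real_normed_vector"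
  assumes t: "tight_seq M Z" and c: "\<And>e. e > 0 \<Longrightarrow> whp M (\<lambda>n x. c n x < e)" and e: "e > (0::real)"
  shows "whp M (\<lambda>n x. (norm (Z n x))\<^sup>2 * c n x < e)"
  unfolding whp_def
proof (intro allI impI)
  fix d :: real assume "d > 0"
  then have d: "d / 2 > 0" by simp
  obtain r where r: "\<forall>\<^sub>F n in sequentially. likely M (d / 2) (\<lambda>x. norm (Z n x) \<le> r)"
    using t d unfolding tight_seq_def by blast
  \<comment> \<open>The added 1 keeps the denominator positive when \<open>r = 0\<close> and makes
    the final inequality strict.\<close>
  define b where "b = e / (r\<^sup>2 + 1)"
  have b: "b > 0" unfolding b_def using e by (intro divide_pos_pos) (auto intro: add_nonneg_pos)
  have "\<forall>\<^sub>F n in sequentially. likely M (d / 2) (\<lambda>x. c n x < b)"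
    using c[OF b] d by (simp only: whp_def)
  with r show "\<forall>\<^sub>F n in sequentially. likely M d (\<lambda>x. (norm (Z n x))\<^sup>2 * c n x < e)"
  proof eventually_elim
    case (elim n)
    then obtain E F where EF: "E \<in> events" "F \<in> events" "prob E > 1 - d / 2" "prob F > 1 - d / 2"
      "\<And>x. x\<in>E \<Longrightarrow> norm (Z n x) \<le> r" "\<And>x. x\<in>F \<Longrightarrow> c n x < b" by blast
    have "(norm (Z n x))\<^sup>2 * c n x < e" if "x \<in> E \<inter> F" for x
    proof -
      have z: "(norm (Z n x))\<^sup>2 \<le> r\<^sup>2" using EF(5)[of x] that by (intro power_mono) auto
      have "(norm (Z n x))\<^sup>2 * c n x \<le> (norm (Z n x))\<^sup>2 * b"
        using EF(6)[of x] that by (intro mult_left_mono) auto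
      also have "\<dots> \<le> r\<^sup>2 * b" using z b by (intro mult_right_mono) auto
      also have "\<dots> < (r\<^sup>2 + 1) * b" using b by (simp add: algebra_simps)
      also have "\<dots> = e"
        unfolding b_def using add_nonneg_pos[OF zero_le_power2[of r] zero_less_one] by (simp add: field_simps)
      finally show ?thesis .
    qed
    then show ?case
      using prob_Int_greater[OF EF(1-4)] EF(1,2) by (intro bexI[of _ "E \<inter> F"]) auto
  qed
qed

text \<open>On the witnessing event the two sets agree, so their probabilities differ by at most the
  probability of its complement. This carries a limit from an event about the Wald statistic to the
  coverage event.\<close>

lemma whp_prob_diff:
  assumes w: "whp M (\<lambda>n x. x \<in> A n \<longleftrightarrow> x \<in> B n)"
    and [measurable]: "\<And>n. A n \<in> events" "\<And>n. B n \<in> events"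
    and lim: "(\<lambda>n. prob (B n)) \<longlonglongrightarrow> l"
  shows "(\<lambda>n. prob (A n)) \<longlonglongrightarrow> l"
proof -
  have "(\<lambda>n. prob (A n) - prob (B n)) \<longlonglongrightarrow> 0"
  proof (rule tendstoI)
    fix e :: real assume "e > 0"
    with w have "\<forall>\<^sub>F n in sequentially. likely M e (\<lambda>x. x \<in> A n \<longleftrightarrow> x \<in> B n)"
      by (simp add: whp_def)
    then show "\<forall>\<^sub>F n in sequentially. dist (prob (A n) - prob (B n)) 0 < e"
    proof eventually_elim
      case (elim n)
      then obtain E where E[measurable]: "E \<in> events" and pE: "prob E > 1 - e"
        and eq: "\<forall>x\<in>E. x \<in> A n \<longleftrightarrow> x \<in> B n" by blast
      have half: "prob C \<le> prob D + (1 - prob E)" if "C \<in> events" "D \<in> events" "C \<inter> E \<subseteq> D" for C D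
      proof -
        have "prob C \<le> prob (D \<union> (space M - E))"
          using that E sets.sets_into_space[OF that(1)] by (intro finite_measure_mono) auto
        also have "\<dots> \<le> prob D + prob (space M - E)" using that by (intro measure_Un_le) auto
        finally show ?thesis by (simp add: prob_compl)
      qed
      have "prob (A n) \<le> prob (B n) + (1 - prob E)" "prob (B n) \<le> prob (A n) + (1 - prob E)"
        using eq by (auto intro!: half)
      then show ?case using pE by (simp add: dist_real_def)
    qed
  qed
  from tendsto_add[OF this lim] show ?thesis by simp
qed

end

text \<open>Expresses the cutoff through u = \<open>exp (- t)\<close>, with - t = ln u. Truncating
  at \<open>exp (- y)\<close> keeps the logarithm away from 0 and alters nothing, since the cutoff
  vanishes for t \<ge> y; the resulting function of u is continuous on the closed unit
  interval.\<close>

lemma cts_step_eq_exp: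
  assumes "x < y"
  shows "cts_step x y t = min 1 (max 0 ((y + ln (max (exp (- t)) (exp (- y)))) / (y - x)))"
  using assms by (auto simp: cts_step_def max_def min_def field_simps)

text \<open>
  On the half line the Laplace transforms at the natural numbers are moments of \<open>exp (- T)\<close>, which
  takes values in the unit interval, so Weierstrass's theorem applies.
\<close>
lemma laplace_transforms_imp_cts_step:
  fixes T :: "nat \<Rightarrow> 'w \<Rightarrow> real" and \<nu> :: "real measure"
  assumes M: "prob_space M" and T[measurable]: "\<And>n. T n \<in> borel_measurable M"
    and T_nonneg: "\<And>n v. T n v \<ge> 0"
    and \<nu>: "real_distribution \<nu>" and \<nu>_nonneg: "AE x in \<nu>. x \<ge> 0"
    and lim: "\<And>m. (\<lambda>n. LINT v|M. exp (- (real m * T n v))) \<longlonglongrightarrow> (LINT x|\<nu>. exp (- (real m * x)))"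
    and xy: "x < y"
  shows "(\<lambda>n. LINT v|M. cts_step x y (T n v)) \<longlonglongrightarrow> (LINT t|\<nu>. cts_step x y t)"
proof -
  interpret prob_space M by (rule M)
  interpret \<nu>: real_distribution \<nu> by (rule \<nu>)
  note [simp] = \<nu>.events_eq_borel
  have [measurable_cong]: "sets \<nu> = sets borel" by simp
  let ?\<phi> = "\<lambda>u::real. min 1 (max 0 ((y + ln (max u (exp (- y)))) / (y - x)))"
  have "max u (exp (- y)) \<noteq> 0" for u by (auto simp: max_def)
  then have cont: "continuous_on {0..1} ?\<phi>" using xy by (intro continuous_intros) auto
  have [measurable]: "cts_step x y \<in> borel_measurable borel"
    unfolding cts_step_def by measurable
  have bdd: "\<bar>cts_step x y t\<bar> \<le> 1" for t using xy by (auto simp: cts_step_def)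
  show ?thesis
  proof (rule tendstoI)
    fix e :: real assume "e > 0"
    then have e: "e / 4 > 0" by simp
    obtain g where g: "real_polynomial_function g" "\<And>u. u \<in> {0..1} \<Longrightarrow> \<bar>?\<phi> u - g u\<bar> < e / 4"
      using Stone_Weierstrass_real_polynomial_function[OF compact_Icc cont e] by (metis real_norm_def)
    obtain a N where gs: "g = (\<lambda>u. \<Sum>i\<le>N. a i * u ^ i)"
      using g(1) real_polynomial_function_iff_sum by metis
    have close: "\<bar>cts_step x y t - (\<Sum>i\<le>N. a i * exp (- (real i * t)))\<bar> < e / 4" if "t \<ge> 0" for t
      using g(2)[of "exp (- t)"] that unfolding cts_step_eq_exp[OF xy] gs
      by (simp add: exp_of_nat_mult[symmetric])
    have le1: "\<bar>exp (- (real i * t))\<bar> \<le> 1" if "t \<ge> 0" for i t using that by simp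
    have iM: "integrable M (\<lambda>v. exp (- (real i * T n v)))" for i n
      by (rule integrable_const_bound[where B=1]) (use T_nonneg in auto)
    have i\<nu>: "integrable \<nu> (\<lambda>t. exp (- (real i * t)))" for i
      by (rule \<nu>.integrable_const_bound[where B=1]) (use \<nu>_nonneg in auto)
    have cM: "integrable M (\<lambda>v. cts_step x y (T n v))" for n
      by (rule integrable_const_bound[where B=1]) (use bdd in auto)
    have c\<nu>: "integrable \<nu> (cts_step x y)"
      by (rule \<nu>.integrable_const_bound[where B=1]) (use bdd in auto)
    let ?P = "\<lambda>t. \<Sum>i\<le>N. a i * exp (- (real i * t))"
    let ?EP = "\<lambda>n. LINT v|M. ?P (T n v)" and ?NP = "LINT t|\<nu>. ?P t"
      and ?Ec = "\<lambda>n. LINT v|M. cts_step x y (T n v)" and ?Nc = "LINT t|\<nu>. cts_step x y t"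
    have PM: "integrable M (\<lambda>v. ?P (T n v))" for n using iM by auto
    have P\<nu>: "integrable \<nu> ?P" using i\<nu> by auto
    have "(\<lambda>n. LINT v|M. ?P (T n v)) \<longlonglongrightarrow> ?NP"
      using iM i\<nu> by (simp add: lim tendsto_intros)
    from tendstoD[OF this e]
    have "eventually (\<lambda>n. \<bar>(?EP n) - ?NP\<bar> < e / 4) sequentially"
      by (simp only: dist_real_def)
    moreover have near_M: "\<bar>(?Ec n) - (?EP n)\<bar> \<le> e / 4" for n
    proof -
      have "\<bar>LINT v|M. cts_step x y (T n v) - ?P (T n v)\<bar> \<le> (LINT v|M. \<bar>cts_step x y (T n v) - ?P (T n v)\<bar>)"
        by (rule integral_abs_bound)
      also have "\<dots> \<le> (LINT v|M. e / 4)"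
        using cM PM close[OF T_nonneg] by (intro integral_mono) (auto intro: less_imp_le)
      finally show ?thesis using cM PM by (simp add: prob_space)
    qed
    moreover have near_\<nu>: "\<bar>?Nc - ?NP\<bar> \<le> e / 4"
    proof -
      have "\<bar>LINT t|\<nu>. cts_step x y t - ?P t\<bar> \<le> (LINT t|\<nu>. \<bar>cts_step x y t - ?P t\<bar>)"
        by (rule integral_abs_bound)
      also have "\<dots> \<le> (LINT t|\<nu>. e / 4)"
      proof (rule integral_mono_AE)
        show "AE t in \<nu>. \<bar>cts_step x y t - ?P t\<bar> \<le> e / 4"
          using \<nu>_nonneg by eventually_elim (rule less_imp_le[OF close])
      qed (use c\<nu> P\<nu> in auto)
      finally show ?thesis using c\<nu> P\<nu> \<nu>.prob_space by simp
    qed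
    ultimately show "eventually (\<lambda>n. dist (?Ec n) ?Nc < e) sequentially"
    proof (elim eventually_mono)
      have tri: "\<bar>c - d\<bar> < e" if "\<bar>a - b\<bar> < e / 4" "\<bar>c - a\<bar> \<le> e / 4" "\<bar>d - b\<bar> \<le> e / 4" for a b c d
        using that \<open>e > 0\<close> by linarith
      fix n assume "\<bar>(?EP n) - ?NP\<bar> < e / 4"
      from tri[OF this near_M near_\<nu>]
      show "dist (?Ec n) ?Nc < e"
        by (simp add: dist_real_def)
    qed
  qed
qed

text \<open>\<open>cts_step\<close> is uniformly continuous with values between 0 and 1: where
  \<open>W\<close> and \<open>T\<close> are close the integrands differ by less than e / 3, and
  elsewhere by at most 1 on an event of probability below e / 3.\<close>

lemma weak_conv_perturbed:
  fixes W T :: "nat \<Rightarrow> 'w \<Rightarrow> real" and \<nu> :: "real measure"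
  assumes M: "prob_space M" and [measurable]: "\<And>n. T n \<in> borel_measurable M" "\<And>n. W n \<in> borel_measurable M"
    and \<nu>: "real_distribution \<nu>"
    and lim: "\<And>x y. x < y \<Longrightarrow> (\<lambda>n. LINT v|M. cts_step x y (T n v)) \<longlonglongrightarrow> (LINT t|\<nu>. cts_step x y t)"
    and close: "\<And>e. e > 0 \<Longrightarrow> whp M (\<lambda>n v. \<bar>W n v - T n v\<bar> < e)"
  shows "weak_conv_m (\<lambda>n. distr M borel (W n)) \<nu>"
proof (rule integral_cts_step_conv_imp_weak_conv)
  interpret prob_space M by (rule M)
  show "real_distribution (distr M borel (W n))" for n by (rule real_distribution_distr) measurable
  show "real_distribution \<nu>" by (rule \<nu>)
  fix x y :: real assume xy: "x < y"
  let ?w = "\<lambda>n v. cts_step x y (W n v)" and ?t = "\<lambda>n v. cts_step x y (T n v)"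
  have [measurable]: "cts_step x y \<in> borel_measurable borel" unfolding cts_step_def by measurable
  have bdd: "0 \<le> cts_step x y t" "cts_step x y t \<le> 1" for t using xy by (auto simp: cts_step_def)
  have int: "integrable M (\<lambda>v. cts_step x y (f v))" if [measurable]: "f \<in> borel_measurable M" for f
  proof (rule integrable_const_bound[where B=1])
    show "AE v in M. norm (cts_step x y (f v)) \<le> 1" using abs_le_iff bdd by (auto intro!: AE_I2 simp: abs_of_nonneg)
  qed measurable
  have "(\<lambda>n. (LINT v|M. ?w n v) - (LINT v|M. ?t n v)) \<longlonglongrightarrow> 0"
  proof (rule tendstoI)
    fix e :: real assume "e > 0"
    then have e: "e / 3 > 0" by simp
    obtain d where d0: "d > 0" "\<forall>t\<in>UNIV. \<forall>s\<in>UNIV. dist s t < d \<longrightarrow> dist (cts_step x y s) (cts_step x y t) < e / 3"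
      using cts_step_uniformly_continuous[OF xy, unfolded uniformly_continuous_on_def, rule_format, OF e] by blast
    then have d: "d > 0" "\<bar>s - t\<bar> < d \<Longrightarrow> \<bar>cts_step x y s - cts_step x y t\<bar> < e / 3" for s t
      by (simp_all add: dist_real_def)
    have "\<forall>\<^sub>F n in sequentially. likely M (e / 3) (\<lambda>v. \<bar>W n v - T n v\<bar> < d)"
      using close[OF d(1)] e by (simp only: whp_def)
    then show "\<forall>\<^sub>F n in sequentially. dist ((LINT v|M. ?w n v) - (LINT v|M. ?t n v)) 0 < e"
    proof eventually_elim
      case (elim n)
      then obtain E where E[measurable]: "E \<in> events" and pE: "prob E > 1 - e / 3"
        and eq: "\<And>v. v\<in>E \<Longrightarrow> \<bar>W n v - T n v\<bar> < d" by blast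
      have iI: "integrable M (indicator (space M - E) :: _ \<Rightarrow> real)"
        by (rule integrable_const_bound[where B=1]) auto
      have "\<bar>LINT v|M. ?w n v - ?t n v\<bar>
          \<le> (LINT v|M. \<bar>?w n v - ?t n v\<bar>)"
        by (rule integral_abs_bound)
      also have "\<dots> \<le> (LINT v|M. e / 3 + indicator (space M - E) v)"
      proof (rule integral_mono)
        show "integrable M (\<lambda>v. \<bar>?w n v - ?t n v\<bar>)"
          by (intro integrable_abs Bochner_Integration.integrable_diff int) measurable
        show "integrable M (\<lambda>v. e / 3 + indicator (space M - E) v :: real)"
          using iI by simp
        fix v assume "v \<in> space M"
        then show "\<bar>?w n v - ?t n v\<bar> \<le> e / 3 + indicator (space M - E) v"
          using d(2)[OF eq, of v] bdd[of "W n v"] bdd[of "T n v"] e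
          by (cases "v \<in> E") (auto simp: abs_le_iff)
      qed
      also have "\<dots> = e / 3 + (1 - prob E)"
        using iI by (subst Bochner_Integration.integral_add) (auto simp: prob_space prob_compl)
      also have "\<dots> < e" using pE \<open>e > 0\<close> by linarith
      finally show ?case using int by (simp add: dist_real_def)
    qed
  qed
  from tendsto_add[OF this lim[OF xy]]
  have "(\<lambda>n. LINT v|M. ?w n v) \<longlonglongrightarrow> (LINT t|\<nu>. cts_step x y t)" by simp
  then show "(\<lambda>n. integral\<^sup>L (distr M borel (W n)) (cts_step x y)) \<longlonglongrightarrow> integral\<^sup>L \<nu> (cts_step x y)"
    by (subst integral_distr) auto
qed

section \<open>Laplace transforms from characteristic functions\<close>

abbreviation gauss_measure :: "'i set \<Rightarrow> ('i \<Rightarrow> real) measure" where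
  "gauss_measure I \<equiv> \<Pi>\<^sub>M i\<in>I. std_normal_distribution"

interpretation std_normal: real_distribution std_normal_distribution
  by (rule real_dist_normal_dist)

interpretation gauss: product_prob_space "\<lambda>_. std_normal_distribution" I for I
  by unfold_locales

lemma prob_space_gauss: "prob_space (gauss_measure I)"
  by (intro prob_space_PiM) unfold_locales

text \<open>The Hubbard-Stratonovich identity: the product measure factorises the integral, and each
  factor is the standard normal characteristic function. A square in the exponent thereby becomes
  linear in \<open>x\<close>.\<close>

lemma gaussian_linearization:
  fixes x :: "'i \<Rightarrow> real"
  assumes "finite I"
  shows "(LINT z|gauss_measure I. iexp (\<Sum>i\<in>I. z i * x i)) = exp (- (\<Sum>i\<in>I. (x i)\<^sup>2) / 2)"
proof -
  have "(LINT z|gauss_measure I. iexp (\<Sum>i\<in>I. z i * x i)) = (LINT z|gauss_measure I. (\<Prod>i\<in>I. iexp (x i * z i)))"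
    by (simp add: exp_sum[OF assms, symmetric] sum_distrib_left mult_ac)
  also have "\<dots> = (\<Prod>i\<in>I. LINT z|std_normal_distribution. iexp (x i * z))"
    by (rule gauss.product_integral_prod[OF assms]) (auto intro!: std_normal.integrable_iexp)
  also have "\<dots> = (\<Prod>i\<in>I. exp (- ((x i)\<^sup>2) / 2))"
    using char_std_normal_distribution by (simp add: char_def fun_eq_iff)
  also have "\<dots> = exp (- (\<Sum>i\<in>I. (x i)\<^sup>2) / 2)"
    using assms by (simp add: exp_sum[symmetric] sum_negf sum_divide_distrib exp_of_real[symmetric])
  finally show ?thesis .
qed

context
  fixes M :: "'w measure" and Z :: "nat \<Rightarrow> 'w \<Rightarrow> real ^ 'q" and G :: "real ^ 'q ^ 'q"
  assumes M: "prob_space M" and Z_meas[measurable]: "\<And>n. Z n \<in> borel_measurable M"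
    and cf: "\<And>w. (\<lambda>n. LINT \<omega>|M. iexp (w \<bullet> Z n \<omega>)) \<longlonglongrightarrow> complex_of_real (exp (- (w \<bullet> (G *v w)) / 2))"
begin

text \<open>Fubini puts the Gaussian integral outside, where for fixed coefficients \<open>z\<close>
  the integrand is a characteristic function at the vector with coefficients \<open>z\<close> in the
  \<open>c i\<close>; it converges by \<open>cf\<close> and is dominated by 1.\<close>

lemma cf_imp_laplace:
  fixes c :: "'i \<Rightarrow> real ^ 'q"
  assumes I: "finite I"
  shows "(\<lambda>n. LINT x|M. exp (- (\<Sum>i\<in>I. (c i \<bullet> Z n x)\<^sup>2) / 2))
    \<longlonglongrightarrow> (LINT z|gauss_measure I. exp (- ((\<Sum>i\<in>I. z i *\<^sub>R c i) \<bullet> (G *v (\<Sum>i\<in>I. z i *\<^sub>R c i))) / 2))"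
proof -
  interpret prob_space M by (rule M)
  interpret P: prob_space "gauss_measure I" by (rule prob_space_gauss)
  interpret PP: pair_prob_space M "gauss_measure I" ..
  let ?w = "\<lambda>z. \<Sum>i\<in>I. z i *\<^sub>R c i"
  let ?q = "\<lambda>w. exp (- (w \<bullet> (G *v w)) / 2)"
  let ?s = "\<lambda>n x. \<Sum>i\<in>I. (c i \<bullet> Z n x)\<^sup>2" and ?E = "\<lambda>n z. LINT x|M. iexp (?w z \<bullet> Z n x)"
  have [measurable]: "(\<lambda>z. z i) \<in> borel_measurable (gauss_measure I)" if "i \<in> I" for i
    using measurable_component_singleton[OF that, of "\<lambda>_. std_normal_distribution"] by simp
  have w_meas[measurable]: "?w \<in> borel_measurable (gauss_measure I)" by measurable
  have [measurable]: "(\<lambda>w::real^'q. w \<bullet> (G *v w)) \<in> borel_measurable borel"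
    by (intro borel_measurable_continuous_onI continuous_intros
        linear_continuous_on bounded_linear_intros matrix_vector_mul_bounded_linear)
  have eq: "complex_of_real (LINT x|M. exp (- ?s n x / 2))
      = (LINT z|gauss_measure I. ?E n z)" for n
  proof -
    have "complex_of_real (LINT x|M. exp (- ?s n x / 2))
      = (LINT x|M. complex_of_real (exp (- ?s n x / 2)))"
      by (rule integral_complex_of_real[symmetric])
    also have "\<dots> = (LINT x|M. LINT z|gauss_measure I. iexp (?w z \<bullet> Z n x))"
    proof (rule Bochner_Integration.integral_cong[OF refl])
      fix x
      show "complex_of_real (exp (- ?s n x / 2)) = (LINT z|gauss_measure I. iexp (?w z \<bullet> Z n x))"
        using gaussian_linearization[OF I, of "\<lambda>i. c i \<bullet> Z n x"]
        by (simp add: inner_sum_left)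
    qed
    also have "\<dots> = (LINT z|gauss_measure I. ?E n z)"
    proof (rule PP.Fubini_integral[symmetric])
      have "(\<lambda>p. iexp (?w (snd p) \<bullet> Z n (fst p))) \<in> borel_measurable (M \<Otimes>\<^sub>M gauss_measure I)"
        by measurable
      then show "integrable (M \<Otimes>\<^sub>M gauss_measure I) (case_prod (\<lambda>x z. iexp (?w z \<bullet> Z n x)))"
        by (intro PP.integrable_const_bound[where B=1]) (auto simp: case_prod_unfold)
    qed
    finally show ?thesis .
  qed
  have "(\<lambda>n. LINT z|gauss_measure I. ?E n z) \<longlonglongrightarrow> (LINT z|gauss_measure I. complex_of_real (?q (?w z)))"
  proof (rule integral_dominated_convergence[where w="\<lambda>_. 1"])
    show "AE z in gauss_measure I. norm (?E n z) \<le> 1" for n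
    proof (rule AE_I2)
      fix z
      have "norm (?E n z) \<le> (LINT x|M. norm (iexp (?w z \<bullet> Z n x)))"
        by (rule integral_norm_bound)
      then show "norm (?E n z) \<le> 1" by (simp add: prob_space)
    qed
    show "(\<lambda>z. ?E n z) \<in> borel_measurable (gauss_measure I)" for n
      by (rule borel_measurable_lebesgue_integral) measurable
  qed (use cf in auto)
  then have "(\<lambda>n. complex_of_real (LINT x|M. exp (- ?s n x / 2)))
    \<longlonglongrightarrow> complex_of_real (LINT z|gauss_measure I. ?q (?w z))"
    unfolding eq integral_complex_of_real .
  then show ?thesis by (simp only: tendsto_of_real_iff)
qed

text \<open>Scaled coordinate vectors give the mean of
  \<open>exp (- (s\<^sup>2 * (norm Z)\<^sup>2) / 2)\<close>. Its limit \<open>L s\<close> tends to 1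
  as s tends to 0, which forces little mass outside a ball of radius proportional to 1 / s.\<close>

lemma cf_imp_tight:
  shows "tight_seq M Z"
  unfolding tight_seq_def
proof (intro allI impI)
  interpret prob_space M by (rule M)
  let ?P = "gauss_measure (UNIV::'q set)"
  interpret P: prob_space ?P by (rule prob_space_gauss)
  fix e :: real assume e: "e > 0"
  define L where "L s = (LINT z|?P. exp (- ((\<Sum>i\<in>UNIV. z i *\<^sub>R (s *\<^sub>R axis i 1)) \<bullet> (G *v (\<Sum>i\<in>UNIV. z i *\<^sub>R (s *\<^sub>R axis i 1)))) / 2))" for s :: real
  define q where "q z = (\<Sum>i\<in>UNIV. z i *\<^sub>R axis i 1) \<bullet> (G *v (\<Sum>i\<in>UNIV. z i *\<^sub>R axis i 1))" for z :: "'q \<Rightarrow> real"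
  have L_eq: "L s = (LINT z|?P. exp (- (s\<^sup>2 * q z) / 2))" for s
  proof -
    have "(\<Sum>i\<in>UNIV. z i *\<^sub>R (s *\<^sub>R (axis i 1 :: real ^ 'q))) = s *\<^sub>R (\<Sum>i\<in>UNIV. z i *\<^sub>R axis i 1)" for z :: "'q \<Rightarrow> real"
      by (simp add: scaleR_sum_right mult.commute)
    then show ?thesis
      unfolding L_def q_def by (simp only: matrix_vector_mult_scaleR power2_eq_square mult.assoc inner_scaleR_left inner_scaleR_right)
  qed
  \<comment> \<open>A limit of characteristic functions has modulus at most 1. The resulting sign of
    the form supplies the dominating constant 1 below.\<close>
  have form_nonneg: "w \<bullet> (G *v w) \<ge> 0" for w
  proof -
    have "norm (LINT x|M. iexp (w \<bullet> Z n x)) \<le> 1" for n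
      using integral_norm_bound[of M "\<lambda>x. iexp (w \<bullet> Z n x)"] by (simp add: prob_space)
    then have "norm (complex_of_real (exp (- (w \<bullet> (G *v w)) / 2))) \<le> 1"
      using tendsto_norm[OF cf[of w]] by (intro LIMSEQ_le_const2) auto
    then show ?thesis by simp
  qed
  have [measurable]: "(\<lambda>z. z i) \<in> borel_measurable ?P" for i :: 'q
    using measurable_component_singleton[of i UNIV "\<lambda>_. std_normal_distribution"] by simp
  have [measurable]: "(\<lambda>w::real^'q. w \<bullet> (G *v w)) \<in> borel_measurable borel"
    by (intro borel_measurable_continuous_onI continuous_intros
        linear_continuous_on bounded_linear_intros matrix_vector_mul_bounded_linear)
  have [measurable]: "q \<in> borel_measurable ?P" unfolding q_def by measurable
  have "(\<lambda>k. L (1 / real (Suc k))) \<longlonglongrightarrow> (LINT z|?P. 1)"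
    unfolding L_eq
  proof (rule integral_dominated_convergence[where w="\<lambda>_. 1"])
    have "(\<lambda>k. exp (- ((1 / real (Suc k))\<^sup>2 * q z) / 2)) \<longlonglongrightarrow> exp (- (0\<^sup>2 * q z) / 2)" for z
      by (intro tendsto_intros LIMSEQ_Suc[OF lim_const_over_n]) simp
    then show "AE z in ?P. (\<lambda>k. exp (- ((1 / real (Suc k))\<^sup>2 * q z) / 2)) \<longlonglongrightarrow> 1" by simp
    show "AE z in ?P. norm (exp (- ((1 / real (Suc k))\<^sup>2 * q z) / 2)) \<le> 1" for k
      using form_nonneg by (simp add: q_def)
  qed auto
  then have "(\<lambda>k. L (1 / real (Suc k))) \<longlonglongrightarrow> 1" by (simp add: prob_space.prob_space[OF prob_space_gauss])
  then have "eventually (\<lambda>k. L (1 / real (Suc k)) > 1 - e / 4) sequentially"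
    by (rule order_tendstoD) (use e in auto)
  then obtain k where k: "L (1 / real (Suc k)) > 1 - e / 4" by (auto simp: eventually_sequentially)
  define s where "s = 1 / real (Suc k)"
  have s: "s > 0" "L s > 1 - e / 4" using k by (auto simp: s_def)
  let ?e = "\<lambda>n x. exp (- (s\<^sup>2 * (norm (Z n x))\<^sup>2) / 2)"
  have sq: "(\<Sum>i\<in>UNIV. ((s *\<^sub>R axis i 1) \<bullet> z)\<^sup>2) = s\<^sup>2 * (norm z)\<^sup>2" for z :: "real ^ 'q"
  proof -
    have "(norm z)\<^sup>2 = (\<Sum>i\<in>UNIV. (z $ i)\<^sup>2)"
      unfolding power2_norm_eq_inner by (simp add: inner_vec_def power2_eq_square)
    then show ?thesis by (simp add: inner_axis' power_mult_distrib sum_distrib_left)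
  qed
  have "(\<lambda>n. LINT x|M. ?e n x) \<longlonglongrightarrow> L s"
    using cf_imp_laplace[of "UNIV::'q set" "\<lambda>i. s *\<^sub>R axis i 1"] unfolding sq L_def by simp
  then have "eventually (\<lambda>n. (LINT x|M. ?e n x) > 1 - e / 4) sequentially"
    using s(2) by (rule order_tendstoD)
  then have "\<forall>\<^sub>F n in sequentially. likely M e (\<lambda>x. norm (Z n x) \<le> sqrt 2 / s)"
  proof eventually_elim
    case (elim n)
    let ?E = "{x\<in>space M. norm (Z n x) \<le> sqrt 2 / s}"
    have E[measurable]: "?E \<in> events" by measurable
    have iE: "integrable M (\<lambda>x. 1 / 2 * indicator ?E x :: real)"
      by (rule integrable_const_bound[where B=1]) (auto simp: indicator_def)
    \<comment> \<open>Beyond radius \<open>sqrt 2 / s\<close> the exponent is at most - 1 and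
      \<open>exp (- 1)\<close> is at most 1 / 2. If p is the mass of the ball, then 1 - e / 4 < 1 /
      2 + p / 2, hence p > 1 - e / 2.\<close>
    have bound: "?e n x \<le> 1 / 2 + 1 / 2 * indicator ?E x" if "x \<in> space M" for x
    proof (cases "x \<in> ?E")
      case False
      then have "sqrt 2 < s * norm (Z n x)" using that s(1) by (simp add: field_simps)
      then have "(sqrt 2)\<^sup>2 \<le> (s * norm (Z n x))\<^sup>2" by (intro power_mono) auto
      then have "- (s\<^sup>2 * (norm (Z n x))\<^sup>2) / 2 \<le> - 1" by (simp add: power_mult_distrib)
      then have "?e n x \<le> exp (- 1)" by simp
      also have "exp (- 1 :: real) \<le> 1 / 2"
        using exp_ge_add_one_self[of 1] by (simp add: exp_minus inverse_eq_divide field_simps)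
      finally show ?thesis using False by simp
    qed auto
    have "1 - e / 4 < (LINT x|M. 1 / 2 + 1 / 2 * indicator ?E x)"
      using elim
    proof (rule less_le_trans)
      show "(LINT x|M. ?e n x) \<le> (LINT x|M. 1 / 2 + 1 / 2 * indicator ?E x)"
      proof (rule integral_mono[OF _ _ bound])
        show "integrable M (\<lambda>x. ?e n x)"
          by (rule integrable_const_bound[where B=1]) auto
        show "integrable M (\<lambda>x. 1 / 2 + 1 / 2 * indicator ?E x :: real)"
          using iE by (intro Bochner_Integration.integrable_add) auto
      qed
    qed
    also have "\<dots> = 1 / 2 + 1 / 2 * prob ?E"
      using iE by (subst Bochner_Integration.integral_add) (auto simp: prob_space)
    finally have "prob ?E > 1 - e" using e by linarith
    then show ?case by (intro bexI[OF _ E]) auto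
  qed
  then show "\<exists>r. \<forall>\<^sub>F n in sequentially. likely M e (\<lambda>x. norm (Z n x) \<le> r)" by blast
qed

end

section \<open>The normal and chi-squared distributions\<close>

text \<open>Continuity makes the superlevel set closed, so its infimum belongs to it and the cdf
  there is at least \<open>u\<close>; points to the left of the infimum lie below level
  \<open>u\<close>, and left continuity gives the other inequality.\<close>

lemma cdf_quantile:
  assumes \<nu>: "real_distribution \<nu>" and cont: "\<And>x. isCont (cdf \<nu>) x" and u: "0 < u" "u < 1"
  shows "cdf \<nu> (quantile \<nu> u) = u"
proof -
  interpret real_distribution \<nu> by (rule \<nu>)
  let ?S = "{x. u \<le> cdf \<nu> x}" and ?q = "quantile \<nu> u"
  have "eventually (\<lambda>x. cdf \<nu> x > u) at_top"
    using cdf_lim_at_top_prob u by (intro order_tendstoD)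
  then obtain b where "cdf \<nu> b > u" by (auto simp: eventually_at_top_linorder)
  then have ne: "?S \<noteq> {}" by (auto intro: exI[of _ b])
  have "eventually (\<lambda>x. cdf \<nu> x < u) at_bot"
    using cdf_lim_at_bot u by (intro order_tendstoD)
  then obtain a where a: "cdf \<nu> a < u" by (auto simp: eventually_at_bot_linorder)
  have bdd: "bdd_below ?S"
  proof (rule bdd_belowI[of _ a])
    fix x assume "x \<in> ?S"
    then show "a \<le> x" using a cdf_nondecreasing[of x a] by (cases "x \<le> a") auto
  qed
  have "closed ?S"
    using cont by (intro closed_Collect_le continuous_intros) (auto intro: continuous_at_imp_continuous_on)
  then have q: "u \<le> cdf \<nu> ?q"
    using closed_contains_Inf[OF ne bdd] by (simp add: quantile_def)
  have "cdf \<nu> ?q \<le> u"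
  proof (rule tendsto_upperbound)
    show "(cdf \<nu> \<longlongrightarrow> cdf \<nu> ?q) (at_left ?q)"
      using cont[of ?q] by (simp add: isCont_def filterlim_at_split)
    show "\<forall>\<^sub>F x in at_left ?q. cdf \<nu> x \<le> u"
    proof (rule eventually_mono[OF eventually_at_left_real[of "?q - 1" ?q]])
      fix x assume "x \<in> {?q - 1<..<?q}"
      then show "cdf \<nu> x \<le> u"
        using cInf_lower[OF _ bdd, of x] by (cases "x \<in> ?S") (auto simp: quantile_def not_le)
    qed auto
  qed auto
  with q show ?thesis by simp
qed

lemma null_singleton_std_normal: "emeasure std_normal_distribution {x} = 0"
  by (subst emeasure_density) (auto simp: nn_integral_0_iff_AE intro!: AE_I[where N="{x}"] split: split_indicator)

lemma isCont_cdf_std_normal: "isCont (cdf std_normal_distribution) x"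
  using null_singleton_std_normal by (simp add: std_normal.isCont_cdf measure_def)

lemma std_normal_interval_pos:
  assumes "a < b"
  shows "measure std_normal_distribution {a<..<b} > 0"
proof -
  have "emeasure std_normal_distribution {a<..<b} \<noteq> 0"
  proof
    assume "emeasure std_normal_distribution {a<..<b} = 0"
    then have "{a<..<b} \<in> null_sets std_normal_distribution" by (auto simp: null_sets_def)
    then have "AE x in lborel. x \<notin> {a<..<b}"
      by (subst (asm) null_sets_density_iff) (auto elim!: eventually_mono simp: not_le less_le normal_density_pos[of 1 0, simplified, THEN less_imp_neq, THEN not_sym])
    then have "emeasure lborel {a<..<b} = 0"
      by (subst (asm) AE_iff_measurable[of "{a<..<b}"]) auto
    with assms show False by simp
  qed
  then show ?thesis
    by (simp add: std_normal.emeasure_eq_measure zero_less_measure_iff)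
qed

lemma std_normal_symmetric: "measure std_normal_distribution {..- x} = measure std_normal_distribution {x..}"
proof -
  have "emeasure std_normal_distribution {..- x} = (\<integral>\<^sup>+ t. ennreal (std_normal_density t) * indicator {..- x} t \<partial>lborel)"
    by (subst emeasure_density) auto
  also have "\<dots> = (\<integral>\<^sup>+ t. ennreal (std_normal_density (- t)) * indicator {..- x} (- t) \<partial>lborel)"
    by (subst nn_integral_real_affine[where c="-1" and t=0]) auto
  also have "\<dots> = (\<integral>\<^sup>+ t. ennreal (std_normal_density t) * indicator {x..} t \<partial>lborel)"
    by (intro nn_integral_cong) (auto simp: normal_density_def split: split_indicator)
  also have "\<dots> = emeasure std_normal_distribution {x..}"
    by (subst emeasure_density) auto
  finally show ?thesis by (simp add: measure_def)
qed

lemma std_normal_abs_le: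
  assumes "0 \<le> x"
  shows "measure std_normal_distribution {- x..x} = 2 * cdf std_normal_distribution x - 1"
proof -
  have c: "measure std_normal_distribution {..<x} = cdf std_normal_distribution x" for x
  proof -
    have "{..x} = {..<x} \<union> {x}" by auto
    then show ?thesis
      unfolding cdf_def using null_singleton_std_normal[of x]
        std_normal.finite_measure_Union[of "{..<x}" "{x}"]
      by (simp add: measure_def[of _ "{x}"])
  qed
  have "cdf std_normal_distribution (- x) = measure std_normal_distribution (space std_normal_distribution - {..<x})"
    unfolding cdf_def std_normal_symmetric by (rule arg_cong[where f="measure _"]) auto
  also have "\<dots> = 1 - cdf std_normal_distribution x"
    by (subst std_normal.prob_compl) (auto simp: c)
  finally have neg: "cdf std_normal_distribution (- x) = 1 - cdf std_normal_distribution x" .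
  have "{..x} = {..<- x} \<union> {- x..x}" using assms by auto
  then have "cdf std_normal_distribution x = cdf std_normal_distribution (- x) + measure std_normal_distribution {- x..x}"
    unfolding c[symmetric, of "- x"] unfolding cdf_def
    by (simp add: std_normal.finite_measure_Union ivl_disj_int)
  then show ?thesis using neg by simp
qed

lemma quantile_std_normal_pos:
  assumes "1 / 2 < u" "u < 1"
  shows "quantile std_normal_distribution u > 0"
proof (rule ccontr)
  let ?q = "quantile std_normal_distribution u"
  assume "\<not> 0 < ?q"
  then have "cdf std_normal_distribution ?q \<le> cdf std_normal_distribution 0"
    by (intro std_normal.cdf_nondecreasing) auto
  moreover have "cdf std_normal_distribution ?q = u"
    using assms by (intro cdf_quantile real_dist_normal_dist isCont_cdf_std_normal) auto
  moreover have "measure std_normal_distribution {0} = 2 * cdf std_normal_distribution 0 - 1"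
    using std_normal_abs_le[of 0] by simp
  then have "cdf std_normal_distribution 0 = 1 / 2"
    using null_singleton_std_normal[of 0] by (simp add: measure_def)
  ultimately show False using assms by simp
qed

section \<open>The chi-squared law: no atoms, mass on positive intervals, quantiles\<close>

lemma measurable_gauss_component: "i \<in> I \<Longrightarrow> (\<lambda>z. z i) \<in> borel_measurable (gauss_measure I)"
  using measurable_component_singleton[of i I "\<lambda>_. std_normal_distribution"] by simp

lemma measurable_sum_squares: "(\<lambda>z. \<Sum>i<k. (z i)\<^sup>2) \<in> borel_measurable (gauss_measure {..<k::nat})"
  by (intro borel_measurable_sum borel_measurable_power measurable_gauss_component) auto

lemma real_distribution_chi_squared: "real_distribution (chi_squared k)"
  unfolding chi_squared_def
  by (intro prob_space.real_distribution_distr prob_space_gauss measurable_sum_squares)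

lemma AE_chi_squared_nonneg: "AE x in chi_squared k. x \<ge> 0"
  unfolding chi_squared_def
  by (subst AE_distr_iff[OF measurable_sum_squares]) (auto intro!: AE_I2 sum_nonneg)

lemma chi_squared_laplace:
  "(LINT x|chi_squared k. exp (- (s * x))) = (LINT z|gauss_measure {..<k}. exp (- (s * (\<Sum>i<k. (z i)\<^sup>2))))"
  unfolding chi_squared_def by (rule integral_distr[OF measurable_sum_squares]) simp

text \<open>Integrate over the last coordinate first: for fixed other coordinates at most two values
  of it solve the equation, a null set of the normal law. The hypothesis on \<open>k\<close>
  provides this coordinate.\<close>

lemma null_singleton_chi_squared:
  assumes k: "k > 0"
  shows "measure (chi_squared k) {x} = 0"
proof -
  obtain m where m: "k = Suc m" using k by (cases k) auto
  have ins: "{..<k} = insert m {..<m}" by (auto simp: m)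
  have sp: "space (gauss_measure {..<k}) = {..<k} \<rightarrow>\<^sub>E UNIV" by (simp add: space_PiM)
  let ?A = "{z \<in> space (gauss_measure {..<k}). (\<Sum>i<k. (z i)\<^sup>2) = x}"
  have A: "?A \<in> sets (gauss_measure {..<k})"
    using measurable_sum_squares[measurable] by measurable
  have "emeasure (gauss_measure {..<k}) ?A = (\<integral>\<^sup>+ z. indicator ?A z \<partial>gauss_measure (insert m {..<m}))"
    unfolding ins[symmetric] by (rule nn_integral_indicator[OF A, symmetric])
  also have "\<dots> = (\<integral>\<^sup>+ z. (\<integral>\<^sup>+ y. indicator ?A (z(m := y)) \<partial>std_normal_distribution) \<partial>gauss_measure {..<m})"
    using A unfolding ins by (intro gauss.product_nn_integral_insert) auto
  also have "\<dots> = (\<integral>\<^sup>+ z. 0 \<partial>gauss_measure {..<m})"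
  proof (rule nn_integral_cong)
    fix z :: "nat \<Rightarrow> real"
    let ?c = "x - (\<Sum>i<m. (z i)\<^sup>2)"
    have "(\<integral>\<^sup>+ y. indicator ?A (z(m := y)) \<partial>std_normal_distribution)
      \<le> (\<integral>\<^sup>+ y. indicator {sqrt ?c} y + indicator {- sqrt ?c} y \<partial>std_normal_distribution)"
    proof (rule nn_integral_mono)
      fix y
      show "indicator ?A (z(m := y)) \<le> (indicator {sqrt ?c} y + indicator {- sqrt ?c} y :: ennreal)"
      proof (cases "z(m := y) \<in> ?A")
        case True
        then have "y\<^sup>2 = ?c" by (simp add: m)
        then have "\<bar>y\<bar> = sqrt ?c" by (metis real_sqrt_abs)
        then have "y = sqrt ?c \<or> y = - sqrt ?c" by linarith
        then show ?thesis by (auto simp: indicator_def)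
      qed simp
    qed
    also have "\<dots> = 0"
      using null_singleton_std_normal by (subst nn_integral_add) (auto simp: nn_integral_indicator)
    finally show "(\<integral>\<^sup>+ y. indicator ?A (z(m := y)) \<partial>std_normal_distribution) = 0" by simp
  qed
  finally have "emeasure (gauss_measure {..<k}) ?A = 0" by simp
  then have "measure (gauss_measure {..<k}) ?A = 0" by (simp add: measure_def)
  then show ?thesis
    unfolding chi_squared_def
    by (subst measure_distr[OF measurable_sum_squares]) (auto simp: vimage_def Int_def conj_commute)
qed

lemma isCont_cdf_chi_squared:
  assumes "k > 0" shows "isCont (cdf (chi_squared k)) x"
proof -
  interpret real_distribution "chi_squared k" by (rule real_distribution_chi_squared)
  show ?thesis using null_singleton_chi_squared[OF assms] by (simp add: isCont_cdf)
qed

text \<open>Dividing the interval into \<open>k\<close> equal shares gives an open box: if every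
  squared coordinate lies strictly between a / k and b / k, the sum lies between a and b. The box
  has positive product mass.\<close>

lemma chi_squared_interval_pos:
  assumes k: "k > 0" and ab: "0 \<le> a" "a < b"
  shows "measure (chi_squared k) {a<..b} > 0"
proof -
  interpret P: prob_space "gauss_measure {..<k}" by (rule prob_space_gauss)
  let ?l = "sqrt (a / k)" and ?u = "sqrt (b / k)"
  have lu: "0 \<le> ?l" "?l < ?u" using ab k by (auto simp: divide_strict_right_mono)
  let ?B = "\<Pi>\<^sub>E i\<in>{..<k}. {?l<..<?u}"
  let ?V = "(\<lambda>z. \<Sum>i<k. (z i)\<^sup>2) -` {a<..b} \<inter> space (gauss_measure {..<k})"
  have "emeasure (gauss_measure {..<k}) ?B = (\<Prod>i<k. emeasure std_normal_distribution {?l<..<?u})"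
    by (rule gauss.emeasure_PiM) auto
  also have "\<dots> = ennreal (measure std_normal_distribution {?l<..<?u} ^ k)"
    by (simp add: std_normal.emeasure_eq_measure ennreal_power)
  finally have "measure (gauss_measure {..<k}) ?B = measure std_normal_distribution {?l<..<?u} ^ k"
    by (simp add: measure_def)
  then have "measure (gauss_measure {..<k}) ?B > 0"
    using std_normal_interval_pos[OF lu(2)] by simp
  also have "measure (gauss_measure {..<k}) ?B \<le> measure (gauss_measure {..<k})
      (?V)"
  proof (rule finite_measure.finite_measure_mono)
    show "finite_measure (gauss_measure {..<k})"
      using prob_space_gauss prob_space.axioms(1) by blast
    show "?B \<subseteq> ?V"
    proof
      fix z assume z: "z \<in> ?B"
      have "a / k < (z i)\<^sup>2 \<and> (z i)\<^sup>2 < b / k" if "i < k" for i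
      proof -
        have zi: "?l < z i" "z i < ?u" using z that by (auto simp: PiE_iff)
        have "?l\<^sup>2 < (z i)\<^sup>2" by (rule power_strict_mono) (use zi lu in auto)
        moreover have "(z i)\<^sup>2 < ?u\<^sup>2" by (rule power_strict_mono) (use zi lu in linarith)+
        ultimately have "?l\<^sup>2 < (z i)\<^sup>2" "(z i)\<^sup>2 < ?u\<^sup>2" .
        then show ?thesis using ab k by (simp add: real_sqrt_pow2)
      qed
      then have "(\<Sum>i<k. a / k) < (\<Sum>i<k. (z i)\<^sup>2)" "(\<Sum>i<k. (z i)\<^sup>2) < (\<Sum>i<k. b / k)"
        using k by (intro sum_strict_mono; auto)+
      then show "z \<in> ?V"
        using z k by (auto simp: space_PiM PiE_iff)
    qed
    show "?V \<in> sets (gauss_measure {..<k})"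
      by (rule measurable_sets[OF measurable_sum_squares]) auto
  qed
  also have "\<dots> = measure (chi_squared k) {a<..b}"
    unfolding chi_squared_def by (rule measure_distr[OF measurable_sum_squares, symmetric]) auto
  finally show ?thesis .
qed

lemma cdf_chi_squared_neg:
  assumes "x \<le> 0" "k > 0" shows "cdf (chi_squared k) x = 0"
proof -
  interpret real_distribution "chi_squared k" by (rule real_distribution_chi_squared)
  have "cdf (chi_squared k) x \<le> cdf (chi_squared k) 0" using assms by (intro cdf_nondecreasing)
  also have "cdf (chi_squared k) 0 = prob ({..<0} \<union> {0})"
    unfolding cdf_def by (rule arg_cong[where f="measure _"]) auto
  also have "\<dots> = prob {..<0}"
    using null_singleton_chi_squared[OF assms(2)] by (subst finite_measure_Union) auto
  also have "\<dots> = 0"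
    using AE_chi_squared_nonneg[of k] prob_eq_0[of "{..<0}"] by (auto simp: not_less)
  finally show ?thesis using cdf_nonneg[of x] by linarith
qed

text \<open>Monotonicity of the cdf settles one direction. The other needs strict growth to the
  right of the quantile, which holds because the quantile is positive and intervals of positive
  numbers carry mass.\<close>

lemma chi_squared_quantile_iff:
  assumes k: "k > 0" and \<alpha>: "0 < \<alpha>" "\<alpha> < 1"
  shows "x > quantile (chi_squared k) (1 - \<alpha>) \<longleftrightarrow> 1 - cdf (chi_squared k) x < \<alpha>"
proof -
  interpret real_distribution "chi_squared k" by (rule real_distribution_chi_squared)
  let ?q = "quantile (chi_squared k) (1 - \<alpha>)"
  have q: "cdf (chi_squared k) ?q = 1 - \<alpha>"
    using k \<alpha> by (intro cdf_quantile real_distribution_chi_squared isCont_cdf_chi_squared) auto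
  then have q0: "?q > 0" using cdf_chi_squared_neg[of ?q k] k \<alpha> by force
  show ?thesis
  proof
    assume x: "x > ?q"
    then have "cdf (chi_squared k) x - cdf (chi_squared k) ?q = prob {?q<..x}" by (rule cdf_diff_eq)
    with chi_squared_interval_pos[OF k _ x] q0 q show "1 - cdf (chi_squared k) x < \<alpha>" by simp
  next
    assume "1 - cdf (chi_squared k) x < \<alpha>"
    then have "\<not> cdf (chi_squared k) x \<le> cdf (chi_squared k) ?q" using q by simp
    then show "x > ?q" using cdf_nondecreasing[of x ?q] by linarith
  qed
qed

text \<open>Converts the chi-squared limit for one coordinate into the normal quantile that appears
  in the confidence interval.\<close>

lemma cdf_chi_squared_1:
  assumes "0 \<le> x"
  shows "cdf (chi_squared 1) (x\<^sup>2) = 2 * cdf std_normal_distribution x - 1"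
proof -
  have eq: "{..<1::nat} = {0}" by auto
  have m: "(\<lambda>z. z 0) \<in> measurable (gauss_measure {0::nat}) std_normal_distribution"
    by (rule measurable_component_singleton) simp
  have "chi_squared 1 = distr (gauss_measure {0::nat}) borel (\<lambda>z. (z 0)\<^sup>2)"
    unfolding chi_squared_def eq by simp
  also have "\<dots> = distr (distr (gauss_measure {0::nat}) std_normal_distribution (\<lambda>z. z 0)) borel (\<lambda>y. y\<^sup>2)"
    by (subst distr_distr[OF _ m]) (auto simp: comp_def)
  also have "distr (gauss_measure {0::nat}) std_normal_distribution (\<lambda>z. z 0) = std_normal_distribution"
    by (rule gauss.distr_singleton)
  finally have "cdf (chi_squared 1) (x\<^sup>2) = measure std_normal_distribution ((\<lambda>y. y\<^sup>2) -` {..x\<^sup>2} \<inter> space std_normal_distribution)"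
    by (simp add: cdf_def measure_distr)
  also have "(\<lambda>y. y\<^sup>2) -` {..x\<^sup>2} \<inter> space std_normal_distribution = {- x..x}"
    using assms by (auto simp: abs_le_square_iff[symmetric] abs_le_iff)
  finally show ?thesis using std_normal_abs_le[OF assms] by simp
qed

section \<open>A central limit theorem for randomly weighted sums\<close>

text \<open>The bound \<open>exp (- y) \<le> 1 - y + y\<^sup>2\<close> follows from
  \<open>(1 - y + y\<^sup>2) * (1 + y) = 1 + y ^ 3\<close> and \<open>1 + y \<le> exp y\<close>. The
  minimum with 1 uses the trivial bound \<open>exp (- y) \<le> 1\<close> for large y.\<close>

lemma exp_neg_approx:
  fixes y :: real
  assumes "y \<ge> 0"
  shows "\<bar>exp (- y) - (1 - y)\<bar> \<le> y * min 1 y"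
proof -
  have lo: "1 - y \<le> exp (- y)" using exp_ge_add_one_self[of "- y"] by simp
  have "1 \<le> (1 - y + y\<^sup>2) * (1 + y)"
  proof -
    have "(1 - y + y\<^sup>2) * (1 + y) = 1 + y * y\<^sup>2" by (simp add: power2_eq_square algebra_simps)
    then show ?thesis using assms by simp
  qed
  also have "\<dots> \<le> (1 - y + y\<^sup>2) * exp y"
  proof (rule mult_left_mono)
    have "0 \<le> (1 - y)\<^sup>2 + y" using assms by simp
    then show "0 \<le> 1 - y + y\<^sup>2" by (simp add: power2_eq_square algebra_simps)
  qed (use exp_ge_add_one_self[of y] in simp)
  finally have "exp (- y) \<le> 1 - y + y\<^sup>2" by (simp add: exp_minus field_simps)
  moreover have "exp (- y) \<le> 1" using assms by simp
  ultimately show ?thesis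
    using lo by (auto simp: min_def power2_eq_square)
qed

context prob_space
begin

text \<open>Both exponentials are compared with \<open>1 - b\<^sup>2 * s / 2\<close>. The truncation
  by 1 is kept because \<open>b\<close> will be a multiple of a random weight with a finite second
  moment: a cubic error alone would call for a third moment.\<close>

lemma cf_centered_bounded_approx:
  fixes Y :: "'a \<Rightarrow> real"
  assumes [measurable]: "Y \<in> borel_measurable M" and bd: "\<And>x. x \<in> space M \<Longrightarrow> \<bar>Y x\<bar> \<le> C"
    and mean: "expectation Y = 0" and var: "expectation (\<lambda>x. (Y x)\<^sup>2) = s"
  shows "norm (expectation (\<lambda>x. iexp (b * Y x)) - exp (- (b\<^sup>2 * s) / 2)) \<le> 2 * s * (b\<^sup>2 * min 1 (C * \<bar>b\<bar>))"
proof -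
  let ?\<phi> = "expectation (\<lambda>x. iexp (b * Y x))"
  have C: "C \<ge> 0" using bd not_empty by force
  have iY: "integrable M Y" by (rule integrable_const_bound[where B=C]) (use bd in auto)
  have Y2: "(Y x)\<^sup>2 \<le> C\<^sup>2" if "x \<in> space M" for x
    using power_mono[OF bd[OF that], of 2] by simp
  have iY2: "integrable M (\<lambda>x. (Y x)\<^sup>2)"
    by (rule integrable_const_bound[where B="C\<^sup>2"]) (use Y2 in auto)
  have s0: "s \<ge> 0" unfolding var[symmetric] by (intro Bochner_Integration.integral_nonneg) simp
  \<comment> \<open>Bounding the variance by the squared range lets the error of the Gaussian factor
    be measured by \<open>C * \<bar>b\<bar>\<close> as well.\<close>
  have "s \<le> expectation (\<lambda>x. C\<^sup>2)" unfolding var[symmetric] using iY2 Y2 by (intro integral_mono) auto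
  then have sC: "s \<le> C\<^sup>2" by (simp add: prob_space)
  let ?m = "\<lambda>x. min (6 * (Y x)\<^sup>2) (\<bar>b\<bar> * \<bar>Y x\<bar> ^ 3)"
  have m_le: "?m x \<le> 6 * min 1 (C * \<bar>b\<bar>) * (Y x)\<^sup>2" if "x \<in> space M" for x
  proof -
    have "\<bar>b\<bar> * \<bar>Y x\<bar> ^ 3 = \<bar>b\<bar> * \<bar>Y x\<bar> * (Y x)\<^sup>2" by (simp add: power3_eq_cube power2_eq_square)
    also have "\<dots> \<le> 6 * (C * \<bar>b\<bar>) * (Y x)\<^sup>2"
      using bd[OF that] C by (intro mult_right_mono) (auto simp: mult.commute intro: order_trans[OF mult_left_mono])
    finally show ?thesis by (auto simp: min_def)
  qed
  have im: "integrable M ?m"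
    by (rule Bochner_Integration.integrable_bound[OF integrable_mult_right[OF iY2, of 6]]) auto
  have "expectation ?m \<le> expectation (\<lambda>x. 6 * min 1 (C * \<bar>b\<bar>) * (Y x)\<^sup>2)"
    using im iY2 m_le by (intro integral_mono) auto
  then have Em: "expectation ?m \<le> 6 * min 1 (C * \<bar>b\<bar>) * s" using var by simp
  have "norm (char (distr M borel Y) b - (1 - b\<^sup>2 * s / 2)) \<le> b\<^sup>2 / 6 * expectation ?m"
    using iY iY2 mean var by (intro char_approx3') auto
  also have "\<dots> \<le> b\<^sup>2 / 6 * (6 * min 1 (C * \<bar>b\<bar>) * s)"
    by (intro mult_left_mono Em) simp
  also have "char (distr M borel Y) b = ?\<phi>"
    unfolding char_def by (subst integral_distr) auto
  finally have 1: "norm (?\<phi> - (1 - b\<^sup>2 * s / 2)) \<le> s * (b\<^sup>2 * min 1 (C * \<bar>b\<bar>))"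
    by (simp add: mult_ac)
  let ?y = "b\<^sup>2 * s / 2"
  have "norm (complex_of_real (1 - ?y) - complex_of_real (exp (- ?y))) = \<bar>exp (- ?y) - (1 - ?y)\<bar>"
    unfolding of_real_diff[symmetric] norm_of_real by (rule abs_minus_commute)
  also have "\<dots> \<le> ?y * min 1 ?y" using s0 by (intro exp_neg_approx) simp
  also have "\<dots> \<le> ?y * (2 * min 1 (C * \<bar>b\<bar>))"
  proof (rule mult_left_mono)
    have "?y \<le> (C * \<bar>b\<bar>)\<^sup>2" proof -
      have "0 \<le> b\<^sup>2 * s" using s0 by simp
      then have "?y \<le> b\<^sup>2 * C\<^sup>2" using mult_left_mono[OF sC zero_le_power2[of b]] by linarith
      then show ?thesis by (simp add: power_mult_distrib mult.commute)
    qed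
    moreover have "C * \<bar>b\<bar> \<ge> 0" using C by simp
    moreover have "(C * \<bar>b\<bar>)\<^sup>2 \<le> C * \<bar>b\<bar>" if "C * \<bar>b\<bar> \<le> 1"
      using mult_left_mono[OF that \<open>C * \<bar>b\<bar> \<ge> 0\<close>] by (simp add: power2_eq_square)
    ultimately show "min 1 ?y \<le> 2 * min 1 (C * \<bar>b\<bar>)" by (auto simp: min_def)
  qed (use s0 in simp)
  finally have 2: "norm (complex_of_real (1 - ?y) - complex_of_real (exp (- ?y))) \<le> s * (b\<^sup>2 * min 1 (C * \<bar>b\<bar>))"
    by (simp add: mult_ac)
  have "norm (?\<phi> - complex_of_real (exp (- ?y)))
    \<le> norm (?\<phi> - (1 - b\<^sup>2 * s / 2)) + norm (complex_of_real (1 - ?y) - complex_of_real (exp (- ?y)))"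
    using norm_triangle_ineq[of "?\<phi> - (1 - b\<^sup>2 * s / 2)" "complex_of_real (1 - ?y) - complex_of_real (exp (- ?y))"]
    by simp
  with 1 2 show ?thesis by simp
qed

lemma norm_cf_le_1: 
  assumes "Y \<in> borel_measurable M"
  shows "norm (expectation (\<lambda>x. iexp (Y x))) \<le> 1"
  using integral_norm_bound[of M "\<lambda>x. iexp (Y x)"] by (simp add: prob_space)

text \<open>Independence turns both sides into products of factors of modulus at most 1, whose
  difference telescopes into the sum of the single differences.\<close>

lemma cf_weighted_sum_approx:
  fixes Y :: "nat \<Rightarrow> 'a \<Rightarrow> real"
  assumes ind: "indep_vars (\<lambda>_. borel) Y {..<n}" 
    and bd: "\<And>i x. i < n \<Longrightarrow> x \<in> space M \<Longrightarrow> \<bar>Y i x\<bar> \<le> C"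
    and mean: "\<And>i. i < n \<Longrightarrow> expectation (Y i) = 0" and var: "\<And>i. i < n \<Longrightarrow> expectation (\<lambda>x. (Y i x)\<^sup>2) = s"
  shows "norm (expectation (\<lambda>x. iexp (\<Sum>i<n. b i * Y i x)) - exp (- (s * (\<Sum>i<n. (b i)\<^sup>2)) / 2))
    \<le> 2 * s * (\<Sum>i<n. (b i)\<^sup>2 * min 1 (C * \<bar>b i\<bar>))"
\<comment> \<open>Nonnegativity of \<open>s\<close> is read off the variance at index 0, so the
  empty sum is treated apart.\<close>
proof (cases "n = 0")
  case False
  let ?\<phi> = "\<lambda>i. expectation (\<lambda>x. iexp (b i * Y i x))" and ?E = "expectation (\<lambda>x. iexp (\<Sum>i<n. b i * Y i x))"
  have Y[measurable]: "Y i \<in> borel_measurable M" if "i < n" for i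
    using ind that by (auto simp: indep_vars_def)
  have s0: "s \<ge> 0" unfolding var[of 0, symmetric] using False var[of 0] by (auto simp flip: var intro!: Bochner_Integration.integral_nonneg)
  have "?E = expectation (\<lambda>x. \<Prod>i<n. iexp (b i * Y i x))"
    by (simp add: exp_sum[symmetric] sum_distrib_left)
  also have "\<dots> = (\<Prod>i<n. ?\<phi> i)"
  proof (rule indep_vars_lebesgue_integral)
    show "indep_vars (\<lambda>_. borel) (\<lambda>i x. iexp (b i * Y i x)) {..<n}"
      using indep_vars_compose2[OF ind, of "\<lambda>i y. iexp (b i * y)" "\<lambda>_. borel"] by simp
    show "integrable M (\<lambda>x. iexp (b i * Y i x))" if "i \<in> {..<n}" for i
      by (rule integrable_const_bound[where B=1]) (use that in auto)
  qed simp
  finally have prod: "?E = (\<Prod>i<n. ?\<phi> i)" .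
  have prod': "complex_of_real (exp (- (s * (\<Sum>i<n. (b i)\<^sup>2)) / 2)) = (\<Prod>i<n. complex_of_real (exp (- ((b i)\<^sup>2 * s) / 2)))"
    unfolding of_real_prod[symmetric]
    by (simp add: exp_sum[symmetric] sum_distrib_left sum_negf sum_divide_distrib mult.commute)
  have "norm ((\<Prod>i<n. ?\<phi> i) - (\<Prod>i<n. complex_of_real (exp (- ((b i)\<^sup>2 * s) / 2))))
    \<le> (\<Sum>i<n. norm (?\<phi> i - complex_of_real (exp (- ((b i)\<^sup>2 * s) / 2))))"
  proof (rule norm_prod_diff)
    show "norm (?\<phi> i) \<le> 1" if "i \<in> {..<n}" for i
      by (rule norm_cf_le_1) (use that in auto)
  qed (use s0 in auto)
  also have "\<dots> \<le> (\<Sum>i<n. 2 * s * ((b i)\<^sup>2 * min 1 (C * \<bar>b i\<bar>)))"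
    by (intro sum_mono cf_centered_bounded_approx) (use bd mean var in auto)
  finally show ?thesis unfolding prod prod' by (simp add: sum_distrib_left)
qed (simp add: prob_space)

text \<open>
  The inner integral averages over the noise \<open>Y\<close> for a fixed realisation of the weights \<open>x\<close>;
  the two are coupled by independence in \<open>indep_seq_integral\<close>.
\<close>
lemma weighted_clt:
  fixes x :: "nat \<Rightarrow> 'a \<Rightarrow> real" and Y :: "nat \<Rightarrow> nat \<Rightarrow> 'a \<Rightarrow> real"
  assumes x[measurable]: "\<And>i. x i \<in> borel_measurable M"
    and x_distr: "\<And>i. distr M borel (x i) = distr M borel (x 0)"
    and x2: "integrable M (\<lambda>v. (x 0 v)\<^sup>2)"
    and lln: "AE v in M. (\<lambda>n. (\<Sum>i<n. (x i v)\<^sup>2) / real n) \<longlonglongrightarrow> expectation (\<lambda>v. (x 0 v)\<^sup>2)"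
    and ind: "\<And>n. indep_vars (\<lambda>_. borel) (Y n) {..<n}"
    and bd: "\<And>n i v. i < n \<Longrightarrow> v \<in> space M \<Longrightarrow> \<bar>Y n i v\<bar> \<le> C"
    and mean: "\<And>n i. i < n \<Longrightarrow> expectation (Y n i) = 0"
    and var: "\<And>n i. i < n \<Longrightarrow> expectation (\<lambda>v. (Y n i v)\<^sup>2) = s n"
    and a: "a \<longlonglongrightarrow> 0" and s_lim: "(\<lambda>n. real n * (a n)\<^sup>2 * s n) \<longlonglongrightarrow> t"
  shows "(\<lambda>n. LINT v'|M. LINT v|M. iexp (\<Sum>i<n. a n * x i v' * Y n i v))
    \<longlonglongrightarrow> complex_of_real (exp (- (t * expectation (\<lambda>v. (x 0 v)\<^sup>2)) / 2))"
proof -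
  let ?E = "expectation (\<lambda>v. (x 0 v)\<^sup>2)"
  have [measurable]: "Y n i \<in> borel_measurable M" if "i < n" for n i
    using ind that by (auto simp: indep_vars_def)
  have x_int: "expectation (\<lambda>v. g (x i v)) = expectation (\<lambda>v. g (x 0 v))"
    "integrable M (\<lambda>v. g (x i v)) \<longleftrightarrow> integrable M (\<lambda>v. g (x 0 v))"
    if [measurable]: "g \<in> borel_measurable borel" for g :: "real \<Rightarrow> real" and i
    using integral_distr[of "x i" M borel g] integral_distr[of "x 0" M borel g]
      integrable_distr_eq[of "x i" M borel g] integrable_distr_eq[of "x 0" M borel g] x_distr[of i]
    by simp_all
  have C: "C \<ge> 0" using bd[of 0 1] not_empty by (force intro: order_trans[OF abs_ge_zero])
  define \<Phi> where "\<Phi> n v' = (LINT v|M. iexp (\<Sum>i<n. a n * x i v' * Y n i v))" for n v'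
  define \<Psi> where "\<Psi> n v' = exp (- (s n * (\<Sum>i<n. (a n * x i v')\<^sup>2)) / 2)" for n v'
  \<comment> \<open>\<open>D\<close> is the Lindeberg error for frozen weights. Since all
    \<open>x i\<close> have the law of \<open>x 0\<close>, every summand of its mean is
    \<open>(a n)\<^sup>2 * R n\<close>.\<close>
  define D where "D n v' = (\<Sum>i<n. (a n * x i v')\<^sup>2 * min 1 (C * \<bar>a n * x i v'\<bar>))" for n v'
  define R where "R n = expectation (\<lambda>v. (x 0 v)\<^sup>2 * min 1 (C * \<bar>a n * x 0 v\<bar>))" for n
  have \<Phi>m[measurable]: "\<Phi> n \<in> borel_measurable M" for n
    unfolding \<Phi>_def by (rule borel_measurable_lebesgue_integral) measurable
  have \<Psi>m[measurable]: "\<Psi> n \<in> borel_measurable M" for n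
    unfolding \<Psi>_def by measurable
  have s0: "s n \<ge> 0" if "n > 0" for n
    unfolding var[of 0 n, OF that, symmetric] by (intro Bochner_Integration.integral_nonneg) simp
  have diff: "norm (\<Phi> n v' - complex_of_real (\<Psi> n v')) \<le> 2 * s n * D n v'" for n v'
    unfolding \<Phi>_def \<Psi>_def D_def
    using cf_weighted_sum_approx[OF ind bd mean var, of n "\<lambda>i. a n * x i v'"] by simp
  have i1: "integrable M (\<lambda>v. (x i v)\<^sup>2 * min 1 (C * \<bar>a n * x i v\<bar>))" for n i
  proof -
    have "integrable M (\<lambda>v. (x i v)\<^sup>2)" using x_int(2)[of "\<lambda>y. y\<^sup>2" i] x2 by simp
    then show ?thesis
      by (rule Bochner_Integration.integrable_bound) (use C in \<open>auto simp: abs_mult min_def intro!: mult_left_le\<close>)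
  qed
  have D_eq: "D n v' = (a n)\<^sup>2 * (\<Sum>i<n. (x i v')\<^sup>2 * min 1 (C * \<bar>a n * x i v'\<bar>))" for n v'
    unfolding D_def by (simp add: sum_distrib_left power_mult_distrib mult.assoc)
  have D_int: "integrable M (D n)" for n
    unfolding D_eq using i1 by (intro integrable_mult_right Bochner_Integration.integrable_sum) auto
  have ED: "expectation (D n) = real n * (a n)\<^sup>2 * R n" for n
  proof -
    have "expectation (D n) = (a n)\<^sup>2 * (\<Sum>i<n. expectation (\<lambda>v. (x i v)\<^sup>2 * min 1 (C * \<bar>a n * x i v\<bar>)))"
      unfolding D_eq using i1 by (simp add: Bochner_Integration.integral_sum)
    also have "(\<Sum>i<n. expectation (\<lambda>v. (x i v)\<^sup>2 * min 1 (C * \<bar>a n * x i v\<bar>))) = (\<Sum>i<n. R n)"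
      unfolding R_def using x_int(1)[of "\<lambda>y. y\<^sup>2 * min 1 (C * \<bar>a n * y\<bar>)"] by (intro sum.cong refl) simp
    finally show ?thesis by simp
  qed
  \<comment> \<open>The truncated factor is at most 1 and vanishes as \<open>a n\<close> tends to 0,
    so the second moment of \<open>x 0\<close> is a sufficient majorant.\<close>
  have "R \<longlonglongrightarrow> expectation (\<lambda>v. 0)"
    unfolding R_def
  proof (rule integral_dominated_convergence[where w="\<lambda>v. (x 0 v)\<^sup>2"])
    have "(\<lambda>n. (x 0 v)\<^sup>2 * min 1 (C * \<bar>a n * x 0 v\<bar>)) \<longlonglongrightarrow> (x 0 v)\<^sup>2 * min 1 (C * \<bar>0 * x 0 v\<bar>)" for v
      by (intro tendsto_intros a)
    then show "AE v in M. (\<lambda>n. (x 0 v)\<^sup>2 * min 1 (C * \<bar>a n * x 0 v\<bar>)) \<longlonglongrightarrow> 0" by simp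
    show "AE v in M. norm ((x 0 v)\<^sup>2 * min 1 (C * \<bar>a n * x 0 v\<bar>)) \<le> (x 0 v)\<^sup>2" for n
      using C by (auto simp: abs_mult min_def intro!: mult_left_le)
  qed (use x2 in auto)
  then have R_lim: "R \<longlonglongrightarrow> 0" by simp
  have i\<Phi>: "integrable M (\<Phi> n)" for n
  proof (rule integrable_const_bound[where B=1])
    show "AE v in M. norm (\<Phi> n v) \<le> 1"
      unfolding \<Phi>_def by (intro AE_I2 norm_cf_le_1) measurable
  qed measurable
  have i\<Psi>: "integrable M (\<Psi> n)" for n
    by (rule integrable_const_bound[where B=1])
      (use s0 in \<open>cases "n = 0"; auto simp: \<Psi>_def intro!: mult_nonneg_nonneg sum_nonneg\<close>)+
  let ?d = "\<lambda>n. (LINT v'|M. \<Phi> n v') - (LINT v'|M. complex_of_real (\<Psi> n v'))"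
  let ?b = "\<lambda>n. 2 * (real n * (a n)\<^sup>2 * s n) * R n"
  have "(\<lambda>n. ?d n) \<longlonglongrightarrow> 0"
  proof (rule Lim_null_comparison)
    show "\<forall>\<^sub>F n in sequentially. norm (?d n) \<le> ?b n"
    proof (rule always_eventually, rule allI)
      fix n
      have "norm (?d n) = norm (LINT v'|M. \<Phi> n v' - complex_of_real (\<Psi> n v'))"
        using i\<Phi> i\<Psi> by (subst Bochner_Integration.integral_diff) auto
      also have "\<dots> \<le> (LINT v'|M. norm (\<Phi> n v' - complex_of_real (\<Psi> n v')))"
        by (rule integral_norm_bound)
      also have "\<dots> \<le> (LINT v'|M. 2 * s n * D n v')"
        using i\<Phi> i\<Psi> D_int by (intro integral_mono diff) auto
      also have "\<dots> = ?b n" by (simp add: ED)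
      finally show "norm (?d n) \<le> ?b n" .
    qed
    have "(\<lambda>n. ?b n) \<longlonglongrightarrow> 2 * t * 0" by (intro tendsto_intros s_lim R_lim)
    then show "(\<lambda>n. ?b n) \<longlonglongrightarrow> 0" by simp
  qed
  moreover have "(\<lambda>n. LINT v'|M. complex_of_real (\<Psi> n v')) \<longlonglongrightarrow> (LINT v'|M. complex_of_real (exp (- (t * ?E) / 2)))"
  proof (rule integral_dominated_convergence[where w="\<lambda>_. 1"])
    show "AE v' in M. (\<lambda>n. complex_of_real (\<Psi> n v')) \<longlonglongrightarrow> complex_of_real (exp (- (t * ?E) / 2))"
      using lln
    proof eventually_elim
      case (elim v')
      \<comment> \<open>The exponent splits into the deterministic factor with limit
        \<open>t\<close> and the empirical second moment, to which \<open>lln\<close>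
        applies.\<close>
      have "\<Psi> n v' = exp (- ((real n * (a n)\<^sup>2 * s n) * ((\<Sum>i<n. (x i v')\<^sup>2) / real n)) / 2)" for n
        unfolding \<Psi>_def by (cases "n = 0") (auto simp: power_mult_distrib sum_distrib_left[symmetric])
      then show ?case by (simp only:) (intro tendsto_intros s_lim elim; simp)
    qed
    show "AE v' in M. norm (complex_of_real (\<Psi> n v')) \<le> 1" for n
      using s0[of n] by (cases "n = 0") (auto simp: \<Psi>_def intro!: mult_nonneg_nonneg sum_nonneg)
  qed auto
  ultimately have "(\<lambda>n. (?d n) + (LINT v'|M. complex_of_real (\<Psi> n v')))
    \<longlonglongrightarrow> 0 + (LINT v'|M. complex_of_real (exp (- (t * ?E) / 2)))"
    by (rule tendsto_add)
  then show ?thesis by (simp add: \<Phi>_def prob_space)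
qed

end

text \<open>Independence of the generated sigma-algebras identifies the joint law of the two
  sequences with the product of their laws, on rectangles and hence everywhere; Fubini then freezes
  the second sequence.\<close>

lemma indep_seq_integral:
  fixes Z :: "nat \<Rightarrow> 'w \<Rightarrow> 'a::topological_space" and Z' :: "nat \<Rightarrow> 'w \<Rightarrow> 'b::topological_space"
    and F :: "(nat \<Rightarrow> 'a) \<times> (nat \<Rightarrow> 'b) \<Rightarrow> 'c::{banach, second_countable_topology}"
  assumes M: "prob_space M" and [measurable]: "\<And>i. Z i \<in> borel_measurable M" "\<And>i. Z' i \<in> borel_measurable M"
    and ind: "indep_seq M Z Z'"
    and F[measurable]: "F \<in> borel_measurable ((\<Pi>\<^sub>M i\<in>UNIV. borel) \<Otimes>\<^sub>M (\<Pi>\<^sub>M i\<in>UNIV. borel))"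
    and bd: "\<And>p. norm (F p) \<le> B"
  shows "(LINT t|M. F (\<lambda>i. Z i t, \<lambda>i. Z' i t)) = (LINT t'|M. LINT t|M. F (\<lambda>i. Z i t, \<lambda>i. Z' i t'))"
proof -
  interpret prob_space M by (rule M)
  let ?P = "\<Pi>\<^sub>M i\<in>(UNIV::nat set). (borel::'a measure)" and ?P' = "\<Pi>\<^sub>M i\<in>(UNIV::nat set). (borel::'b measure)"
  let ?s = "\<lambda>t i. Z i t" and ?s' = "\<lambda>t i. Z' i t"
  have m[measurable]: "?s \<in> measurable M ?P" "?s' \<in> measurable M ?P'"
    by (rule measurable_PiM_single'; auto)+
  let ?D = "distr M ?P ?s" and ?D' = "distr M ?P' ?s'" and ?J = "distr M (?P \<Otimes>\<^sub>M ?P') (\<lambda>t. (?s t, ?s' t))"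
  interpret D: prob_space "?D" by (rule prob_space_distr) measurable
  interpret D': prob_space "?D'" by (rule prob_space_distr) measurable
  interpret DD: pair_prob_space "?D" "?D'" ..
  have joint: "?D \<Otimes>\<^sub>M ?D' = ?J"
  proof (rule pair_measure_eqI)
    show "sets (?D \<Otimes>\<^sub>M ?D') = sets (?J)"
      by (simp cong: sets_pair_measure_cong)
    fix A A' assume A: "A \<in> sets (?D)" "A' \<in> sets (?D')"
    then have [measurable]: "A \<in> sets ?P" "A' \<in> sets ?P'" by auto
    have "?s -` A \<inter> space M \<in> sets (vimage_algebra (space M) ?s ?P)"
      "?s' -` A' \<inter> space M \<in> sets (vimage_algebra (space M) ?s' ?P')"
      by (auto intro!: in_vimage_algebra)
    then have "prob ((?s -` A \<inter> space M) \<inter> (?s' -` A' \<inter> space M)) = prob (?s -` A \<inter> space M) * prob (?s' -` A' \<inter> space M)"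
      using ind unfolding indep_seq_def by (intro indep_setD)
    moreover have "(\<lambda>t. (?s t, ?s' t)) -` (A \<times> A') \<inter> space M = (?s -` A \<inter> space M) \<inter> (?s' -` A' \<inter> space M)"
      by auto
    ultimately show "emeasure (?D) A * emeasure (?D') A' = emeasure (?J) (A \<times> A')"
      by (simp add: emeasure_distr emeasure_eq_measure ennreal_mult)
  qed (intro D.sigma_finite_measure_axioms D'.sigma_finite_measure_axioms)+
  have Fm: "F \<in> borel_measurable (?D \<Otimes>\<^sub>M ?D')"
    using F by (simp cong: measurable_cong_sets sets_pair_measure_cong)
  have "(LINT t|M. F (?s t, ?s' t)) = (LINT p|(?D \<Otimes>\<^sub>M ?D'). F p)"
    unfolding joint by (rule integral_distr[symmetric]) auto
  also have "\<dots> = (LINT y|?D'. LINT x|?D. F (x, y))"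
  proof -
    have "integrable (?D \<Otimes>\<^sub>M ?D') (\<lambda>(x, y). F (x, y))"
      by (rule DD.integrable_const_bound[where B=B]) (use bd Fm in \<open>auto simp: case_prod_unfold\<close>)
    from DD.integral_snd[OF this] show ?thesis by (simp add: case_prod_unfold)
  qed
  also have "\<dots> = (LINT t'|M. LINT x|?D. F (x, ?s' t'))"
  proof (rule integral_distr[OF m(2)])
    show "(\<lambda>y. LINT x|?D. F (x, y)) \<in> borel_measurable ?P'"
      by (rule D.borel_measurable_lebesgue_integral) (use F in \<open>measurable\<close>)
  qed
  also have "\<dots> = (LINT t'|M. LINT t|M. F (?s t, ?s' t'))"
    by (intro Bochner_Integration.integral_cong refl integral_distr[OF m(1)]) measurable
  finally show ?thesis .
qed

text \<open>Substituting x = h u produces h times the integral of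
  \<open>f (h n * u) * \<phi> u\<close>; the bound of \<open>f\<close> gives a majorant and
  continuity at 0 the limit. It is applied to \<open>K\<close> and to its square.\<close>

lemma kernel_moment_asymptotics:
  fixes \<phi> f :: "real \<Rightarrow> real" and h :: "nat \<Rightarrow> real"
  assumes V: "distributed M lborel V (\<lambda>x. ennreal (f x))"
    and f_nonneg: "\<And>x. f x \<ge> 0" and f_bd: "bounded (range f)" and f_cont: "isCont f 0"
    and \<phi>: "integrable lborel \<phi>"
    and h: "h \<longlonglongrightarrow> 0" and h_pos: "\<And>n. n \<ge> 1 \<Longrightarrow> h n > 0"
  shows "(\<lambda>n. (LINT y|M. \<phi> (V y / h n)) / h n) \<longlonglongrightarrow> f 0 * (LINT u|lborel. \<phi> u)"
proof -
  have f[measurable]: "f \<in> borel_measurable lborel"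
    by (rule distributed_real_measurable[OF _ V]) (use f_nonneg in auto)
  have [measurable]: "\<phi> \<in> borel_measurable lborel" using \<phi> by auto
  obtain B where B: "\<And>x. \<bar>f x\<bar> \<le> B" using f_bd unfolding bounded_iff by auto
  have eq: "(LINT y|M. \<phi> (V y / h n)) / h n = (LINT u|lborel. f (h n * u) * \<phi> u)" if "n \<ge> 1" for n
  proof -
    have "(LINT y|M. \<phi> (V y / h n)) = (LINT x|lborel. f x * \<phi> (x / h n))"
      by (rule distributed_integral[OF V, symmetric]) (use f_nonneg in auto)
    also have "\<dots> = h n * (LINT u|lborel. f (h n * u) * \<phi> u)"
      using h_pos[OF that] lborel_integral_real_affine[of "h n" "\<lambda>x. f x * \<phi> (x / h n)" 0] by simp
    finally show ?thesis using h_pos[OF that] by simp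
  qed
  have "(\<lambda>n. LINT u|lborel. f (h n * u) * \<phi> u) \<longlonglongrightarrow> (LINT u|lborel. f 0 * \<phi> u)"
  proof (rule integral_dominated_convergence[where w="\<lambda>u. B * \<bar>\<phi> u\<bar>"])
    have "(\<lambda>n. f (h n * u)) \<longlonglongrightarrow> f (0 * u)" for u
      using f_cont by (intro isCont_tendsto_compose[of _ f] tendsto_intros h) simp
    then show "AE u in lborel. (\<lambda>n. f (h n * u) * \<phi> u) \<longlonglongrightarrow> f 0 * \<phi> u"
      by (auto intro!: tendsto_intros)
    show "AE u in lborel. norm (f (h n * u) * \<phi> u) \<le> B * \<bar>\<phi> u\<bar>" for n
      using B by (auto simp: abs_mult intro!: mult_right_mono)
  qed (use \<phi> in auto)
  then have "(\<lambda>n. LINT u|lborel. f (h n * u) * \<phi> u) \<longlonglongrightarrow> f 0 * (LINT u|lborel. \<phi> u)" by simp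
  then show ?thesis
    by (rule Lim_transform_eventually) (auto simp: eventually_sequentially eq intro!: exI[of _ 1])
qed

section \<open>Variance bounds\<close>

text \<open>Eigenvectors for distinct eigenvalues are orthogonal, hence independent. Finiteness is
  what allows the \<open>Max\<close> in \<open>lambda_max\<close> to bound each eigenvalue.\<close>

lemma symmetric_eigenvalues_finite:
  fixes A :: "real ^ 'n ^ 'n"
  assumes sym: "transpose A = A"
  shows "finite {l. \<exists>v. v \<noteq> 0 \<and> A *v v = l *\<^sub>R v}" (is "finite ?L")
proof -
  have adj: "x \<bullet> (A *v y) = (A *v x) \<bullet> y" for x y
    by (metis dot_lmul_matrix sym vector_transpose_matrix)
  define v where "v l = (SOME v. v \<noteq> 0 \<and> A *v v = l *\<^sub>R v)" for l
  have v: "v l \<noteq> 0 \<and> A *v v l = l *\<^sub>R v l" if "l \<in> ?L" for l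
    unfolding v_def by (rule someI_ex) (use that in simp)
  have orth: "v l \<bullet> v l' = 0" if "l \<in> ?L" "l' \<in> ?L" "l \<noteq> l'" for l l'
    using adj[of "v l" "v l'"] v[OF that(1)] v[OF that(2)] that(3) by simp
  have inj: "inj_on v ?L"
  proof (rule inj_onI, rule ccontr)
    fix l l' assume l: "l \<in> ?L" "l' \<in> ?L" "v l = v l'" "l \<noteq> l'"
    with orth[OF l(1,2,4)] v[OF l(1)] show False by simp
  qed
  have "pairwise orthogonal (v ` ?L)"
    unfolding pairwise_def orthogonal_def using orth by force
  then have "independent (v ` ?L)"
    by (rule pairwise_orthogonal_independent) (use v in force)
  then have "finite (v ` ?L)" by (rule independent_imp_finite)
  then show ?thesis using inj finite_imageD by blast
qed

text \<open>A maximiser of the Rayleigh quotient on the unit sphere is an eigenvector.\<close>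
lemma quadratic_form_le_lambda_max:
  fixes A :: "real ^ 'n ^ 'n"
  assumes sym: "transpose A = A"
  shows "x \<bullet> (A *v x) \<le> lambda_max A * (norm x)\<^sup>2"
proof -
  have adj: "x \<bullet> (A *v y) = (A *v x) \<bullet> y" for x y
    by (metis dot_lmul_matrix sym vector_transpose_matrix)
  let ?q = "\<lambda>x. x \<bullet> (A *v x)"
  have cont: "continuous_on (sphere 0 1) ?q"
    by (intro continuous_intros linear_continuous_on matrix_vector_mul_bounded_linear)
  have "axis undefined 1 \<in> sphere (0::real^'n) 1" by simp
  then have "sphere (0::real^'n) 1 \<noteq> {}" by blast
  then obtain v where v: "v \<in> sphere 0 1" "\<And>y. y \<in> sphere 0 1 \<Longrightarrow> ?q y \<le> ?q v"
    using continuous_attains_sup[OF compact_sphere _ cont] by blast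
  define l where "l = ?q v"
  have le: "?q y \<le> l * (norm y)\<^sup>2" for y
  proof (cases "y = 0")
    case False
    have "?q ((1 / norm y) *\<^sub>R y) \<le> l"
      unfolding l_def by (rule v(2)) (use False in simp)
    then show ?thesis using False
      by (simp add: matrix_vector_mult_scaleR field_simps power2_eq_square)
  qed simp
  have eig: "A *v v = l *\<^sub>R v"
  proof -
    let ?d = "A *v v - l *\<^sub>R v"
    have "?d \<bullet> u = 0" for u
    proof -
      \<comment> \<open>Inserting the perturbation \<open>v + e *\<^sub>R u\<close> into
        \<open>le\<close> leaves a term linear in \<open>e\<close> on the left and a quadratic one
        on the right.\<close>
      have le2: "2 * e * (?d \<bullet> u) \<le> e\<^sup>2 * (l * (norm u)\<^sup>2 - ?q u)" for e
      proof -
        have "?q (v + e *\<^sub>R u) = l + 2 * e * ((A *v v) \<bullet> u) + e\<^sup>2 * ?q u"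
          using adj[of v u] unfolding l_def
          by (simp add: matrix_vector_right_distrib matrix_vector_mult_scaleR inner_add_left inner_add_right
              power2_eq_square inner_commute[of u "A *v v"] algebra_simps)
        moreover have "(norm (v + e *\<^sub>R u))\<^sup>2 = 1 + 2 * e * (v \<bullet> u) + e\<^sup>2 * (norm u)\<^sup>2"
          using v(1) unfolding power2_norm_eq_inner
          by (simp add: inner_add_left inner_add_right power2_eq_square
              inner_commute[of u v] norm_eq_1 algebra_simps)
        ultimately show ?thesis
          using le[of "v + e *\<^sub>R u"] by (simp add: inner_diff_left algebra_simps)
      qed
      let ?c = "?d \<bullet> u" and ?b = "l * (norm u)\<^sup>2 - ?q u"
      have b: "?b \<ge> 0" using le[of u] by simp
      show "?c = 0"
      proof (rule ccontr)
        assume c: "?c \<noteq> 0"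
        \<comment> \<open>A step in the direction of \<open>?c\<close>, short enough for the linear
          term to win; adding 1 keeps the denominator positive when \<open>?b = 0\<close>.\<close>
        let ?e = "?c / (?b + 1)"
        have "2 * ?e * ?c \<le> ?e\<^sup>2 * ?b" by (rule le2)
        also have "\<dots> \<le> ?e\<^sup>2 * (?b + 1)" by (intro mult_left_mono) auto
        also have "\<dots> = ?e * ?c" using b by (simp add: power2_eq_square)
        finally have "?c\<^sup>2 / (?b + 1) \<le> 0" by (simp add: power2_eq_square)
        moreover have "?c\<^sup>2 / (?b + 1) > 0" using c b by (intro divide_pos_pos) auto
        ultimately show False by linarith
      qed
    qed
    from this[of ?d] show ?thesis by simp
  qed
  have "v \<noteq> 0" using v(1) by auto
  with eig have "l \<in> {l. \<exists>v. v \<noteq> 0 \<and> A *v v = l *\<^sub>R v}" by blast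
  then have "l \<le> lambda_max A"
    unfolding lambda_max_def by (rule Max_ge[OF symmetric_eigenvalues_finite[OF sym]])
  then show ?thesis using le[of x] by (meson mult_right_mono order_trans zero_le_power2)
qed

text \<open>Expanding the square yields the quadratic form of the symmetric matrix
  \<open>cov_mat M Z\<close>, so the Rayleigh bound applies.\<close>

lemma (in prob_space) variance_le_lambda_max:
  fixes Z :: "'a \<Rightarrow> real ^ 'n"
  assumes [measurable]: "Z \<in> borel_measurable M" and Z2: "integrable M (\<lambda>x. (norm (Z x))\<^sup>2)"
  shows "expectation (\<lambda>x. (w \<bullet> (Z x - expectation Z))\<^sup>2) \<le> lambda_max (cov_mat M Z) * (norm w)\<^sup>2"
    and "integrable M (\<lambda>x. (w \<bullet> (Z x - expectation Z))\<^sup>2)"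
proof -
  have iZn: "integrable M (\<lambda>x. norm (Z x))"
    by (rule square_integrable_imp_integrable) (use Z2 in auto)
  then have iZ: "integrable M Z" by (simp add: integrable_norm_iff)
  let ?C = "\<lambda>x. Z x - expectation Z"
  let ?b = "\<lambda>x. 2 * (norm (Z x))\<^sup>2 + 2 * (norm (expectation Z))\<^sup>2"
  have comp: "(LINT x|M. Z x $ i) = expectation Z $ i" for i
    using integral_bounded_linear[OF bounded_linear_vec_nth iZ] .
  have C2: "integrable M (\<lambda>x. (norm (?C x))\<^sup>2)"
  proof (rule Bochner_Integration.integrable_bound)
    show "integrable M (\<lambda>x. ?b x)" using Z2 by simp
    show "AE x in M. norm ((norm (?C x))\<^sup>2) \<le> norm (?b x)"
    proof (rule AE_I2)
      fix x
      have "(norm (?C x))\<^sup>2 \<le> (norm (Z x) + norm (expectation Z))\<^sup>2"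
        by (intro power_mono norm_triangle_ineq4) simp
      also have "\<dots> \<le> ?b x"
        using sum_squares_bound[of "norm (Z x)" "norm (expectation Z)"] by (simp add: power2_sum)
      finally show "norm ((norm (?C x))\<^sup>2) \<le> norm (?b x)" by simp
    qed
  qed measurable
  have iprod: "integrable M (\<lambda>x. ?C x $ i * ?C x $ j)" for i j
  proof (rule Bochner_Integration.integrable_bound[OF C2])
    have "(\<lambda>x. ?C x $ i) \<in> borel_measurable M" for i
      by (intro measurable_compose[OF _ borel_measurable_continuous_onI[OF continuous_on_component[OF continuous_on_id]]]) measurable
    then show "(\<lambda>x. ?C x $ i * ?C x $ j) \<in> borel_measurable M" by (intro borel_measurable_times)
    show "AE x in M. norm (?C x $ i * ?C x $ j) \<le> norm ((norm (?C x))\<^sup>2)"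
      by (rule AE_I2) (auto simp: abs_mult power2_eq_square simp del: vector_minus_component intro!: mult_mono component_le_norm_cart)
  qed
  have sq: "(w \<bullet> ?C x)\<^sup>2 = (\<Sum>i\<in>UNIV. \<Sum>j\<in>UNIV. w $ i * w $ j * (?C x $ i * ?C x $ j))" for x
    unfolding power2_eq_square inner_vec_def sum_product by (intro sum.cong refl) simp
  show i: "integrable M (\<lambda>x. (w \<bullet> (Z x - expectation Z))\<^sup>2)"
    unfolding sq using iprod by (intro Bochner_Integration.integrable_sum integrable_mult_right) auto
  have "expectation (\<lambda>x. (w \<bullet> ?C x)\<^sup>2) = (\<Sum>i\<in>UNIV. \<Sum>j\<in>UNIV. w $ i * w $ j * expectation (\<lambda>x. ?C x $ i * ?C x $ j))"
    unfolding sq using iprod by (simp add: Bochner_Integration.integral_sum del: vector_minus_component)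
  also have "\<dots> = w \<bullet> (cov_mat M Z *v w)"
    unfolding inner_vec_def matrix_vector_mult_def cov_mat_def comp
    by (simp add: sum_distrib_left mult_ac)
  also have "\<dots> \<le> lambda_max (cov_mat M Z) * (norm w)\<^sup>2"
    by (rule quadratic_form_le_lambda_max) (simp add: cov_mat_def transpose_def vec_eq_iff mult.commute)
  finally show "expectation (\<lambda>x. (w \<bullet> (Z x - expectation Z))\<^sup>2) \<le> lambda_max (cov_mat M Z) * (norm w)\<^sup>2" .
qed

section \<open>Characteristic functions under perturbations small in mean square\<close>

lemma norm_iexp_diff: "norm (iexp (x + y) - iexp x) \<le> \<bar>y\<bar>"
proof -
  have "iexp (x + y) - iexp x = iexp x * (iexp y - 1)"
    by (simp add: exp_add[symmetric] algebra_simps)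
  then have "norm (iexp (x + y) - iexp x) = norm (iexp y - 1)" by (simp add: norm_mult)
  also have "\<dots> \<le> \<bar>y\<bar>" using iexp_approx1[of y 0] by simp
  finally show ?thesis .
qed

text \<open>The characteristic function moves by at most the mean of \<bar>B\<bar>, and this mean is
  bounded by the root of the second moment because the variance of \<bar>B\<bar> is
  nonnegative.\<close>

lemma (in prob_space) cf_perturbed:
  fixes A B :: "nat \<Rightarrow> 'a \<Rightarrow> real"
  assumes [measurable]: "\<And>n. A n \<in> borel_measurable M" "\<And>n. B n \<in> borel_measurable M"
    and lim: "(\<lambda>n. expectation (\<lambda>x. iexp (A n x))) \<longlonglongrightarrow> l"
    and B2: "\<And>n. integrable M (\<lambda>x. (B n x)\<^sup>2)" and B_lim: "(\<lambda>n. expectation (\<lambda>x. (B n x)\<^sup>2)) \<longlonglongrightarrow> 0"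
  shows "(\<lambda>n. expectation (\<lambda>x. iexp (A n x + B n x))) \<longlonglongrightarrow> l"
proof -
  let ?d = "\<lambda>n. expectation (\<lambda>x. iexp (A n x + B n x)) - expectation (\<lambda>x. iexp (A n x))"
    and ?b = "\<lambda>n. sqrt (expectation (\<lambda>x. (B n x)\<^sup>2))"
  have "(\<lambda>n. ?d n) \<longlonglongrightarrow> 0"
  proof (rule Lim_null_comparison)
    show "\<forall>\<^sub>F n in sequentially. norm (?d n)
      \<le> ?b n"
    proof (rule always_eventually, rule allI)
      fix n
      have iB: "integrable M (B n)" by (rule square_integrable_imp_integrable) (use B2 in auto)
      have i: "integrable M (\<lambda>x. iexp (f x))" if [measurable]: "f \<in> borel_measurable M" for f
        by (rule integrable_const_bound[where B=1]) auto
      have i1: "integrable M (\<lambda>x. iexp (A n x + B n x))" and i2: "integrable M (\<lambda>x. iexp (A n x))"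
        by (rule i; measurable)+
      have "norm (?d n)
        = norm (expectation (\<lambda>x. iexp (A n x + B n x) - iexp (A n x)))"
        using i1 i2 by (subst Bochner_Integration.integral_diff) auto
      also have "\<dots> \<le> expectation (\<lambda>x. norm (iexp (A n x + B n x) - iexp (A n x)))"
        by (rule integral_norm_bound)
      also have "\<dots> \<le> expectation (\<lambda>x. \<bar>B n x\<bar>)"
        by (intro integral_mono norm_iexp_diff integrable_norm Bochner_Integration.integrable_diff i1 i2 integrable_abs iB)
      also have "\<dots> \<le> ?b n"
      proof (rule real_le_rsqrt)
        have "0 \<le> variance (\<lambda>x. \<bar>B n x\<bar>)" by (rule variance_positive)
        also have "\<dots> = expectation (\<lambda>x. (B n x)\<^sup>2) - (expectation (\<lambda>x. \<bar>B n x\<bar>))\<^sup>2"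
          using iB B2[of n] by (subst variance_eq) auto
        finally show "(expectation (\<lambda>x. \<bar>B n x\<bar>))\<^sup>2 \<le> expectation (\<lambda>x. (B n x)\<^sup>2)" by simp
      qed
      finally show "norm (?d n)
        \<le> ?b n" .
    qed
    show "(\<lambda>n. ?b n) \<longlonglongrightarrow> 0"
      using tendsto_real_sqrt[OF B_lim] by simp
  qed
  from tendsto_add[OF this lim] show ?thesis by simp
qed

section \<open>The smoothed mean\<close>

text \<open>Adding and subtracting the mean \<open>\<kappa> n\<close> in each kernel weight splits
  the scaled error into a sum with centred weights, governed by \<open>weighted_clt\<close>, and the
  scaled error \<open>R\<close> of the unsmoothed average.\<close>

lemma smooth_mean_clt:
  fixes M :: "'w measure" and U :: "nat \<Rightarrow> 'w \<Rightarrow> real ^ 'q" and V :: "nat \<Rightarrow> 'w \<Rightarrow> real"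
    and f K :: "real \<Rightarrow> real" and h :: "nat \<Rightarrow> real"
  assumes M: "prob_space M" and U_meas[measurable]: "\<And>i. U i \<in> borel_measurable M"
    and U_distr: "\<And>i. distr M borel (U i) = distr M borel (U 0)"
    and U2: "integrable M (\<lambda>y. (norm (U 0 y))\<^sup>2)"
    and lln: "AE y in M. (\<lambda>n. (\<Sum>i<n. (w \<bullet> U i y)\<^sup>2) / real n) \<longlonglongrightarrow> (LINT y|M. (w \<bullet> U 0 y)\<^sup>2)"
    and V_indep: "prob_space.indep_vars M (\<lambda>_. borel) V UNIV"
    and V_dens: "\<And>i. distributed M lborel (V i) (\<lambda>x. ennreal (f x))"
    and VU_indep: "indep_seq M V U"
    and f_nonneg: "\<And>x. f x \<ge> 0" and f_bounded: "bounded (range f)" and f_cont: "isCont f 0" and f_pos: "f 0 > 0"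
    and K_dens: "has_bochner_integral lborel K 1"
    and K_bounded: "bounded (range K)" and K_c2: "integrable lborel (\<lambda>u. (K u)\<^sup>2)"
    and h_pos: "\<And>n. n \<ge> 1 \<Longrightarrow> h n > 0" and h_lim: "h \<longlonglongrightarrow> 0"
    and nh_lim: "filterlim (\<lambda>n. real n * h n) at_top sequentially"
    and cov_lim: "(\<lambda>n. real n * h n * lambda_max (cov_mat M (\<lambda>y. (1 / real n) *\<^sub>R (\<Sum>i<n. U i y)))) \<longlonglongrightarrow> 0"
  shows "(\<lambda>n. LINT y|M. iexp (w \<bullet> (sqrt (real n * h n) *\<^sub>R (smooth_mean M U V K h n y - (LINT y|M. U 0 y)))))
    \<longlonglongrightarrow> complex_of_real (exp (- (c2 K / f 0 * (LINT y|M. (w \<bullet> U 0 y)\<^sup>2)) / 2))"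
proof -
  interpret prob_space M by (rule M)
  have K_int: "integrable lborel K" "(LINT u|lborel. K u) = 1"
    using K_dens by (auto simp: has_bochner_integral_iff)
  have [measurable]: "K \<in> borel_measurable borel" using K_int(1) by auto
  have V_meas[measurable]: "V i \<in> borel_measurable M" for i
    using V_indep by (auto simp: indep_vars_def)
  obtain B where B: "\<And>u. \<bar>K u\<bar> \<le> B" using K_bounded unfolding bounded_iff by auto
  define \<kappa> where "\<kappa> n = expectation (\<lambda>y. K (V 0 y / h n))" for n
  define s where "s n = expectation (\<lambda>y. (K (V 0 y / h n) - \<kappa> n)\<^sup>2)" for n
  define a where "a n = sqrt (real n * h n) / (real n * \<kappa> n)" for n
  define Y where "Y n i y = K (V i y / h n) - \<kappa> n" for n i y
  \<comment> \<open>Kernel moments per unit of bandwidth; they have the finite limits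
    \<open>f 0\<close> and \<open>f 0 * c2 K\<close>.\<close>
  define k1 where "k1 n = \<kappa> n / h n" for n
  define k2 where "k2 n = expectation (\<lambda>y. (K (V 0 y / h n))\<^sup>2) / h n" for n
  define \<mu> where "\<mu> = expectation (U 0)"
  let ?A = "\<lambda>n y. \<Sum>i<n. a n * (w \<bullet> U i y) * Y n i y"
  let ?L = "complex_of_real (exp (- (c2 K / f 0 * expectation (\<lambda>y. (w \<bullet> U 0 y)\<^sup>2)) / 2))"
  have V_same: "expectation (\<lambda>y. g (V i y)) = expectation (\<lambda>y. g (V 0 y))"
    if [measurable]: "g \<in> borel_measurable borel" for g :: "real \<Rightarrow> real" and i
    using distributed_integral[OF V_dens, of g i] distributed_integral[OF V_dens, of g 0] f_nonneg by simp
  have iK: "integrable M (\<lambda>y. K (V i y / h n))" for i n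
    by (rule integrable_const_bound[where B=B]) (use B in auto)
  have B2: "(K u)\<^sup>2 \<le> B\<^sup>2" for u using power_mono[OF B[of u], of 2] by simp
  have iK2: "integrable M (\<lambda>y. (K (V i y / h n))\<^sup>2)" for i n
    by (rule integrable_const_bound[where B="B\<^sup>2"]) (use B2 in auto)
  have \<kappa>_bd: "\<bar>\<kappa> n\<bar> \<le> B" for n
  proof -
    have "\<bar>\<kappa> n\<bar> \<le> expectation (\<lambda>y. \<bar>K (V 0 y / h n)\<bar>)" unfolding \<kappa>_def by (rule integral_abs_bound)
    also have "\<dots> \<le> expectation (\<lambda>y. B)" using iK B by (intro integral_mono) auto
    finally show ?thesis by (simp add: prob_space)
  qed
  have k1_lim: "k1 \<longlonglongrightarrow> f 0"
    using kernel_moment_asymptotics[OF V_dens f_nonneg f_bounded f_cont K_int(1) h_lim h_pos, of 0] K_int(2)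
    unfolding k1_def \<kappa>_def by simp
  have k2_lim: "k2 \<longlonglongrightarrow> f 0 * c2 K"
    using kernel_moment_asymptotics[OF V_dens f_nonneg f_bounded f_cont K_c2 h_lim h_pos, of 0]
    unfolding k2_def c2_def by simp
  have ev: "eventually (\<lambda>n. n \<ge> 1 \<and> h n > 0 \<and> k1 n > 0 \<and> \<kappa> n \<noteq> 0) sequentially"
    using eventually_ge_at_top[of 1] order_tendstoD(1)[OF k1_lim f_pos]
    by eventually_elim (use h_pos in \<open>auto simp: k1_def\<close>)
  \<comment> \<open>The squared mean carries one more factor \<open>h n\<close> than the second
    moment and so disappears in the limit.\<close>
  have s_eq: "s n = h n * (k2 n - (k1 n)\<^sup>2 * h n)" if "h n > 0" for n
  proof -
    have "s n = expectation (\<lambda>y. (K (V 0 y / h n))\<^sup>2) - (\<kappa> n)\<^sup>2"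
      unfolding s_def \<kappa>_def by (rule variance_eq) (use iK iK2 in auto)
    also have "\<dots> = h n * (k2 n - (k1 n)\<^sup>2 * h n)"
      unfolding k1_def k2_def using that by (simp add: power2_eq_square right_diff_distrib)
    finally show ?thesis .
  qed
  have a_eq: "a n = inverse (sqrt (real n * h n)) * inverse (k1 n)" if "n \<ge> 1" "h n > 0" "k1 n > 0" for n
  proof -
    have "real n * \<kappa> n = sqrt (real n * h n) * sqrt (real n * h n) * k1 n"
      using that by (simp add: k1_def)
    moreover have "sqrt (real n * h n) > 0" using that by simp
    ultimately show ?thesis using that unfolding a_def by (simp add: field_simps)
  qed
  have a_lim: "a \<longlonglongrightarrow> 0"
  proof (rule Lim_transform_eventually)
    have "(\<lambda>n. inverse (sqrt (real n * h n))) \<longlonglongrightarrow> 0"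
      by (intro tendsto_inverse_0_at_top filterlim_compose[OF sqrt_at_top] nh_lim)
    then have "(\<lambda>n. inverse (sqrt (real n * h n)) * inverse (k1 n)) \<longlonglongrightarrow> 0 * inverse (f 0)"
      by (intro tendsto_intros k1_lim) (use f_pos in auto)
    then show "(\<lambda>n. inverse (sqrt (real n * h n)) * inverse (k1 n)) \<longlonglongrightarrow> 0" by simp
    show "\<forall>\<^sub>F n in sequentially. inverse (sqrt (real n * h n)) * inverse (k1 n) = a n"
      using ev by eventually_elim (use a_eq in auto)
  qed
  \<comment> \<open>With \<open>a_eq\<close>, the sample size and bandwidth cancel and leave
    \<open>(k2 n - (k1 n)\<^sup>2 * h n) / (k1 n)\<^sup>2\<close>, whose limit is
    \<open>f 0 * c2 K / (f 0)\<^sup>2\<close>.\<close>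
  have s_lim: "(\<lambda>n. real n * (a n)\<^sup>2 * s n) \<longlonglongrightarrow> c2 K / f 0"
  proof (rule Lim_transform_eventually)
    have "(\<lambda>n. (k2 n - (k1 n)\<^sup>2 * h n) / (k1 n)\<^sup>2) \<longlonglongrightarrow> (f 0 * c2 K - (f 0)\<^sup>2 * 0) / (f 0)\<^sup>2"
      by (intro tendsto_intros k1_lim k2_lim h_lim) (use f_pos in auto)
    then show "(\<lambda>n. (k2 n - (k1 n)\<^sup>2 * h n) / (k1 n)\<^sup>2) \<longlonglongrightarrow> c2 K / f 0"
      using f_pos by (simp add: power2_eq_square)
    show "\<forall>\<^sub>F n in sequentially. (k2 n - (k1 n)\<^sup>2 * h n) / (k1 n)\<^sup>2 = real n * (a n)\<^sup>2 * s n"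
      using ev
    proof eventually_elim
      case (elim n)
      have "(a n)\<^sup>2 = inverse (real n * h n) * inverse ((k1 n)\<^sup>2)"
        using elim a_eq[of n] by (simp add: power_mult_distrib power_inverse)
      moreover have "s n = h n * (k2 n - (k1 n)\<^sup>2 * h n)" using elim s_eq[of n] by blast
      ultimately have "real n * (a n)\<^sup>2 * s n = (real n * h n * inverse (real n * h n)) * ((k2 n - (k1 n)\<^sup>2 * h n) * inverse ((k1 n)\<^sup>2))"
        by (simp only: mult_ac)
      also have "real n * h n * inverse (real n * h n) = 1" by (rule right_inverse) (use elim in auto)
      finally show ?case by (simp add: divide_inverse)
    qed
  qed
  have main: "(\<lambda>n. expectation (\<lambda>y. iexp (?A n y)))
    \<longlonglongrightarrow> ?L"
  proof -
    have "expectation (\<lambda>y. iexp (?A n y))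
      = (LINT y'|M. LINT y|M. iexp (\<Sum>i<n. a n * (w \<bullet> U i y') * Y n i y))" for n
    proof -
      let ?F = "\<lambda>(v :: nat \<Rightarrow> real, u :: nat \<Rightarrow> real ^ 'q). iexp (\<Sum>i<n. a n * (w \<bullet> u i) * (K (v i / h n) - \<kappa> n))"
      have "?F \<in> borel_measurable ((\<Pi>\<^sub>M i\<in>UNIV. borel) \<Otimes>\<^sub>M (\<Pi>\<^sub>M i\<in>UNIV. borel))" by measurable
      from indep_seq_integral[OF M V_meas U_meas VU_indep this, of 1]
      show ?thesis by (simp add: Y_def case_prod_unfold)
    qed
    moreover have "(\<lambda>n. LINT y'|M. LINT y|M. iexp (\<Sum>i<n. a n * (w \<bullet> U i y') * Y n i y))
      \<longlonglongrightarrow> ?L"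
    \<comment> \<open>The kernel and its mean are each bounded by \<open>B\<close>, hence the
      centred weight by \<open>2 * B\<close>.\<close>
    proof (rule weighted_clt[where C="2 * B" and s=s])
      show "distr M borel (\<lambda>y. w \<bullet> U i y) = distr M borel (\<lambda>y. w \<bullet> U 0 y)" for i
        using distr_distr[of "\<lambda>u. w \<bullet> u" borel borel "U i" M] distr_distr[of "\<lambda>u. w \<bullet> u" borel borel "U 0" M] U_distr[of i]
        by (simp add: comp_def)
      show "integrable M (\<lambda>y. (w \<bullet> U 0 y)\<^sup>2)"
      proof (rule Bochner_Integration.integrable_bound[OF integrable_mult_right[OF U2, of "(norm w)\<^sup>2"]])
        show "AE y in M. norm ((w \<bullet> U 0 y)\<^sup>2) \<le> norm ((norm w)\<^sup>2 * (norm (U 0 y))\<^sup>2)"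
        proof (rule AE_I2)
          fix y
          have "\<bar>w \<bullet> U 0 y\<bar>\<^sup>2 \<le> (norm w * norm (U 0 y))\<^sup>2"
            by (intro power_mono Cauchy_Schwarz_ineq2) auto
          then show "norm ((w \<bullet> U 0 y)\<^sup>2) \<le> norm ((norm w)\<^sup>2 * (norm (U 0 y))\<^sup>2)"
            by (simp add: power_mult_distrib)
        qed
      qed measurable
      show "indep_vars (\<lambda>_. borel) (Y n) {..<n}" for n
        using indep_vars_compose2[OF indep_vars_subset[OF V_indep, of "{..<n}"], of "\<lambda>i v. K (v / h n) - \<kappa> n" "\<lambda>_. borel"]
        unfolding Y_def[abs_def] by simp
      show "\<bar>Y n i y\<bar> \<le> 2 * B" for n i y
        using B[of "V i y / h n"] \<kappa>_bd[of n] unfolding Y_def by linarith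
      show "expectation (Y n i) = 0" for n i
        using iK V_same[of "\<lambda>v. K (v / h n)" i] unfolding Y_def[abs_def] by (simp add: \<kappa>_def prob_space)
      show "expectation (\<lambda>y. (Y n i y)\<^sup>2) = s n" for n i
        using V_same[of "\<lambda>v. (K (v / h n) - \<kappa> n)\<^sup>2" i] by (simp add: Y_def s_def)
    qed (use lln a_lim s_lim in auto)
    ultimately show ?thesis by simp
  qed
  define Ubar where "Ubar n y = (1 / real n) *\<^sub>R (\<Sum>i<n. U i y)" for n y
  define R where "R n y = sqrt (real n * h n) * (w \<bullet> (Ubar n y - \<mu>))" for n y
  have [measurable]: "Ubar n \<in> borel_measurable M" for n unfolding Ubar_def by measurable
  have [measurable]: "Y n i \<in> borel_measurable M" for n i unfolding Y_def by measurable
  have U2i: "integrable M (\<lambda>y. (norm (U i y))\<^sup>2)" for i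
  proof -
    have "integrable (distr M borel (U j)) (\<lambda>u. (norm u)\<^sup>2) \<longleftrightarrow> integrable M (\<lambda>y. (norm (U j y))\<^sup>2)" for j
      by (rule integrable_distr_eq) measurable
    from this[of i] this[of 0] U2 U_distr[of i] show ?thesis by simp
  qed
  have iU: "integrable M (U i)" for i
  proof -
    have "integrable M (\<lambda>y. norm (U i y))"
      by (rule square_integrable_imp_integrable) (use U2i in auto)
    then show ?thesis by (simp add: integrable_norm_iff)
  qed
  have EU: "expectation (U i) = \<mu>" for i
  proof -
    have "expectation (U j) = (LINT u|distr M borel (U j). u)" for j
      by (rule integral_distr[symmetric]) auto
    then show ?thesis by (simp only: U_distr[of i] \<mu>_def)
  qed
  have EUbar: "expectation (Ubar n) = \<mu>" if "n \<ge> 1" for n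
  proof -
    have "expectation (Ubar n) = (1 / real n) *\<^sub>R (\<Sum>i<n. expectation (U i))"
      unfolding Ubar_def[abs_def] using iU by (subst integral_scaleR_right) (simp add: Bochner_Integration.integral_sum)
    also have "\<dots> = \<mu>" using that by (simp only: EU sum_constant_scaleR card_lessThan) simp
    finally show ?thesis .
  qed
  have Ubar2: "integrable M (\<lambda>y. (norm (Ubar n y))\<^sup>2)" for n
  proof (rule Bochner_Integration.integrable_bound)
    show "integrable M (\<lambda>y. (1 / real n)\<^sup>2 * (real n * (\<Sum>i<n. (norm (U i y))\<^sup>2)))"
      using U2i by auto
    show "AE y in M. norm ((norm (Ubar n y))\<^sup>2) \<le> norm ((1 / real n)\<^sup>2 * (real n * (\<Sum>i<n. (norm (U i y))\<^sup>2)))"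
    proof (rule AE_I2)
      fix y
      have "(norm (\<Sum>i<n. U i y))\<^sup>2 \<le> (\<Sum>i<n. norm (U i y))\<^sup>2"
        by (intro power_mono norm_sum) auto
      also have "\<dots> \<le> real n * (\<Sum>i<n. (norm (U i y))\<^sup>2)"
        using sum_squared_le_sum_of_squares[of "\<lambda>i. norm (U i y)" "{..<n}"] by (simp add: mult.commute)
      finally have "(1 / real n)\<^sup>2 * (norm (\<Sum>i<n. U i y))\<^sup>2 \<le> (1 / real n)\<^sup>2 * (real n * (\<Sum>i<n. (norm (U i y))\<^sup>2))"
        by (rule mult_left_mono) simp
      then have "(norm (Ubar n y))\<^sup>2 \<le> (1 / real n)\<^sup>2 * (real n * (\<Sum>i<n. (norm (U i y))\<^sup>2))"
        by (simp add: Ubar_def power_mult_distrib power_divide)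
      also have "\<dots> \<le> norm \<dots>" unfolding real_norm_def by (rule abs_ge_self)
      finally show "norm ((norm (Ubar n y))\<^sup>2) \<le> norm ((1 / real n)\<^sup>2 * (real n * (\<Sum>i<n. (norm (U i y))\<^sup>2)))"
        by simp
    qed
  qed measurable
  have R2: "integrable M (\<lambda>y. (R n y)\<^sup>2)" for n
  \<comment> \<open>\<open>EUbar\<close> identifies the mean for n \<ge> 1; at n = 0 the factor
    \<open>sqrt 0\<close> makes \<open>R\<close> vanish.\<close>
  proof (cases "n \<ge> 1")
    case True
    show ?thesis
      using variance_le_lambda_max(2)[OF _ Ubar2, of n w] EUbar[OF True] by (simp add: R_def power_mult_distrib)
  next
    case False
    then have "n = 0" by simp
    then show ?thesis by (simp add: R_def)
  qed
  have R_lim: "(\<lambda>n. expectation (\<lambda>y. (R n y)\<^sup>2)) \<longlonglongrightarrow> 0"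
  proof (rule tendsto_sandwich)
    show "\<forall>\<^sub>F n in sequentially. 0 \<le> expectation (\<lambda>y. (R n y)\<^sup>2)"
      by (intro always_eventually allI Bochner_Integration.integral_nonneg) simp
    show "\<forall>\<^sub>F n in sequentially. expectation (\<lambda>y. (R n y)\<^sup>2) \<le> real n * h n * lambda_max (cov_mat M (Ubar n)) * (norm w)\<^sup>2"
      using ev
    proof eventually_elim
      case (elim n)
      have "expectation (\<lambda>y. (R n y)\<^sup>2) = real n * h n * expectation (\<lambda>y. (w \<bullet> (Ubar n y - \<mu>))\<^sup>2)"
        using elim by (simp add: R_def power_mult_distrib)
      also have "\<dots> \<le> real n * h n * (lambda_max (cov_mat M (Ubar n)) * (norm w)\<^sup>2)"
        using variance_le_lambda_max(1)[OF _ Ubar2, of n w] EUbar[of n] elim by (intro mult_left_mono) auto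
      finally show ?case by (simp add: mult.assoc)
    qed
    have "(\<lambda>n. real n * h n * lambda_max (cov_mat M (Ubar n)) * (norm w)\<^sup>2) \<longlonglongrightarrow> 0 * (norm w)\<^sup>2"
      using cov_lim unfolding Ubar_def[abs_def] by (intro tendsto_intros)
    then show "(\<lambda>n. real n * h n * lambda_max (cov_mat M (Ubar n)) * (norm w)\<^sup>2) \<longlonglongrightarrow> 0" by simp
  qed simp
  have "(\<lambda>n. expectation (\<lambda>y. iexp ((?A n y) + R n y)))
    \<longlonglongrightarrow> ?L"
    by (rule cf_perturbed[OF _ _ main R2 R_lim]) (unfold R_def, measurable)
  then show ?thesis
  proof (rule Lim_transform_eventually)
    show "\<forall>\<^sub>F n in sequentially. expectation (\<lambda>y. iexp ((?A n y) + R n y))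
      = expectation (\<lambda>y. iexp (w \<bullet> (sqrt (real n * h n) *\<^sub>R (smooth_mean M U V K h n y - expectation (U 0)))))"
      using ev
    proof eventually_elim
      case (elim n)
      \<comment> \<open>The centring part of \<open>?A\<close> contributes minus
        \<open>?r * (?S / real n)\<close>, which cancels the average in \<open>R\<close>; only the
        smoothed mean and \<open>\<mu>\<close> remain.\<close>
      have "(?A n y) + R n y
        = w \<bullet> (sqrt (real n * h n) *\<^sub>R (smooth_mean M U V K h n y - expectation (U 0)))" for y
      proof -
        let ?r = "sqrt (real n * h n)" and ?S = "\<Sum>i<n. w \<bullet> U i y" and ?T = "\<Sum>i<n. K (V i y / h n) * (w \<bullet> U i y)"
        have "(?A n y) = a n * (?T - \<kappa> n * ?S)"
          unfolding Y_def by (simp add: sum_distrib_left sum_subtractf algebra_simps)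
        also have "\<dots> = ?r * (?T / (real n * \<kappa> n)) - ?r * (?S / real n)"
          using elim by (simp add: a_def field_simps)
        finally show ?thesis
          unfolding R_def Ubar_def smooth_mean_def \<mu>_def \<kappa>_def[symmetric]
          by (simp add: inner_diff_right inner_sum_right algebra_simps)
      qed
      then show ?case by simp
    qed
  qed
qed

section \<open>Matrices and quadratic forms\<close>

lemma matrix_inv_inverse:
  assumes "invertible A"
  shows "A ** matrix_inv A = mat 1" and "matrix_inv A ** A = mat 1"
proof -
  have "A ** matrix_inv A = mat 1 \<and> matrix_inv A ** A = mat 1"
    unfolding matrix_inv_def using assms[unfolded invertible_def] by (rule someI_ex)
  then show "A ** matrix_inv A = mat 1" "matrix_inv A ** A = mat 1" by auto
qed

lemma matrix_inv_eqI:
  fixes A B :: "real ^ 'n ^ 'n"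
  assumes "A ** B = mat 1"
  shows "matrix_inv A = B"
proof -
  have "B ** A = mat 1" using assms matrix_left_right_inverse by blast
  then have "invertible A" using assms by (auto simp: invertible_def)
  have "matrix_inv A = (B ** A) ** matrix_inv A" using \<open>B ** A = mat 1\<close> by simp
  also have "\<dots> = B" 
    by (simp add: matrix_mul_assoc[symmetric] matrix_inv_inverse[OF \<open>invertible A\<close>])
  finally show ?thesis .
qed

lemma tendsto_matrix_matrix_mult:
  fixes A :: "'x \<Rightarrow> real ^ 'n ^ 'm" and B :: "'x \<Rightarrow> real ^ 'l ^ 'n"
  assumes "(A \<longlongrightarrow> a) F" "(B \<longlongrightarrow> b) F"
  shows "((\<lambda>x. A x ** B x) \<longlongrightarrow> a ** b) F"
  unfolding matrix_matrix_mult_def using assms by (intro tendsto_vec_lambda tendsto_intros)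

lemma tendsto_matrix_vector_mult:
  fixes A :: "'x \<Rightarrow> real ^ 'n ^ 'm" and v :: "'x \<Rightarrow> real ^ 'n"
  assumes "(A \<longlongrightarrow> a) F" "(v \<longlongrightarrow> b) F"
  shows "((\<lambda>x. A x *v v x) \<longlongrightarrow> a *v b) F"
  unfolding matrix_vector_mult_def using assms by (intro tendsto_vec_lambda tendsto_intros)

lemma tendsto_transpose:
  fixes A :: "'x \<Rightarrow> real ^ 'n ^ 'm"
  assumes "(A \<longlongrightarrow> a) F"
  shows "((\<lambda>x. transpose (A x)) \<longlongrightarrow> transpose a) F"
  unfolding transpose_def using assms by (intro tendsto_vec_lambda tendsto_intros)

lemma tendsto_det:
  fixes A :: "'x \<Rightarrow> real ^ 'n ^ 'n"
  assumes "(A \<longlongrightarrow> a) F"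
  shows "((\<lambda>x. det (A x)) \<longlongrightarrow> det a) F"
  unfolding det_def using assms by (intro tendsto_intros)

text \<open>Writes the entries of the inverse as quotients of determinants, which reduces continuity
  of inversion to \<open>tendsto_det\<close>.\<close>

lemma matrix_inv_cramer:
  fixes A :: "real ^ 'n ^ 'n"
  assumes "det A \<noteq> 0"
  shows "matrix_inv A = (\<chi> i j. det (\<chi> k l. if l = i then axis j 1 $ k else A $ k $ l) / det A)"
proof -
  have inv: "invertible A" using assms by (simp add: invertible_det_nz)
  have "matrix_inv A *v axis j 1 = (\<chi> i. det (\<chi> k l. if l = i then axis j 1 $ k else A $ k $ l) / det A)" for j
    unfolding cramer[OF assms, symmetric]
    by (simp add: matrix_vector_mul_assoc matrix_inv_inverse[OF inv])
  moreover have "matrix_inv A $ i $ j = (matrix_inv A *v axis j 1) $ i" for i j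
    by (simp add: matrix_vector_mul_component inner_axis)
  ultimately show ?thesis by (simp add: vec_eq_iff)
qed

lemma tendsto_matrix_inv:
  fixes A :: "'x \<Rightarrow> real ^ 'n ^ 'n"
  assumes A: "(A \<longlongrightarrow> a) F" and a: "invertible a"
  shows "((\<lambda>x. matrix_inv (A x)) \<longlongrightarrow> matrix_inv a) F"
    and "\<forall>\<^sub>F x in F. invertible (A x)"
proof -
  have a0: "det a \<noteq> 0" using a by (simp add: invertible_det_nz)
  have ev: "\<forall>\<^sub>F x in F. det (A x) \<noteq> 0"
    using tendsto_imp_eventually_ne[OF tendsto_det[OF A] a0] .
  then show "\<forall>\<^sub>F x in F. invertible (A x)" by (simp add: invertible_det_nz)
  let ?C = "\<lambda>A::real^'n^'n. (\<chi> i j. det (\<chi> k l. if l = i then axis j 1 $ k else A $ k $ l) / det A) :: real ^ 'n ^ 'n"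
  have ent: "((\<lambda>x. if l = i then axis j 1 $ k else A x $ k $ l) \<longlongrightarrow> (if l = i then axis j 1 $ k else a $ k $ l)) F" for i j k l
    using A by (auto intro!: tendsto_intros)
  have "((\<lambda>x. ?C (A x)) \<longlongrightarrow> ?C a) F"
    by (intro tendsto_vec_lambda tendsto_divide tendsto_det A a0 ent)
  then show "((\<lambda>x. matrix_inv (A x)) \<longlongrightarrow> matrix_inv a) F"
    unfolding matrix_inv_cramer[OF a0]
    by (rule Lim_transform_eventually) (use ev in \<open>auto elim!: eventually_mono simp: matrix_inv_cramer\<close>)
qed

text \<open>The norm of a matrix, as a vector of rows, is the Frobenius norm, so Cauchy-Schwarz in
  each row is enough.\<close>

lemma norm_matrix_vector_mult_le:
  fixes A :: "real ^ 'n ^ 'm"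
  shows "norm (A *v x) \<le> norm A * norm x"
proof -
  have "norm (A *v x) = L2_set (\<lambda>i. norm ((A *v x) $ i)) UNIV" by (simp add: norm_vec_def)
  also have "\<dots> \<le> L2_set (\<lambda>i. norm (A $ i) * norm x) UNIV"
    by (intro L2_set_mono) (auto simp: matrix_vector_mul_component Cauchy_Schwarz_ineq2)
  also have "\<dots> = norm A * norm x"
    by (simp add: norm_vec_def[of A] L2_set_left_distrib)
  finally show ?thesis .
qed

text \<open>Gram-Schmidt with respect to the inner product defined by \<open>A\<close>.\<close>
lemma conjugate_basis_exists:
  fixes A :: "real ^ 'k ^ 'k" and S :: "'k set"
  assumes sym: "transpose A = A" and pos: "\<And>v. v \<noteq> 0 \<Longrightarrow> v \<bullet> (A *v v) > 0"
  shows "\<exists>u. \<forall>i\<in>S. \<forall>j\<in>S. u i \<bullet> (A *v u j) = (if i = j then 1 else 0)"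
proof -
  have adj: "x \<bullet> (A *v y) = y \<bullet> (A *v x)" for x y
    by (metis dot_lmul_matrix sym vector_transpose_matrix inner_commute)
  have "finite S" by simp
  then show ?thesis
  proof (induction S rule: finite_induct)
    case (insert s S)
    then obtain u where u: "\<And>i j. i \<in> S \<Longrightarrow> j \<in> S \<Longrightarrow> u i \<bullet> (A *v u j) = (if i = j then 1 else 0)" by blast
    \<comment> \<open>Fewer than \<open>CARD('k)\<close> vectors \<open>A *v u i\<close> are
      present, so some nonzero \<open>x\<close> is orthogonal to all of them, that is, conjugate to
      the earlier \<open>u i\<close>.\<close>
    have "dim ((\<lambda>i. A *v u i) ` S) \<le> card S"
      by (metis card_image_le dim_le_card' finite finite_imageI le_trans)
    also have "\<dots> < CARD('k)" using insert(2) by (intro psubset_card_mono) auto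
    finally have "dim ((\<lambda>i. A *v u i) ` S) < DIM(real ^ 'k)" by simp
    then obtain x where x: "x \<noteq> 0" "\<And>y. y \<in> span ((\<lambda>i. A *v u i) ` S) \<Longrightarrow> x \<bullet> y = 0"
      using lowdim_subset_hyperplane by blast
    let ?y = "(1 / sqrt (x \<bullet> (A *v x))) *\<^sub>R x"
    have xu: "x \<bullet> (A *v u i) = 0" if "i \<in> S" for i
      using x(2)[OF span_base] that by auto
    have yy: "?y \<bullet> (A *v ?y) = 1"
    proof -
      let ?r = "x \<bullet> (A *v x)"
      have "?y \<bullet> (A *v ?y) = ?r / (sqrt ?r * sqrt ?r)" by (simp add: matrix_vector_mult_scaleR)
      also have "sqrt ?r * sqrt ?r = ?r" using pos[OF x(1)] by (intro real_sqrt_mult_self[THEN trans]) simp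
      finally show ?thesis using pos[OF x(1)] by simp
    qed
    have yu: "?y \<bullet> (A *v u i) = 0" "u i \<bullet> (A *v ?y) = 0" if "i \<in> S" for i
      using xu[OF that] adj[of "u i" ?y] by simp_all
    have "(u(s := ?y)) i \<bullet> (A *v (u(s := ?y)) j) = (if i = j then 1 else 0)" if ij: "i \<in> insert s S" "j \<in> insert s S" for i j
    proof -
      consider "i = s" "j = s" | "i = s" "j \<in> S" "j \<noteq> s" | "i \<in> S" "i \<noteq> s" "j = s" | "i \<in> S" "i \<noteq> s" "j \<in> S" "j \<noteq> s"
        using ij by blast
      then show ?thesis
        by cases (simp_all only: fun_upd_same fun_upd_other yy yu u simp_thms if_True if_False not_sym cong: if_cong)
    qed
    then show ?case by blast
  qed simp
qed

text \<open>If the rows of \<open>P\<close> form a conjugate basis, then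
  \<open>P ** A ** transpose P\<close> is the identity, hence the inverse of \<open>A\<close> is
  \<open>transpose P ** P\<close> and its form is a sum of squares. \<open>P\<close> plays the role
  of a square root of the inverse.\<close>

lemma inverse_quadratic_form_decomposition:
  fixes A :: "real ^ 'k ^ 'k"
  assumes sym: "transpose A = A" and pos: "\<And>v. v \<noteq> 0 \<Longrightarrow> v \<bullet> (A *v v) > 0"
  obtains u :: "nat \<Rightarrow> real ^ 'k"
  where "\<And>i j. i < CARD('k) \<Longrightarrow> j < CARD('k) \<Longrightarrow> u i \<bullet> (A *v u j) = (if i = j then 1 else 0)"
    and "\<And>x. x \<bullet> (matrix_inv A *v x) = (\<Sum>i<CARD('k). (u i \<bullet> x)\<^sup>2)"
proof -
  obtain u :: "'k \<Rightarrow> real ^ 'k" where u: "\<And>i j. u i \<bullet> (A *v u j) = (if i = j then 1 else 0)"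
    using conjugate_basis_exists[OF sym pos, of UNIV] by auto
  define P :: "real ^ 'k ^ 'k" where "P = (\<chi> i. u i)"
  have PT: "transpose P *v axis j 1 = u j" for j
    by (simp add: P_def vec_eq_iff matrix_vector_mul_component transpose_def inner_axis)
  have "P ** (A ** transpose P) = mat 1"
  proof -
    have "(P ** (A ** transpose P)) $ i $ j = (mat 1 :: real ^ 'k ^ 'k) $ i $ j" for i j
    proof -
      have "(P ** (A ** transpose P)) $ i $ j = ((P ** (A ** transpose P)) *v axis j 1) $ i"
        by (simp add: matrix_vector_mul_component inner_axis)
      also have "\<dots> = u i \<bullet> (A *v u j)"
        unfolding matrix_vector_mul_assoc[symmetric] PT by (simp add: matrix_vector_mul_component P_def)
      finally show ?thesis by (simp add: u mat_def)
    qed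
    then show ?thesis by (simp add: vec_eq_iff)
  qed
  then have "A ** (transpose P ** P) = mat 1"
    using matrix_left_right_inverse by (metis matrix_mul_assoc)
  then have inv: "matrix_inv A = transpose P ** P" by (rule matrix_inv_eqI)
  have quad: "x \<bullet> (matrix_inv A *v x) = (\<Sum>i\<in>UNIV. (u i \<bullet> x)\<^sup>2)" for x
  proof -
    have "x \<bullet> (matrix_inv A *v x) = (P *v x) \<bullet> (P *v x)"
      unfolding inv by (metis dot_lmul_matrix matrix_vector_mul_assoc transpose_matrix_vector transpose_transpose vector_transpose_matrix)
    also have "\<dots> = (\<Sum>i\<in>UNIV. ((P *v x) $ i)\<^sup>2)"
      by (simp add: inner_vec_def power2_eq_square)
    finally show ?thesis by (simp add: matrix_vector_mul_component P_def)
  qed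
  \<comment> \<open>The basis is renumbered by the naturals below \<open>CARD('k)\<close> to match
    the index set in \<open>chi_squared\<close>.\<close>
  obtain e where e: "bij_betw e {0..<CARD('k)} (UNIV :: 'k set)"
    using ex_bij_betw_nat_finite[OF finite_class.finite_UNIV] by blast
  then have e: "bij_betw e {..<CARD('k)} UNIV" by (simp add: atLeast0LessThan)
  show ?thesis
  proof (rule that[of "u \<circ> e"])
    show "(u \<circ> e) i \<bullet> (A *v (u \<circ> e) j) = (if i = j then 1 else 0)" if "i < CARD('k)" "j < CARD('k)" for i j
      using that bij_betw_imp_inj_on[OF e] by (auto simp: u inj_on_def)
    show "x \<bullet> (matrix_inv A *v x) = (\<Sum>i<CARD('k). ((u \<circ> e) i \<bullet> x)\<^sup>2)" for x
      unfolding quad using sum.reindex_bij_betw[OF e, of "\<lambda>i. (u i \<bullet> x)\<^sup>2"] by simp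
  qed
qed

text \<open>The limiting form is the sum of the squares of \<open>c i \<bullet> Z\<close>, where the
  \<open>c i\<close> are orthonormal for the form of \<open>G\<close>. Hence the limit in
  \<open>cf_imp_laplace\<close> depends on the Gaussian coefficients only through the sum of their
  squares, which is the chi-squared transform.\<close>

lemma quadratic_form_weak_conv_chi_squared:
  fixes M :: "'w measure" and Z :: "nat \<Rightarrow> 'w \<Rightarrow> real ^ 'q" and G :: "real ^ 'q ^ 'q" and H :: "real ^ 'q ^ 'k"
  assumes M: "prob_space M" and Z[measurable]: "\<And>n. Z n \<in> borel_measurable M"
    and cf: "\<And>w. (\<lambda>n. LINT p|M. iexp (w \<bullet> Z n p)) \<longlonglongrightarrow> complex_of_real (exp (- (w \<bullet> (G *v w)) / 2))"
    and G: "transpose G = G" and pos: "\<And>v. v \<noteq> 0 \<Longrightarrow> v \<bullet> ((H ** G ** transpose H) *v v) > 0"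
    and W: "\<And>n. W n \<in> borel_measurable M"
    and close: "\<And>e. e > 0 \<Longrightarrow> whp M (\<lambda>n p. \<bar>W n p - (H *v Z n p) \<bullet> (matrix_inv (H ** G ** transpose H) *v (H *v Z n p))\<bar> < e)"
  shows "weak_conv_m (\<lambda>n. distr M borel (W n)) (chi_squared CARD('k))"
proof -
  let ?A = "H ** G ** transpose H" and ?k = "CARD('k)"
  have symA: "transpose ?A = ?A"
    by (simp add: matrix_transpose_mul transpose_transpose G matrix_mul_assoc)
  obtain u :: "nat \<Rightarrow> real ^ 'k"
    where u: "\<And>i j. i < ?k \<Longrightarrow> j < ?k \<Longrightarrow> u i \<bullet> (?A *v u j) = (if i = j then 1 else 0)"
    and dec: "\<And>x. x \<bullet> (matrix_inv ?A *v x) = (\<Sum>i<?k. (u i \<bullet> x)\<^sup>2)"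
    using inverse_quadratic_form_decomposition[OF symA pos] by blast
  define c where "c i = transpose H *v u i" for i
  have uH: "u i \<bullet> (H *v z) = c i \<bullet> z" for i z
    unfolding c_def by (metis dot_lmul_matrix transpose_matrix_vector)
  have cc: "c i \<bullet> (G *v c j) = (if i = j then 1 else 0)" if "i < ?k" "j < ?k" for i j
  proof -
    have "?A *v u j = H *v (G *v c j)" by (simp only: c_def matrix_vector_mul_assoc matrix_mul_assoc)
    then show ?thesis using u[OF that] uH[of i "G *v c j"] by simp
  qed
  define T where "T n p = (\<Sum>i<?k. (c i \<bullet> Z n p)\<^sup>2)" for n p
  have T_eq: "(H *v Z n p) \<bullet> (matrix_inv ?A *v (H *v Z n p)) = T n p" for n p
    unfolding dec T_def uH ..
  have Tm[measurable]: "T n \<in> borel_measurable M" for n unfolding T_def by measurable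
  show ?thesis
  proof (rule weak_conv_perturbed[OF M Tm W real_distribution_chi_squared _ close[unfolded T_eq]])
    fix x y :: real assume "x < y"
    then show "(\<lambda>n. LINT p|M. cts_step x y (T n p)) \<longlonglongrightarrow> (LINT t|chi_squared ?k. cts_step x y t)"
    proof (rule laplace_transforms_imp_cts_step[OF M Tm _ real_distribution_chi_squared AE_chi_squared_nonneg, rotated 2])
      fix m
      \<comment> \<open>This scaling cancels the factor 1 / 2 in \<open>cf_imp_laplace\<close>,
        giving the Laplace transform at \<open>m\<close>.\<close>
      let ?s = "sqrt (2 * real m)"
      have form: "(\<Sum>i<?k. z i *\<^sub>R (?s *\<^sub>R c i)) \<bullet> (G *v (\<Sum>i<?k. z i *\<^sub>R (?s *\<^sub>R c i))) = 2 * real m * (\<Sum>i<?k. (z i)\<^sup>2)" for z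
      proof -
        have "(\<Sum>i<?k. z i *\<^sub>R (?s *\<^sub>R c i)) \<bullet> (G *v (\<Sum>i<?k. z i *\<^sub>R (?s *\<^sub>R c i)))
          = (\<Sum>i<?k. \<Sum>j<?k. z i * ?s * (z j * ?s * (c i \<bullet> (G *v c j))))"
          by (simp add: linear_sum[OF matrix_vector_mul_linear] matrix_vector_mult_scaleR inner_sum_left inner_sum_right sum_distrib_left)
            (subst sum.swap, intro sum.cong refl, simp add: mult_ac)
        also have "\<dots> = (\<Sum>i<?k. \<Sum>j<?k. if i = j then 2 * real m * (z i)\<^sup>2 else 0)"
          by (intro sum.cong refl) (auto simp: cc power2_eq_square)
        also have "\<dots> = (\<Sum>i<?k. 2 * real m * (z i)\<^sup>2)" by (simp add: sum.delta)
        finally show ?thesis by (simp add: sum_distrib_left)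
      qed
      have "(\<Sum>i<?k. ((?s *\<^sub>R c i) \<bullet> Z n p)\<^sup>2) = 2 * real m * T n p" for n p
        by (simp add: T_def power_mult_distrib sum_distrib_left)
      then show "(\<lambda>n. LINT p|M. exp (- (real m * T n p))) \<longlonglongrightarrow> (LINT x|chi_squared ?k. exp (- (real m * x)))"
        using cf_imp_laplace[OF M Z cf, of "{..<?k}" "\<lambda>i. ?s *\<^sub>R c i"]
        unfolding chi_squared_laplace form by simp
    qed (simp add: T_def sum_nonneg)
  qed auto
qed

section \<open>The least-squares map and its Jacobian\<close>

definition residual :: "real ^ ('n::{finite, linorder}) \<Rightarrow> real ^ ('n ltri + 'n::{finite, linorder}) \<Rightarrow> real ^ ('n::{finite, linorder})" where
  "residual b x = Gamma_of x - Sigma_of x *v b"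

definition residual_mat :: "real ^ ('n::{finite, linorder}) \<Rightarrow> real ^ ('n ltri + 'n) ^ ('n::{finite, linorder})" where
  "residual_mat b = matrix (residual b)"

lemma linear_Sigma_of: "linear Sigma_of"
  by (rule linearI) (simp_all add: Sigma_of_def vec_eq_iff)

lemma linear_Gamma_of: "linear Gamma_of"
  by (rule linearI) (simp_all add: Gamma_of_def vec_eq_iff)

lemma linear_residual: "linear (residual b)"
  unfolding residual_def[abs_def]
  by (rule linearI)
    (simp_all add: linear_add[OF linear_Sigma_of] linear_add[OF linear_Gamma_of] linear_scale[OF linear_Sigma_of]
      linear_scale[OF linear_Gamma_of] matrix_vector_mult_add_rdistrib scaleR_matrix_vector_assoc[symmetric] scaleR_diff_right)

lemma residual_mat_mult: "residual_mat b *v x = residual b x"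
  unfolding residual_mat_def by (rule matrix_works) (simp add: linear_matrix_vector_mul_eq linear_residual)

lemma tendsto_Sigma_of: "(f \<longlongrightarrow> x) F \<Longrightarrow> ((\<lambda>y. Sigma_of (f y)) \<longlongrightarrow> Sigma_of x) F"
  by (rule bounded_linear.tendsto[OF linear_conv_bounded_linear[THEN iffD1, OF linear_Sigma_of]])

lemma tendsto_Gamma_of: "(f \<longlongrightarrow> x) F \<Longrightarrow> ((\<lambda>y. Gamma_of (f y)) \<longlongrightarrow> Gamma_of x) F"
  by (rule bounded_linear.tendsto[OF linear_conv_bounded_linear[THEN iffD1, OF linear_Gamma_of]])

lemma tendsto_residual_mat:
  assumes "(f \<longlongrightarrow> b) F"
  shows "((\<lambda>y. residual_mat (f y)) \<longlongrightarrow> residual_mat b) F"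
  unfolding residual_mat_def matrix_def residual_def
  by (intro tendsto_vec_lambda tendsto_vec_nth tendsto_diff tendsto_const tendsto_matrix_vector_mult assms)

lemma invertible_Sigma_of: "x \<in> dom_D \<Longrightarrow> invertible (Sigma_of x)"
  by (simp add: dom_D_def invertible_det_nz)

lemma g_map_diff:
  assumes "x \<in> dom_D"
  shows "g_map x - b = matrix_inv (Sigma_of x) *v residual b x"
  unfolding g_map_def residual_def
  by (simp add: matrix_vector_mult_diff_distrib matrix_vector_mul_assoc matrix_inv_inverse[OF invertible_Sigma_of[OF assms]])

lemma eventually_dom_D:
  assumes "x \<in> dom_D" and "(f \<longlongrightarrow> x) F"
  shows "\<forall>\<^sub>F y in F. f y \<in> dom_D"
  using order_tendstoD(1)[OF tendsto_det[OF tendsto_Sigma_of[OF assms(2)]], of 0] assms(1)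
  by (simp add: dom_D_def)

lemma tendsto_g_map:
  assumes "x \<in> dom_D" and "(f \<longlongrightarrow> x) F"
  shows "((\<lambda>y. g_map (f y)) \<longlongrightarrow> g_map x) F"
  unfolding g_map_def
  by (intro tendsto_matrix_vector_mult tendsto_matrix_inv(1) tendsto_Sigma_of tendsto_Gamma_of invertible_Sigma_of assms)

text \<open>
  The remainder of the first-order expansion is exactly
  \<open>(matrix_inv (Sigma_of (x + u)) - matrix_inv (Sigma_of x)) *v residual (g_map x) u\<close>.
\<close>
lemma g_map_has_derivative:
  assumes x: "x \<in> dom_D"
  shows "(g_map has_derivative (\<lambda>u. matrix_inv (Sigma_of x) *v residual (g_map x) u)) (at x)"
  unfolding has_derivative_at
proof
  let ?S = "\<lambda>y. matrix_inv (Sigma_of y)" and ?r = "residual (g_map x)"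
  have "linear (\<lambda>u. ?S x *v ?r u)"
    using linear_compose[OF linear_residual matrix_vector_mul_linear] by (simp add: comp_def)
  then show "bounded_linear (\<lambda>u. ?S x *v ?r u)" by (simp add: linear_conv_bounded_linear)
  obtain B where B: "\<And>u. norm (?r u) \<le> B * norm u"
    using linear_bounded[OF linear_residual] by blast
  have lim: "((\<lambda>u. x + u) \<longlongrightarrow> x) (at 0)" by (rule tendsto_eq_intros refl)+ simp
  have r0: "?r x = 0"
    using g_map_diff[OF x, of "g_map x"] invertible_Sigma_of[OF x]
    by (metis diff_self matrix_inv_inverse(1) matrix_vector_mul_assoc matrix_vector_mul_lid matrix_vector_mult_0_right)
  show "((\<lambda>u. norm (g_map (x + u) - g_map x - ?S x *v ?r u) / norm u) \<longlongrightarrow> 0) (at 0)"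
  proof (rule Lim_null_comparison)
    show "\<forall>\<^sub>F u in at 0. norm (norm (g_map (x + u) - g_map x - ?S x *v ?r u) / norm u) \<le> norm (?S (x + u) - ?S x) * \<bar>B\<bar>"
      using eventually_dom_D[OF x lim] eventually_neq_at_within[of 0 0]
    proof eventually_elim
      case (elim u)
      have "g_map (x + u) - g_map x - ?S x *v ?r u = (?S (x + u) - ?S x) *v ?r u"
        using g_map_diff[OF elim(1), of "g_map x"]
        by (simp add: linear_add[OF linear_residual] r0 matrix_vector_mult_diff_rdistrib)
      then have "norm (g_map (x + u) - g_map x - ?S x *v ?r u) \<le> norm (?S (x + u) - ?S x) * norm (?r u)"
        by (simp add: norm_matrix_vector_mult_le)
      also have "\<dots> \<le> norm (?S (x + u) - ?S x) * (\<bar>B\<bar> * norm u)"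
      proof (rule mult_left_mono)
        have "B * norm u \<le> \<bar>B\<bar> * norm u" by (intro mult_right_mono) auto
        with B[of u] show "norm (?r u) \<le> \<bar>B\<bar> * norm u" by linarith
      qed simp
      finally show ?case using elim(2) by (simp add: divide_le_eq mult.assoc)
    qed
    have "((\<lambda>u. norm (?S (x + u) - ?S x) * \<bar>B\<bar>) \<longlongrightarrow> norm (?S x - ?S x) * \<bar>B\<bar>) (at 0)"
      by (intro tendsto_intros tendsto_matrix_inv(1) tendsto_Sigma_of lim invertible_Sigma_of x)
    then show "((\<lambda>u. norm (?S (x + u) - ?S x) * \<bar>B\<bar>) \<longlongrightarrow> 0) (at 0)" by simp
  qed
qed

lemma jacobian_g_map:
  assumes x: "x \<in> dom_D"
  shows "jacobian g_map (at x) = matrix_inv (Sigma_of x) ** residual_mat (g_map x)"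
proof -
  have "frechet_derivative g_map (at x) = (\<lambda>u. matrix_inv (Sigma_of x) *v residual (g_map x) u)"
    using frechet_derivative_at[OF g_map_has_derivative[OF x]] by simp
  then have "jacobian g_map (at x) = matrix (\<lambda>u. (matrix_inv (Sigma_of x) ** residual_mat (g_map x)) *v u)"
    unfolding jacobian_def by (simp add: residual_mat_mult matrix_vector_mul_assoc[symmetric])
  then show ?thesis by (simp add: matrix_of_matrix_vector_mul)
qed

lemma tendsto_jacobian_g_map:
  assumes x: "x \<in> dom_D" and f: "(f \<longlongrightarrow> x) F"
  shows "((\<lambda>y. jacobian g_map (at (f y))) \<longlongrightarrow> jacobian g_map (at x)) F"
proof (rule Lim_transform_eventually)
  show "((\<lambda>y. matrix_inv (Sigma_of (f y)) ** residual_mat (g_map (f y))) \<longlongrightarrow> jacobian g_map (at x)) F"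
    unfolding jacobian_g_map[OF x]
    by (intro tendsto_matrix_matrix_mult tendsto_matrix_inv(1) tendsto_Sigma_of tendsto_residual_mat tendsto_g_map invertible_Sigma_of assms)
  show "\<forall>\<^sub>F y in F. matrix_inv (Sigma_of (f y)) ** residual_mat (g_map (f y)) = jacobian g_map (at (f y))"
    using eventually_dom_D[OF x f] by eventually_elim (simp add: jacobian_g_map)
qed

text \<open>The continuous mapping principle in terms of events: a property that holds near the
  limit point holds with high probability along the sequence.\<close>

lemma whp_nhds:
  assumes conv: "\<And>e. e > 0 \<Longrightarrow> whp M (\<lambda>n x. dist (Z n x) c < e)" and ev: "\<forall>\<^sub>F z in nhds c. \<Phi> z"
  shows "whp M (\<lambda>n x. \<Phi> (Z n x))"
proof -
  obtain d where d: "d > 0" "\<And>z. dist z c < d \<Longrightarrow> \<Phi> z"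
    using ev unfolding eventually_nhds_metric by blast
  show ?thesis by (rule whp_mono[OF conv[OF d(1)]]) (use d(2) in simp)
qed

lemma (in prob_space) whp_nhds_Pair:
  assumes "\<And>e. e > 0 \<Longrightarrow> whp M (\<lambda>n t. dist (X n t) a < e)" and "\<And>e. e > 0 \<Longrightarrow> whp M (\<lambda>n t. dist (Y n t) b < e)"
    and ev: "\<forall>\<^sub>F z in nhds (a, b). \<Phi> z"
  shows "whp M (\<lambda>n t. \<Phi> (X n t, Y n t))"
proof (rule whp_nhds[OF _ ev])
  fix e :: real assume "e > 0"
  then have e: "e / 2 > 0" by simp
  have "dist (x, y) (a, b) < e" if "dist x a < e / 2" "dist y b < e / 2" for x y
  proof -
    have "dist (x, y) (a, b) \<le> dist x a + dist y b"
      unfolding dist_Pair_Pair by (rule sqrt_sum_squares_le_sum) auto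
    then show ?thesis using that by simp
  qed
  then show "whp M (\<lambda>n t. dist (X n t, Y n t) (a, b) < e)"
    by (intro whp_mono[OF whp_conj[OF assms(1)[OF e] assms(2)[OF e]]]) simp
qed

text \<open>Consistency from the rate: a scaled error bounded by b has unscaled size at most b /
  sqrt (r n), which falls below \<open>e\<close> once \<open>r n\<close> exceeds
  \<open>(\<bar>b\<bar> / e)\<^sup>2\<close>.\<close>

lemma whp_scaled_tight:
  fixes X :: "nat \<Rightarrow> 'w \<Rightarrow> 'b::real_normed_vector"
  assumes t: "tight_seq M (\<lambda>n x. sqrt (r n) *\<^sub>R (X n x - c))" and r: "filterlim r at_top sequentially" and e: "e > 0"
  shows "whp M (\<lambda>n x. dist (X n x) c < e)"
  unfolding whp_def
proof (intro allI impI)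
  fix d :: real assume "d > 0"
  then obtain b where b: "\<forall>\<^sub>F n in sequentially. likely M d (\<lambda>x. norm (sqrt (r n) *\<^sub>R (X n x - c)) \<le> b)"
    using t unfolding tight_seq_def by blast
  have "\<forall>\<^sub>F n in sequentially. r n > (\<bar>b\<bar> / e)\<^sup>2"
    using r by (simp add: filterlim_at_top_dense)
  with b show "\<forall>\<^sub>F n in sequentially. likely M d (\<lambda>x. dist (X n x) c < e)"
  proof eventually_elim
    case (elim n)
    have "\<bar>b\<bar> / e < sqrt (r n)" using elim(2) by (rule real_less_rsqrt)
    moreover have "0 \<le> \<bar>b\<bar> / e" using e by simp
    ultimately have pos: "sqrt (r n) > 0" and "\<bar>b\<bar> < sqrt (r n) * e"
      using e by (linarith, simp add: divide_less_eq)
    then have lt: "b < sqrt (r n) * e" by linarith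
    have "dist y c < e" if "norm (sqrt (r n) *\<^sub>R (y - c)) \<le> b" for y
    proof -
      have "norm (sqrt (r n) *\<^sub>R (y - c)) = sqrt (r n) * dist y c" using pos by (simp add: dist_norm)
      with that lt have "sqrt (r n) * dist y c < sqrt (r n) * e" by linarith
      then show ?thesis using mult_less_cancel_left_pos[OF pos] by blast
    qed
    then show ?case using elim(1) by blast
  qed
qed

section \<open>Positive definiteness under congruence and the Wald statistic\<close>

lemma quadratic_form_congruence:
  fixes H :: "real ^ 'q ^ 'k" and A :: "real ^ 'q ^ 'q"
  shows "v \<bullet> ((H ** A ** transpose H) *v v) = (transpose H *v v) \<bullet> (A *v (transpose H *v v))"
proof -
  have "v \<bullet> (H *v y) = (transpose H *v v) \<bullet> y" for y
    by (metis dot_lmul_matrix transpose_matrix_vector)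
  then show ?thesis by (simp only: matrix_vector_mul_assoc[symmetric])
qed

text \<open>Full row rank makes \<open>transpose R\<close> injective, so a nonzero vector stays
  nonzero before it meets the form of \<open>A\<close>.\<close>

lemma positive_definite_congruence:
  fixes R :: "real ^ 'n ^ 'k" and A :: "real ^ 'n ^ 'n"
  assumes R: "rank R = CARD('k)" and pos: "\<And>v. v \<noteq> 0 \<Longrightarrow> v \<bullet> (A *v v) > 0" and v: "v \<noteq> 0"
  shows "v \<bullet> ((R ** A ** transpose R) *v v) > 0"
proof -
  have "inj ((*v) (transpose R))"
    using R by (simp add: full_rank_injective[symmetric] rank_transpose)
  then have "transpose R *v v \<noteq> 0"
    using v by (metis injD matrix_vector_mult_0_right)
  then show ?thesis unfolding quadratic_form_congruence by (rule pos)
qed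

lemma positive_definite_invertible:
  fixes A :: "real ^ 'n ^ 'n"
  assumes "\<And>v. v \<noteq> 0 \<Longrightarrow> v \<bullet> (A *v v) > 0"
  shows "invertible A"
proof -
  have "\<forall>v. A *v v = 0 \<longrightarrow> v = 0" using assms by (metis inner_zero_right less_irrefl)
  then show ?thesis
    using matrix_left_invertible_ker[of A] invertible_left_inverse[of A] by blast
qed

text \<open>On the event \<open>good\<close> the statistic is exactly a quadratic form in
  \<open>Z\<close> with matrix \<open>Q\<close> at the pair of estimators. \<open>Q\<close> is
  continuous at the limit pair, so freezing it there costs a tight factor times a vanishing one.
  \<open>W_eq\<close> prescribes \<open>W\<close> only where the formula makes sense.\<close>

lemma wald_statistic_weak_conv:
  fixes M :: "'w measure" and \<mu> :: "real ^ ('n ltri + 'n::{finite, linorder})"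
    and X :: "nat \<Rightarrow> 'w \<Rightarrow> real ^ ('n ltri + 'n)" and G :: "real ^ ('n ltri + 'n) ^ ('n ltri + 'n)"
    and R :: "real ^ ('n::{finite, linorder}) ^ 'k" and r :: "nat \<Rightarrow> real"
  defines "A x G' \<equiv> R ** (jacobian g_map (at x) ** G' ** transpose (jacobian g_map (at x))) ** transpose R"
  assumes M: "prob_space M" and X[measurable]: "\<And>n. X n \<in> borel_measurable M"
    and r: "filterlim r at_top sequentially"
    and cf: "\<And>w. (\<lambda>n. LINT y|M. iexp (w \<bullet> (sqrt (r n) *\<^sub>R (X n y - \<mu>)))) \<longlonglongrightarrow> complex_of_real (exp (- (w \<bullet> (G *v w)) / 2))"
    and G: "transpose G = G" and \<mu>: "\<mu> \<in> dom_D"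
    and pos: "\<And>v. v \<noteq> 0 \<Longrightarrow> v \<bullet> ((jacobian g_map (at \<mu>) ** G ** transpose (jacobian g_map (at \<mu>))) *v v) > 0"
    and Ghat: "\<And>e. e > 0 \<Longrightarrow> whp M (\<lambda>n y. dist (Ghat n y) G < e)"
    and R: "rank R = CARD('k)"
    and W: "\<And>n. W n \<in> borel_measurable M"
    and W_eq: "\<And>n y. y \<in> space M \<Longrightarrow> X n y \<in> dom_D \<Longrightarrow> invertible (A (X n y) (Ghat n y)) \<Longrightarrow>
      W n y = r n * ((R *v (g_map (X n y) - g_map \<mu>)) \<bullet> (matrix_inv (A (X n y) (Ghat n y)) *v (R *v (g_map (X n y) - g_map \<mu>))))"
  shows "weak_conv_m (\<lambda>n. distr M borel (W n)) (chi_squared CARD('k))"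
proof -
  interpret prob_space M by (rule M)
  let ?J = "jacobian g_map (at \<mu>)" and ?b = "g_map \<mu>"
  define Z where "Z n y = sqrt (r n) *\<^sub>R (X n y - \<mu>)" for n y
  define H where "H = R ** ?J"
  \<comment> \<open>The residual is taken at the true coefficient \<open>?b\<close>, as the exact
    error identity demands, whereas the Jacobian in \<open>A\<close> involves
    \<open>g_map x\<close>. The two matrices agree at \<open>\<mu>\<close>, see
    \<open>H_eq\<close>.\<close>
  define Hx where "Hx x = R ** (matrix_inv (Sigma_of x) ** residual_mat ?b)" for x
  define Q where "Q p = transpose (Hx (fst p)) ** matrix_inv (A (fst p) (snd p)) ** Hx (fst p)" for p
  have Zm[measurable]: "Z n \<in> borel_measurable M" for n unfolding Z_def by measurable
  have tight: "tight_seq M Z" by (rule cf_imp_tight[OF M Zm]) (use cf in \<open>simp add: Z_def\<close>)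
  have X_conv: "whp M (\<lambda>n y. dist (X n y) \<mu> < e)" if "e > 0" for e
    by (rule whp_scaled_tight[OF _ r that]) (use tight in \<open>simp add: Z_def[abs_def]\<close>)
  have H_eq: "Hx \<mu> = H" unfolding Hx_def H_def jacobian_g_map[OF \<mu>] ..
  have A_eq: "A \<mu> G = H ** G ** transpose H"
    unfolding A_def H_def by (simp add: matrix_transpose_mul matrix_mul_assoc)
  have posA: "v \<bullet> (A \<mu> G *v v) > 0" if "v \<noteq> 0" for v
    unfolding A_def by (rule positive_definite_congruence[OF R pos that])
  have invA: "invertible (A \<mu> G)" by (rule positive_definite_invertible[OF posA])
  have symA: "transpose (A \<mu> G) = A \<mu> G"
    unfolding A_eq by (simp add: matrix_transpose_mul G matrix_mul_assoc)
  have f: "((\<lambda>p. fst p) \<longlongrightarrow> \<mu>) (nhds (\<mu>, G))" and s: "((\<lambda>p. snd p) \<longlongrightarrow> G) (nhds (\<mu>, G))"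
    using tendsto_fst[OF filterlim_ident, of "(\<mu>, G)"] tendsto_snd[OF filterlim_ident, of "(\<mu>, G)"] by simp_all
  have A_lim: "((\<lambda>p. A (fst p) (snd p)) \<longlongrightarrow> A \<mu> G) (nhds (\<mu>, G))"
    unfolding A_def by (intro tendsto_matrix_matrix_mult tendsto_transpose tendsto_const tendsto_jacobian_g_map \<mu> f s)
  have H_lim: "((\<lambda>p. Hx (fst p)) \<longlongrightarrow> H) (nhds (\<mu>, G))"
    unfolding H_eq[symmetric] Hx_def
    by (intro tendsto_matrix_matrix_mult tendsto_const tendsto_matrix_inv(1) tendsto_Sigma_of f invertible_Sigma_of \<mu>)
  have Q_lim: "(Q \<longlongrightarrow> Q (\<mu>, G)) (nhds (\<mu>, G))"
    using H_lim A_lim invA unfolding Q_def fst_conv snd_conv H_eq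
    by (intro tendsto_matrix_matrix_mult tendsto_transpose tendsto_matrix_inv(1))
  have good: "whp M (\<lambda>n y. X n y \<in> dom_D \<and> invertible (A (X n y) (Ghat n y)))"
    using whp_nhds_Pair[OF X_conv Ghat eventually_conj[OF eventually_dom_D[OF \<mu> f] tendsto_matrix_inv(2)[OF A_lim invA]]]
    by simp
  have Q_conv: "whp M (\<lambda>n y. norm (Q (X n y, Ghat n y) - Q (\<mu>, G)) < e)" if "e > 0" for e
    using whp_nhds_Pair[OF X_conv Ghat tendstoD[OF Q_lim that]] by (simp add: dist_norm)
  have r_nonneg: "\<forall>\<^sub>F n in sequentially. r n \<ge> 0"
    using r unfolding filterlim_at_top by blast
  let ?err = "\<lambda>n y. \<bar>W n y - (H *v Z n y) \<bullet> (matrix_inv (H ** G ** transpose H) *v (H *v Z n y))\<bar>"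
    and ?qd = "\<lambda>n y. norm (Q (X n y, Ghat n y) - Q (\<mu>, G))"
  show ?thesis
  proof (rule quadratic_form_weak_conv_chi_squared[OF M Zm _ G _ W])
    show "(\<lambda>n. LINT y|M. iexp (w \<bullet> Z n y)) \<longlonglongrightarrow> complex_of_real (exp (- (w \<bullet> (G *v w)) / 2))" for w
      using cf[of w] by (simp add: Z_def)
    show "v \<bullet> ((H ** G ** transpose H) *v v) > 0" if "v \<noteq> 0" for v
      using posA[OF that] by (simp only: A_eq)
    fix e :: real assume e: "e > 0"
    have "whp M (\<lambda>n y. (norm (Z n y))\<^sup>2 * ?qd n y < e)"
      by (rule whp_tight_mult[OF tight Q_conv e])
    from whp_conj[OF this good]
    show "whp M (\<lambda>n y. ?err n y < e)"
    proof (rule whp_mono)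
      have QH: "z \<bullet> ((transpose B ** C ** B) *v z) = (B *v z) \<bullet> (C *v (B *v z))" for z and B :: "real ^ ('n ltri + 'n) ^ 'k" and C
        using quadratic_form_congruence[of z "transpose B" C] by (simp add: transpose_transpose)
      show "\<forall>\<^sub>F n in sequentially. \<forall>y\<in>space M.
        (norm (Z n y))\<^sup>2 * ?qd n y < e \<and> X n y \<in> dom_D \<and> invertible (A (X n y) (Ghat n y)) \<longrightarrow>
        ?err n y < e"
        using r_nonneg
      proof (eventually_elim, intro ballI impI)
        fix n y
        assume rn: "r n \<ge> 0" and y: "y \<in> space M"
          and *: "(norm (Z n y))\<^sup>2 * ?qd n y < e \<and> X n y \<in> dom_D \<and> invertible (A (X n y) (Ghat n y))"
        let ?x = "X n y" and ?A = "A (X n y) (Ghat n y)" and ?z = "Z n y"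
        \<comment> \<open>The normal equations at \<open>\<mu>\<close>; they turn the residual of
          the estimator into the residual of its deviation from \<open>\<mu>\<close>.\<close>
        have res: "residual ?b \<mu> = 0"
          using g_map_diff[OF \<mu>, of ?b] invertible_Sigma_of[OF \<mu>]
          by (metis diff_self matrix_inv_inverse(1) matrix_vector_mul_assoc matrix_vector_mul_lid matrix_vector_mult_0_right)
        have "sqrt (r n) *\<^sub>R (R *v (g_map ?x - ?b)) = R *v (matrix_inv (Sigma_of ?x) *v (sqrt (r n) *\<^sub>R residual ?b ?x))"
          using g_map_diff[of ?x ?b] * by (simp add: matrix_vector_mult_scaleR)
        also have "sqrt (r n) *\<^sub>R residual ?b ?x = residual ?b ?z"
          unfolding Z_def by (simp add: linear_scale[OF linear_residual] linear_diff[OF linear_residual] res)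
        also have "R *v (matrix_inv (Sigma_of ?x) *v residual ?b ?z) = Hx ?x *v ?z"
          unfolding Hx_def by (simp only: residual_mat_mult[symmetric] matrix_vector_mul_assoc matrix_mul_assoc)
        finally have d: "sqrt (r n) *\<^sub>R (R *v (g_map ?x - ?b)) = Hx ?x *v ?z" .
        let ?d = "R *v (g_map ?x - ?b)"
        have "W n y = r n * (?d \<bullet> (matrix_inv ?A *v ?d))" using W_eq y * by blast
        also have "\<dots> = (sqrt (r n) * sqrt (r n)) * (?d \<bullet> (matrix_inv ?A *v ?d))" using rn by simp
        also have "\<dots> = (sqrt (r n) *\<^sub>R ?d) \<bullet> (matrix_inv ?A *v (sqrt (r n) *\<^sub>R ?d))"
          by (simp only: matrix_vector_mult_scaleR inner_scaleR_left inner_scaleR_right mult.assoc)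
        also have "\<dots> = ?z \<bullet> (Q (?x, Ghat n y) *v ?z)"
          unfolding d Q_def fst_conv snd_conv QH ..
        finally have W': "W n y = ?z \<bullet> (Q (?x, Ghat n y) *v ?z)" .
        have T: "(H *v ?z) \<bullet> (matrix_inv (H ** G ** transpose H) *v (H *v ?z)) = ?z \<bullet> (Q (\<mu>, G) *v ?z)"
          unfolding Q_def fst_conv snd_conv QH H_eq A_eq ..
        have "\<bar>W n y - ?z \<bullet> (Q (\<mu>, G) *v ?z)\<bar> = \<bar>?z \<bullet> ((Q (?x, Ghat n y) - Q (\<mu>, G)) *v ?z)\<bar>"
          unfolding W' by (simp add: inner_diff_right matrix_vector_mult_diff_rdistrib)
        also have "\<dots> \<le> norm ?z * norm ((Q (?x, Ghat n y) - Q (\<mu>, G)) *v ?z)" by (rule Cauchy_Schwarz_ineq2)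
        also have "\<dots> \<le> norm ?z * (norm (Q (?x, Ghat n y) - Q (\<mu>, G)) * norm ?z)"
          by (intro mult_left_mono norm_matrix_vector_mult_le) simp
        also have "\<dots> = (norm ?z)\<^sup>2 * norm (Q (?x, Ghat n y) - Q (\<mu>, G))" by (simp add: power2_eq_square)
        also have "\<dots> < e" using * by blast
        finally show "?err n y < e"
          unfolding T .
      qed
    qed
  qed
qed

section \<open>Moments in the regression model\<close>

lemma measurable_vec_nth:
  fixes f :: "'w \<Rightarrow> ('a::topological_space) ^ 'n"
  assumes "f \<in> borel_measurable M"
  shows "(\<lambda>x. f x $ i) \<in> borel_measurable M"
  by (rule measurable_compose[OF assms borel_measurable_continuous_onI[OF continuous_on_component[OF continuous_on_id]]])

lemma continuous_on_outer:
  assumes "continuous_on S f" "continuous_on S g"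
  shows "continuous_on S (\<lambda>x. outer (f x) (g x))"
  unfolding outer_def using assms by (intro continuous_on_vec_lambda continuous_intros)

lemma continuous_on_design: "continuous_on S (design :: real ^ 'p \<Rightarrow> _)"
proof -
  have "continuous_on S (\<lambda>x :: real ^ 'p. (case j of None \<Rightarrow> 1 | Some l \<Rightarrow> x $ l) :: real)" for j
    by (cases j) (auto intro!: continuous_intros)
  then show ?thesis unfolding design_def[abs_def] by (intro continuous_on_vec_lambda)
qed

lemma continuous_on_moment_vec:
  assumes "continuous_on S f" "continuous_on S g"
  shows "continuous_on S (\<lambda>x. moment_vec (f x) (g x))"
proof -
  have d: "continuous_on S (\<lambda>x. design (f x))"
    using continuous_on_compose2[OF continuous_on_design assms(1)] by blast
  have "continuous_on S (\<lambda>x. case k of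
      Inl t \<Rightarrow> vech (outer (design (f x)) (design (f x))) $ t | Inr b \<Rightarrow> (g x *\<^sub>R design (f x)) $ b)" for k
    unfolding vech_def outer_def using d assms(2) by (cases k) (auto intro!: continuous_intros)
  then show ?thesis unfolding moment_vec_def stack_def by (intro continuous_on_vec_lambda)
qed

lemma outer_mult: "outer u v *v x = (v \<bullet> x) *\<^sub>R u"
  by (simp add: outer_def vec_eq_iff matrix_vector_mult_def inner_vec_def sum_distrib_left mult_ac)

lemma Sigma_of_moment_vec: "Sigma_of (moment_vec x y) = outer (design x) (design x)"
  unfolding moment_vec_def
  by (rule Sigma_of_stack(1)) (simp add: outer_def transpose_def vec_eq_iff mult.commute)

lemma Gamma_of_moment_vec: "Gamma_of (moment_vec x y) = y *\<^sub>R design x"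
  unfolding moment_vec_def
  by (rule Sigma_of_stack(2)) (simp add: outer_def transpose_def vec_eq_iff mult.commute)

text \<open>The regression terms cancel exactly. Both the mean of the estimation error and its limit
  variance are thereby expressed through the noise and the design vector.\<close>

lemma residual_moment_vec: "residual b (moment_vec x (b \<bullet> design x + e)) = e *\<^sub>R design x"
  unfolding residual_def Sigma_of_moment_vec Gamma_of_moment_vec outer_mult
  by (simp add: scaleR_add_left inner_commute)

lemma inner_design:
  fixes b :: "real ^ ('p::finite) option"
  shows "b \<bullet> design x = b $ None + (\<Sum>l\<in>UNIV. b $ Some l * x $ l)"
  unfolding inner_vec_def UNIV_option_conv by (simp add: sum.reindex design_def)

lemma integral_linear:
  fixes T :: "'a::euclidean_space \<Rightarrow> 'b::euclidean_space"
  assumes "linear T" and "integrable M f"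
  shows "(LINT x|M. T (f x)) = T (LINT x|M. f x)" and "integrable M (\<lambda>x. T (f x))"
  using integral_bounded_linear[of T M f] integrable_bounded_linear[of T M f] assms
  by (simp_all add: linear_conv_bounded_linear)

text \<open>The norm of \<open>outer v v\<close> is \<open>(norm v)\<^sup>2\<close>, so a second
  moment makes the matrix integrable; evaluating the form at \<open>x\<close> is linear in the
  matrix and commutes with the integral.\<close>

lemma quadratic_form_second_moment:
  fixes f :: "'w \<Rightarrow> real ^ 'q"
  assumes [measurable]: "f \<in> borel_measurable M" and f2: "integrable M (\<lambda>y. (norm (f y))\<^sup>2)"
  shows "integrable M (\<lambda>y. outer (f y) (f y))"
    and "x \<bullet> ((LINT y|M. outer (f y) (f y)) *v x) = (LINT y|M. (x \<bullet> f y)\<^sup>2)"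
    and "integrable M (\<lambda>y. (x \<bullet> f y)\<^sup>2)"
proof -
  have "(\<lambda>v::real^'q. outer v v) \<in> borel_measurable borel"
    by (intro borel_measurable_continuous_onI continuous_on_outer continuous_on_id)
  then have [measurable]: "(\<lambda>y. outer (f y) (f y)) \<in> borel_measurable M"
    by (rule measurable_compose[rotated]) measurable
  have n: "norm (outer v v) = (norm v)\<^sup>2" for v :: "real ^ 'q"
  proof -
    have "outer v v $ i = (v $ i) *\<^sub>R v" for i by (simp add: outer_def vec_eq_iff)
    then have "norm (outer v v) = L2_set (\<lambda>i. norm (v $ i) * norm v) UNIV"
      by (simp add: norm_vec_def[of "outer v v"])
    also have "\<dots> = norm v * norm v" by (simp add: norm_vec_def[of v] L2_set_left_distrib)
    finally show ?thesis by (simp add: power2_eq_square)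
  qed
  show i: "integrable M (\<lambda>y. outer (f y) (f y))"
    by (subst integrable_norm_iff[symmetric]) (use f2 in \<open>auto simp: n\<close>)
  have "linear (\<lambda>B :: real ^ 'q ^ 'q. x \<bullet> (B *v x))"
    by (rule linearI) (simp_all add: matrix_vector_mult_add_rdistrib inner_add_right scaleR_matrix_vector_assoc[symmetric])
  from integral_linear[OF this i]
  show "x \<bullet> ((LINT y|M. outer (f y) (f y)) *v x) = (LINT y|M. (x \<bullet> f y)\<^sup>2)"
    and "integrable M (\<lambda>y. (x \<bullet> f y)\<^sup>2)"
    by (simp_all add: outer_mult power2_eq_square inner_commute)
qed

section \<open>Conditioning on the regressors\<close>

lemma (in prob_space) prob_space_sigma_finite_subalgebra:
  assumes "Z \<in> borel_measurable M"
  shows "sigma_finite_subalgebra M (sigma_gen M Z)"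
proof -
  have "subalgebra M (sigma_gen M Z)"
    unfolding subalgebra_def sigma_gen_def using assms
    by (auto simp: sets_vimage_algebra2 measurable_space intro: measurable_sets)
  then interpret finite_measure_subalgebra M "sigma_gen M Z"
    by unfold_locales
  show ?thesis by unfold_locales
qed

lemma measurable_sigma_gen:
  assumes "g \<in> borel_measurable borel"
  shows "(\<lambda>x. g (Z x)) \<in> borel_measurable (sigma_gen M Z)"
  unfolding sigma_gen_def
  by (rule measurable_compose[OF measurable_vimage_algebra1 assms]) auto

lemma (in prob_space) cond_exp_zero_integral:
  fixes g :: "'b::topological_space \<Rightarrow> real"
  assumes Z: "Z \<in> borel_measurable M" and g: "g \<in> borel_measurable borel" and e: "e \<in> borel_measurable M"
    and c: "AE x in M. real_cond_exp M (sigma_gen M Z) e x = 0" and i: "integrable M (\<lambda>x. g (Z x) * e x)"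
  shows "(LINT x|M. g (Z x) * e x) = 0"
proof -
  interpret sigma_finite_subalgebra M "sigma_gen M Z" by (rule prob_space_sigma_finite_subalgebra[OF Z])
  have "(LINT x|M. g (Z x) * e x) = (LINT x|M. g (Z x) * real_cond_exp M (sigma_gen M Z) e x)"
    by (rule real_cond_exp_intg(2)[OF i measurable_sigma_gen[OF g] e, symmetric])
  also have "\<dots> = (LINT x|M. 0)"
    by (rule integral_cong_AE) (use c real_cond_exp_intg(1)[OF i measurable_sigma_gen[OF g] e] in auto)
  finally show ?thesis by simp
qed

text \<open>Conditioning replaces the squared noise by its conditional mean. A nonnegative product
  with zero integral vanishes almost everywhere, and the conditional factor is positive, so the
  other factor is zero.\<close>

lemma (in prob_space) weighted_cond_second_moment_zero:
  fixes g :: "'b::topological_space \<Rightarrow> real"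
  assumes Z: "Z \<in> borel_measurable M" and g[measurable]: "g \<in> borel_measurable borel" and e[measurable]: "e \<in> borel_measurable M"
    and c: "AE x in M. nn_cond_exp M (sigma_gen M Z) (\<lambda>x. ennreal ((e x)\<^sup>2)) x > 0"
    and i: "integrable M (\<lambda>x. (g (Z x) * e x)\<^sup>2)" and zero: "(LINT x|M. (g (Z x) * e x)\<^sup>2) = 0"
  shows "AE x in M. g (Z x) = 0"
proof -
  interpret sigma_finite_subalgebra M "sigma_gen M Z" by (rule prob_space_sigma_finite_subalgebra[OF Z])
  note [measurable] = Z
  let ?c = "nn_cond_exp M (sigma_gen M Z) (\<lambda>x. ennreal ((e x)\<^sup>2))"
  have "(\<integral>\<^sup>+ x. ennreal ((g (Z x))\<^sup>2) * ?c x \<partial>M) = (\<integral>\<^sup>+ x. ennreal ((g (Z x))\<^sup>2) * ennreal ((e x)\<^sup>2) \<partial>M)"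
    by (rule nn_cond_exp_intg) (use measurable_sigma_gen[of "\<lambda>z. ennreal ((g z)\<^sup>2)"] in auto)
  also have "\<dots> = (\<integral>\<^sup>+ x. ennreal ((g (Z x) * e x)\<^sup>2) \<partial>M)"
    by (simp add: ennreal_mult'[symmetric] power_mult_distrib)
  also have "\<dots> = 0" using nn_integral_eq_integral[OF i] zero by simp
  finally have "(\<integral>\<^sup>+ x. ennreal ((g (Z x))\<^sup>2) * ?c x \<partial>M) = 0" .
  moreover have "(\<lambda>x. ennreal ((g (Z x))\<^sup>2) * ?c x) \<in> borel_measurable M"
    using borel_measurable_nn_cond_exp2 by measurable
  ultimately have "AE x in M. ennreal ((g (Z x))\<^sup>2) * ?c x = 0"
    by (simp add: nn_integral_0_iff_AE)
  with c show ?thesis by eventually_elim (auto simp: ennreal_eq_0_iff)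
qed

text \<open>The strict upper tail is the rejection event of the test, the strict lower one the
  coverage event of an open interval. The limit law has no atoms, so \<open>x\<close> is a
  continuity point and the half-line below it a continuity set.\<close>

lemma weak_conv_chi_squared_tail:
  assumes M: "prob_space M" and W[measurable]: "\<And>n. W n \<in> borel_measurable M"
    and wc: "weak_conv_m (\<lambda>n. distr M borel (W n)) (chi_squared k)" and k: "k > 0"
  shows "(\<lambda>n. measure M {y \<in> space M. W n y > x}) \<longlonglongrightarrow> 1 - cdf (chi_squared k) x"
    and "(\<lambda>n. measure M {y \<in> space M. W n y < x}) \<longlonglongrightarrow> cdf (chi_squared k) x"
proof -
  interpret prob_space M by (rule M)
  have rd: "real_distribution (distr M borel (W n))" for n by (rule real_distribution_distr) measurable
  interpret C: real_distribution "chi_squared k" by (rule real_distribution_chi_squared)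
  have null: "measure (chi_squared k) {x} = 0" by (rule null_singleton_chi_squared[OF k])
  have "(\<lambda>n. cdf (distr M borel (W n)) x) \<longlonglongrightarrow> cdf (chi_squared k) x"
    using wc isCont_cdf_chi_squared[OF k] unfolding weak_conv_m_def weak_conv_def by blast
  moreover have "prob {y \<in> space M. W n y > x} = 1 - cdf (distr M borel (W n)) x" for n
  proof -
    have "{y \<in> space M. W n y > x} = space M - (W n -` {..x} \<inter> space M)" by auto
    then show ?thesis by (simp add: prob_compl cdf_def measure_distr)
  qed
  ultimately show "(\<lambda>n. prob {y \<in> space M. W n y > x}) \<longlonglongrightarrow> 1 - cdf (chi_squared k) x"
    by (simp add: tendsto_intros)
  have fr: "frontier {..<x} = {x}" unfolding frontier_def by (auto simp: interior_open)
  have "(\<lambda>n. measure (distr M borel (W n)) {..<x}) \<longlonglongrightarrow> measure (chi_squared k) {..<x}"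
    by (rule weak_conv_imp_continuity_set_conv[OF rd real_distribution_chi_squared wc])
      (use null fr in \<open>simp_all add: C.emeasure_eq_measure\<close>)
  moreover have "measure (distr M borel (W n)) {..<x} = prob {y \<in> space M. W n y < x}" for n
    by (simp add: measure_distr vimage_def Int_def conj_commute)
  moreover have "cdf (chi_squared k) x = measure (chi_squared k) {..<x}"
  proof -
    have "{..x} = {..<x} \<union> {x}" by auto
    then show ?thesis unfolding cdf_def using C.finite_measure_Union[of "{..<x}" "{x}"] null by simp
  qed
  ultimately show "(\<lambda>n. prob {y \<in> space M. W n y < x}) \<longlonglongrightarrow> cdf (chi_squared k) x" by simp
qed

section \<open>Coverage of the interval and level of the Wald test\<close>

theorem corollary3p1:
  fixes M :: "'w measure"
    and X :: "nat \<Rightarrow> 'w \<Rightarrow> real ^ 'p::{finite, linorder}"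
    and eps Y V :: "nat \<Rightarrow> 'w \<Rightarrow> real"
    and beta :: "real ^ 'p option"
    and U :: "nat \<Rightarrow> 'w \<Rightarrow> real ^ ('p option ltri + 'p option)"
    and \<Sigma> :: "real ^ 'p option ^ 'p option"
    and \<Gamma> :: "real ^ 'p option"
    and \<mu> :: "real ^ ('p option ltri + 'p option)"
    and f K :: "real \<Rightarrow> real"
    and h :: "nat \<Rightarrow> real"
    and mu_hat :: "nat \<Rightarrow> 'w \<Rightarrow> real ^ ('p option ltri + 'p option)"
    and beta_hat :: "nat \<Rightarrow> 'w \<Rightarrow> real ^ 'p option"
    and Sigma_beta_hat :: "nat \<Rightarrow> 'w \<Rightarrow> real ^ 'p option ^ 'p option"
    and \<alpha> :: real
  assumes prob: "prob_space M"
    \<comment> \<open>regression model\<close>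
    and X_meas: "\<And>i. X i \<in> borel_measurable M"
    and eps_meas: "\<And>i. eps i \<in> borel_measurable M"
    and stationary: "stationary_seq M (\<lambda>i \<omega>. (X i \<omega>, eps i \<omega>))"
    and ergodic: "ergodic_seq M (\<lambda>i \<omega>. (X i \<omega>, eps i \<omega>))"
    and eps_int: "integrable M (eps 0)"
    and eps_cond: "AE \<omega> in M. real_cond_exp M (sigma_gen M (X 0)) (eps 0) \<omega> = 0"
    and X_mom2: "integrable M (\<lambda>\<omega>. (norm (X 0 \<omega>))\<^sup>2)"
    and Y_eq: "\<And>i \<omega>. Y i \<omega> = beta $ None + (\<Sum>l\<in>UNIV. beta $ Some l * X i \<omega> $ l) + eps i \<omega>"
    and \<Sigma>_eq: "\<Sigma> = (LINT \<omega>|M. outer (design (X 0 \<omega>)) (design (X 0 \<omega>)))"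
    and \<Gamma>_eq: "\<Gamma> = (LINT \<omega>|M. Y 0 \<omega> *\<^sub>R design (X 0 \<omega>))"
    and \<mu>_eq: "\<mu> = stack (vech \<Sigma>) \<Gamma>"
    and U_eq: "\<And>i \<omega>. U i \<omega> = moment_vec (X i \<omega>) (Y i \<omega>)"
    \<comment> \<open>smoothing\<close>
    and V_indep: "prob_space.indep_vars M (\<lambda>_. borel) V UNIV"
    and V_dens: "\<And>i. distributed M lborel (V i) (\<lambda>x. ennreal (f x))"
    and VU_indep: "indep_seq M V U"
    and f_nonneg: "\<And>x. f x \<ge> 0"
    and f_bounded: "bounded (range f)"
    and f_cont: "isCont f 0"
    and f_pos: "f 0 > 0"
    and K_meas: "K \<in> borel_measurable borel"
    and K_nonneg: "\<And>u. K u \<ge> 0"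
    and K_dens: "has_bochner_integral lborel K 1"
    and K_sym: "\<And>u. K (- u) = K u"
    and K_bounded: "bounded (range K)"
    and K_c2: "integrable lborel (\<lambda>u. (K u)\<^sup>2)"
    and h_pos: "\<And>n. n \<ge> 1 \<Longrightarrow> h n > 0"
    and h_lim: "h \<longlonglongrightarrow> 0"
    and nh_lim: "filterlim (\<lambda>n. real n * h n) at_top sequentially"
    \<comment> \<open>assumptions of the corollary\<close>
    and U_mom2: "integrable M (\<lambda>\<omega>. (norm (U 0 \<omega>))\<^sup>2)"
    and cov_lim: "(\<lambda>n. real n * h n *
                     lambda_max (cov_mat M (\<lambda>\<omega>. (1 / real n) *\<^sub>R (\<Sum>i<n. U i \<omega>)))) \<longlonglongrightarrow> 0"
    and \<mu>_dom: "\<mu> \<in> dom_D"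
    and X_mom4: "integrable M (\<lambda>\<omega>. (norm (X 0 \<omega>)) ^ 4)"
    and eps2_cond: "AE \<omega> in M. 0 < nn_cond_exp M (sigma_gen M (X 0)) (\<lambda>\<omega>'. ennreal ((eps 0 \<omega>')\<^sup>2)) \<omega> \<and>
                               nn_cond_exp M (sigma_gen M (X 0)) (\<lambda>\<omega>'. ennreal ((eps 0 \<omega>')\<^sup>2)) \<omega> < \<infinity>"
    and X_supp: "interior (law_support M (X 0)) \<noteq> {}"
    and \<alpha>: "0 < \<alpha>" "\<alpha> < 1"
    \<comment> \<open>estimators: arbitrary measurable values where the defining formulas make no sense\<close>
    and mu_hat_eq: "\<And>n \<omega>. mu_hat n \<omega> = smooth_mean M U V K h n \<omega>"
    and beta_hat_meas: "\<And>n. beta_hat n \<in> borel_measurable M"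
    and beta_hat_eq: "\<And>n \<omega>. \<omega> \<in> space M \<Longrightarrow> mu_hat n \<omega> \<in> dom_D \<Longrightarrow> beta_hat n \<omega> = g_map (mu_hat n \<omega>)"
    and Sigma_beta_hat_meas: "\<And>n. Sigma_beta_hat n \<in> borel_measurable M"
    and Sigma_beta_hat_eq: "\<And>n \<omega>. \<omega> \<in> space M \<Longrightarrow> mu_hat n \<omega> \<in> dom_D \<Longrightarrow>
          Sigma_beta_hat n \<omega> =
            jacobian g_map (at (mu_hat n \<omega>)) ** Sigma_mu_hat U K f n \<omega>
              ** transpose (jacobian g_map (at (mu_hat n \<omega>)))"
  shows
    "(\<forall>j. (\<lambda>n. measure M {\<omega> \<in> space M.
          beta $ j \<in>
            {beta_hat n \<omega> $ j - quantile std_normal_distribution (1 - \<alpha> / 2)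
                 * sqrt (Sigma_beta_hat n \<omega> $ j $ j / (real n * h n)) <..<
             beta_hat n \<omega> $ j + quantile std_normal_distribution (1 - \<alpha> / 2)
                 * sqrt (Sigma_beta_hat n \<omega> $ j $ j / (real n * h n))}})
        \<longlonglongrightarrow> 1 - \<alpha>)
     \<and>
     (\<forall>(R :: real ^ 'p option ^ 'k) (r :: real ^ 'k) (W :: nat \<Rightarrow> 'w \<Rightarrow> real).
        rank R = CARD('k) \<and>
        (\<forall>n. W n \<in> borel_measurable M) \<and>
        (\<forall>n. \<forall>\<omega>\<in>space M. mu_hat n \<omega> \<in> dom_D \<and> invertible (R ** Sigma_beta_hat n \<omega> ** transpose R) \<longrightarrow>
           W n \<omega> = real n * h n *
             ((R *v beta_hat n \<omega> - r) \<bullet>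
              (matrix_inv (R ** Sigma_beta_hat n \<omega> ** transpose R) *v (R *v beta_hat n \<omega> - r))))
        \<longrightarrow>
        (\<forall>n. \<forall>\<omega>\<in>space M. W n \<omega> > quantile (chi_squared CARD('k)) (1 - \<alpha>)
                            \<longleftrightarrow> 1 - cdf (chi_squared CARD('k)) (W n \<omega>) < \<alpha>) \<and>
        (R *v beta = r \<longrightarrow>
           weak_conv_m (\<lambda>n. distr M borel (W n)) (chi_squared CARD('k)) \<and>
           (\<lambda>n. measure M {\<omega> \<in> space M. W n \<omega> > quantile (chi_squared CARD('k)) (1 - \<alpha>)})
             \<longlonglongrightarrow> \<alpha>))"
proof -
  interpret prob_space M by (rule prob)
  let ?Z = "\<lambda>i \<omega>. (X i \<omega>, eps i \<omega>)"
  \<comment> \<open>Each \<open>U i\<close> is the same measurable function of the pair of regressor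
    and noise, and so inherits its law and ergodic averages from the pair sequence.\<close>
  define u where "u p = moment_vec (fst p) (beta \<bullet> design (fst p) + snd p)" for p :: "(real ^ ('p::{finite, linorder})) \<times> real"
  define r where "r n = real n * h n" for n
  define J where "J = jacobian g_map (at \<mu>)"
  \<comment> \<open>One matrix in two roles: the limit variance of the smoothed mean and the almost
    sure limit of \<open>Sigma_mu_hat\<close>.\<close>
  define G where "G = (c2 K / f 0) *\<^sub>R (LINT \<omega>|M. outer (U 0 \<omega>) (U 0 \<omega>))"
  have Z_meas: "?Z i \<in> borel_measurable M" for i
    using X_meas eps_meas by (rule borel_measurable_Pair)
  have U_u: "U i = (\<lambda>\<omega>. u (X i \<omega>, eps i \<omega>))" for i
    by (simp add: U_eq Y_eq u_def inner_design fun_eq_iff)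
  have u_meas[measurable]: "u \<in> borel_measurable borel"
    unfolding u_def
    by (intro borel_measurable_continuous_onI continuous_on_moment_vec continuous_on_add continuous_on_inner
        continuous_on_compose2[OF continuous_on_design] continuous_on_fst continuous_on_snd continuous_on_id continuous_on_const) auto
  have U_meas[measurable]: "U i \<in> borel_measurable M" for i
    unfolding U_u by (rule measurable_compose[OF Z_meas u_meas])
  have V_meas[measurable]: "V i \<in> borel_measurable M" for i
    using V_indep by (auto simp: indep_vars_def)
  note [measurable] = K_meas X_meas eps_meas beta_hat_meas Sigma_beta_hat_meas
  have U_distr: "distr M borel (U i) = distr M borel (U 0)" for i
  proof -
    have "distr M borel (U k) = distr (distr M borel (?Z k)) borel u" for k
      unfolding U_u by (subst distr_distr[OF u_meas Z_meas]) (simp add: comp_def)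
    then show ?thesis using stationary_distr_eq[OF prob Z_meas stationary, of i] by simp
  qed
  have lln: "AE \<omega> in M. (\<lambda>n. (\<Sum>i<n. F (U i \<omega>)) / real n) \<longlonglongrightarrow> (LINT \<omega>|M. F (U 0 \<omega>))"
    if F[measurable]: "F \<in> borel_measurable borel" and i: "integrable M (\<lambda>\<omega>. F (U 0 \<omega>))" for F :: "_ \<Rightarrow> real"
    using ergodic_theorem[OF prob Z_meas stationary ergodic, of "\<lambda>p. F (u p)"] i unfolding U_u by simp
  note second = quadratic_form_second_moment[OF U_meas U_mom2]
  have iU: "integrable M (U 0)"
    using square_integrable_imp_integrable[OF _ U_mom2] by (simp add: integrable_norm_iff)
  have \<mu>_mean: "\<mu> = (LINT \<omega>|M. U 0 \<omega>)"
  proof -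
    have "\<Sigma> = Sigma_of (LINT \<omega>|M. U 0 \<omega>)"
      unfolding \<Sigma>_eq integral_linear(1)[OF linear_Sigma_of iU, symmetric] by (simp add: U_eq Sigma_of_moment_vec)
    moreover have "\<Gamma> = Gamma_of (LINT \<omega>|M. U 0 \<omega>)"
      unfolding \<Gamma>_eq integral_linear(1)[OF linear_Gamma_of iU, symmetric] by (simp add: U_eq Gamma_of_moment_vec)
    ultimately show ?thesis unfolding \<mu>_eq by (simp only: stack_Sigma_of_Gamma_of)
  qed
  have res_U: "residual beta (U 0 \<omega>) = eps 0 \<omega> *\<^sub>R design (X 0 \<omega>)" for \<omega>
    unfolding U_u u_def by (simp add: residual_moment_vec)
  have design_meas: "(\<lambda>x. design x $ j) \<in> borel_measurable borel" for j :: "'p option"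
    by (intro measurable_vec_nth borel_measurable_continuous_onI continuous_on_design)
  \<comment> \<open>The residual of a moment vector is the noise times the design vector;
    conditional mean zero of the noise annihilates its mean in each coordinate.\<close>
  have res_\<mu>: "residual beta \<mu> = 0"
  proof -
    have i: "integrable M (\<lambda>\<omega>. eps 0 \<omega> *\<^sub>R design (X 0 \<omega>))"
      using integral_linear(2)[OF linear_residual iU, of beta] by (simp add: res_U)
    have "(LINT \<omega>|M. eps 0 \<omega> *\<^sub>R design (X 0 \<omega>)) $ j = 0" for j
    proof -
      have "integrable M (\<lambda>\<omega>. design (X 0 \<omega>) $ j * eps 0 \<omega>)"
        using integrable_bounded_linear[OF bounded_linear_vec_nth i, of j] by (simp add: mult.commute)
      from cond_exp_zero_integral[OF X_meas design_meas eps_meas eps_cond this]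
      show ?thesis using integral_bounded_linear[OF bounded_linear_vec_nth i, of j] by (simp add: mult.commute)
    qed
    then have "(LINT \<omega>|M. eps 0 \<omega> *\<^sub>R design (X 0 \<omega>)) = 0" by (simp add: vec_eq_iff)
    then show ?thesis
      using integral_linear(1)[OF linear_residual iU, of beta] by (simp add: res_U \<mu>_mean)
  qed
  have g_\<mu>: "g_map \<mu> = beta"
    using g_map_diff[OF \<mu>_dom, of beta] by (simp add: res_\<mu>)
  \<comment> \<open>A zero integral of the square would make \<open>K\<close> vanish almost
    everywhere, although it integrates to 1.\<close>
  have c2_pos: "c2 K > 0"
  proof -
    have "c2 K \<noteq> 0"
    proof
      assume "c2 K = 0"
      then have "AE x in lborel. K x = 0"
        using integral_nonneg_eq_0_iff_AE[OF K_c2] by (simp add: c2_def)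
      then have "(LINT x|lborel. K x) = 0" by (rule integral_eq_zero_AE)
      then show False using K_dens by (simp add: has_bochner_integral_iff)
    qed
    moreover have "c2 K \<ge> 0" unfolding c2_def by simp
    ultimately show ?thesis by simp
  qed
  have G_form: "w \<bullet> (G *v w) = c2 K / f 0 * (LINT \<omega>|M. (w \<bullet> U 0 \<omega>)\<^sup>2)" for w
    unfolding G_def by (simp add: scaleR_matrix_vector_assoc[symmetric] second(2))
  have G_entry: "G $ i $ k = c2 K / f 0 * (LINT \<omega>|M. U 0 \<omega> $ i * U 0 \<omega> $ k)"
    and entry_int: "integrable M (\<lambda>\<omega>. U 0 \<omega> $ i * U 0 \<omega> $ k)" for i k
  proof -
    have l: "linear (\<lambda>B :: real ^ ('p option ltri + 'p option) ^ ('p option ltri + 'p option). B $ i $ k)"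
      by (rule linearI) simp_all
    show "G $ i $ k = c2 K / f 0 * (LINT \<omega>|M. U 0 \<omega> $ i * U 0 \<omega> $ k)"
      using integral_linear(1)[OF l second(1)] by (simp add: G_def outer_def)
    show "integrable M (\<lambda>\<omega>. U 0 \<omega> $ i * U 0 \<omega> $ k)"
      using integral_linear(2)[OF l second(1)] by (simp add: outer_def)
  qed
  have G_sym: "transpose G = G"
    by (simp add: vec_eq_iff transpose_def G_entry mult.commute)
  \<comment> \<open>The form is a positive multiple of the second moment of
    \<open>(w \<bullet> design (X 0 \<omega>)) * eps 0 \<omega>\<close>. If that were zero, the
    conditional variance would force \<open>w \<bullet> design (X 0 \<omega>)\<close> to vanish
    almost surely; then \<open>Sigma_of \<mu>\<close> annihilates \<open>w\<close>, and
    invertibility gives first \<open>w = 0\<close> and then \<open>v = 0\<close>.\<close>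
  have J_pos: "v \<bullet> ((J ** G ** transpose J) *v v) > 0" if v: "v \<noteq> 0" for v
  proof -
    let ?S = "Sigma_of \<mu>"
    have inv: "invertible ?S" by (rule invertible_Sigma_of[OF \<mu>_dom])
    define w where "w = transpose (matrix_inv ?S) *v v"
    let ?m = "LINT \<omega>|M. ((w \<bullet> design (X 0 \<omega>)) * eps 0 \<omega>)\<^sup>2"
    have JU: "(transpose J *v v) \<bullet> U 0 \<omega> = (w \<bullet> design (X 0 \<omega>)) * eps 0 \<omega>" for \<omega>
    proof -
      have tr: "(transpose B *v v) \<bullet> y = v \<bullet> (B *v y)" for B :: "real ^ 'm ^ 'p option" and y
        by (metis dot_lmul_matrix transpose_matrix_vector)
      have "(transpose J *v v) \<bullet> U 0 \<omega> = v \<bullet> (matrix_inv ?S *v (eps 0 \<omega> *\<^sub>R design (X 0 \<omega>)))"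
        unfolding tr J_def jacobian_g_map[OF \<mu>_dom] g_\<mu> matrix_vector_mul_assoc[symmetric] residual_mat_mult res_U ..
      then show ?thesis unfolding w_def tr by (simp add: matrix_vector_mult_scaleR)
    qed
    have eq: "v \<bullet> ((J ** G ** transpose J) *v v) = c2 K / f 0 * ?m"
      unfolding quadratic_form_congruence G_form JU ..
    have int: "integrable M (\<lambda>\<omega>. ((w \<bullet> design (X 0 \<omega>)) * eps 0 \<omega>)\<^sup>2)"
      using second(3)[of "transpose J *v v"] unfolding JU .
    have "?m \<noteq> 0"
    proof
      assume zero: "?m = 0"
      have gm: "(\<lambda>x. w \<bullet> design x) \<in> borel_measurable borel"
        by (intro borel_measurable_continuous_onI continuous_on_inner continuous_on_const continuous_on_design)
      have "AE \<omega> in M. w \<bullet> design (X 0 \<omega>) = 0"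
        by (rule weighted_cond_second_moment_zero[OF X_meas gm eps_meas _ int zero]) (use eps2_cond in auto)
      moreover have iS: "integrable M (\<lambda>\<omega>. Sigma_of (U 0 \<omega>) *v w)"
        and S_w: "?S *v w = (LINT \<omega>|M. Sigma_of (U 0 \<omega>) *v w)"
      proof -
        have "linear (\<lambda>x. Sigma_of x *v w)"
          by (rule linearI) (simp_all add: linear_add[OF linear_Sigma_of] linear_scale[OF linear_Sigma_of]
            matrix_vector_mult_add_rdistrib scaleR_matrix_vector_assoc[symmetric])
        from integral_linear[OF this iU]
        show "integrable M (\<lambda>\<omega>. Sigma_of (U 0 \<omega>) *v w)" "?S *v w = (LINT \<omega>|M. Sigma_of (U 0 \<omega>) *v w)"
          by (simp_all add: \<mu>_mean)
      qed
      moreover have "Sigma_of (U 0 \<omega>) *v w = (w \<bullet> design (X 0 \<omega>)) *\<^sub>R design (X 0 \<omega>)" for \<omega>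
        by (simp add: U_eq Sigma_of_moment_vec outer_mult inner_commute)
      ultimately have "(LINT \<omega>|M. Sigma_of (U 0 \<omega>) *v w) = (LINT \<omega>|M. 0)"
        by (intro integral_cong_AE) auto
      then have "?S *v w = 0" by (simp add: S_w)
      then have "w = 0"
        by (metis inv matrix_inv_inverse(2) matrix_vector_mul_assoc matrix_vector_mul_lid matrix_vector_mult_0_right)
      moreover have "transpose ?S *v w = v"
        unfolding w_def matrix_vector_mul_assoc matrix_transpose_mul[symmetric] matrix_inv_inverse(2)[OF inv] by (simp add: transpose_mat)
      ultimately show False using v by simp
    qed
    moreover have "?m \<ge> 0" by simp
    ultimately have "?m > 0" by linarith
    then show ?thesis unfolding eq using c2_pos f_pos by (intro mult_pos_pos divide_pos_pos)
  qed
  have mu_hat_meas[measurable]: "mu_hat n \<in> borel_measurable M" for n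
  proof -
    have "(\<lambda>\<omega>. smooth_mean M U V K h n \<omega>) \<in> borel_measurable M" unfolding smooth_mean_def by measurable
    then show ?thesis using mu_hat_eq by (simp add: fun_eq_iff[symmetric] cong: measurable_cong)
  qed
  have r_lim: "filterlim r at_top sequentially" using nh_lim by (simp add: r_def[abs_def])
  have cf: "(\<lambda>n. LINT \<omega>|M. iexp (w \<bullet> (sqrt (r n) *\<^sub>R (mu_hat n \<omega> - \<mu>)))) \<longlonglongrightarrow> complex_of_real (exp (- (w \<bullet> (G *v w)) / 2))" for w
  proof -
    have "AE \<omega> in M. (\<lambda>n. (\<Sum>i<n. (w \<bullet> U i \<omega>)\<^sup>2) / real n) \<longlonglongrightarrow> (LINT \<omega>|M. (w \<bullet> U 0 \<omega>)\<^sup>2)"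
      using second(3) by (intro lln) auto
    from smooth_mean_clt[OF prob U_meas U_distr U_mom2 this V_indep V_dens VU_indep
        f_nonneg f_bounded f_cont f_pos K_dens K_bounded K_c2 h_pos h_lim nh_lim cov_lim]
    show ?thesis unfolding G_form r_def mu_hat_eq \<mu>_mean by simp
  qed
  \<comment> \<open>Convergence holds almost surely entry by entry, since each product of two
    coordinates of \<open>U\<close> is integrable and obeys the ergodic theorem.\<close>
  have Ghat: "whp M (\<lambda>n \<omega>. dist (Sigma_mu_hat U K f n \<omega>) G < e)" if "e > 0" for e
  proof (rule whp_AE_tendsto[OF _ _ that])
    show "Sigma_mu_hat U K f n \<in> borel_measurable M" for n
    proof -
      have "(\<lambda>v. outer v v) \<in> borel_measurable (borel :: (real ^ ('p option ltri + 'p option)) measure)"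
        by (intro borel_measurable_continuous_onI continuous_on_outer continuous_on_id)
      from measurable_compose[OF U_meas this] show ?thesis
        unfolding Sigma_mu_hat_def[abs_def] by measurable
    qed
    have "AE \<omega> in M. \<forall>i k. (\<lambda>n. (\<Sum>l<n. U l \<omega> $ i * U l \<omega> $ k) / real n) \<longlonglongrightarrow> (LINT \<omega>|M. U 0 \<omega> $ i * U 0 \<omega> $ k)"
      unfolding AE_all_countable
    proof (intro allI)
      fix i k
      have "(\<lambda>v. v $ i * v $ k) \<in> borel_measurable (borel :: (real ^ ('p option ltri + 'p option)) measure)"
        by (intro borel_measurable_times measurable_vec_nth) auto
      from lln[OF this entry_int]
      show "AE \<omega> in M. (\<lambda>n. (\<Sum>l<n. U l \<omega> $ i * U l \<omega> $ k) / real n) \<longlonglongrightarrow> (LINT \<omega>|M. U 0 \<omega> $ i * U 0 \<omega> $ k)" .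
    qed
    then show "AE \<omega> in M. (\<lambda>n. Sigma_mu_hat U K f n \<omega>) \<longlonglongrightarrow> G"
    proof eventually_elim
      case (elim \<omega>)
      have "Sigma_mu_hat U K f n \<omega> $ i $ k = c2 K / f 0 * ((\<Sum>l<n. U l \<omega> $ i * U l \<omega> $ k) / real n)" for n i k
        by (simp add: Sigma_mu_hat_def outer_def)
      moreover have "(\<lambda>n. c2 K / f 0 * ((\<Sum>l<n. U l \<omega> $ i * U l \<omega> $ k) / real n)) \<longlonglongrightarrow> G $ i $ k" for i k
        unfolding G_entry using elim by (intro tendsto_mult_left) blast
      ultimately show ?case by (intro vec_tendstoI) simp
    qed
  qed
  let ?Sb = "\<lambda>x B. jacobian g_map (at x) ** B ** transpose (jacobian g_map (at x))"
  let ?Sh = "\<lambda>n \<omega>. ?Sb (mu_hat n \<omega>) (Sigma_mu_hat U K f n \<omega>)"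
  have part_a: "(\<lambda>n. prob {\<omega> \<in> space M.
      beta $ j \<in> {beta_hat n \<omega> $ j - quantile std_normal_distribution (1 - \<alpha> / 2) * sqrt (Sigma_beta_hat n \<omega> $ j $ j / (real n * h n)) <..<
        beta_hat n \<omega> $ j + quantile std_normal_distribution (1 - \<alpha> / 2) * sqrt (Sigma_beta_hat n \<omega> $ j $ j / (real n * h n))}})
    \<longlonglongrightarrow> 1 - \<alpha>" (is "(\<lambda>n. prob (?C n)) \<longlonglongrightarrow> _") for j
  proof -
    let ?z = "quantile std_normal_distribution (1 - \<alpha> / 2)"
    have z: "?z > 0" using \<alpha> by (intro quantile_std_normal_pos) auto
    have cdf_z: "cdf std_normal_distribution ?z = 1 - \<alpha> / 2"
      using \<alpha> by (intro cdf_quantile real_dist_normal_dist isCont_cdf_std_normal) auto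
    \<comment> \<open>The row selecting coordinate \<open>j\<close>, for which the Wald statistic is
      the squared studentised error.\<close>
    define R :: "real ^ 'p option ^ 1" where "R = (\<chi> i l. if l = j then 1 else 0)"
    \<comment> \<open>The value 0 is a measurable default; where the 1 by 1 matrix is invertible its
      entry is nonzero and the second branch applies.\<close>
    define W where "W n \<omega> = (if Sigma_beta_hat n \<omega> $ j $ j = 0 then 0
      else r n * (beta_hat n \<omega> $ j - beta $ j)\<^sup>2 / (Sigma_beta_hat n \<omega> $ j $ j))" for n \<omega>
    have bm[measurable]: "(\<lambda>\<omega>. beta_hat n \<omega> $ j) \<in> borel_measurable M" for n
      by (intro measurable_vec_nth beta_hat_meas)
    have sm[measurable]: "(\<lambda>\<omega>. Sigma_beta_hat n \<omega> $ j $ j) \<in> borel_measurable M" for n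
      by (intro measurable_vec_nth Sigma_beta_hat_meas)
    have W_meas[measurable]: "W n \<in> borel_measurable M" for n
      unfolding W_def[abs_def] by measurable
    have R_mult: "R *v b = (\<chi> i. b $ j)" for b
      by (simp add: R_def vec_eq_iff matrix_vector_mult_def if_distrib[where f="\<lambda>t. t * _"] cong: if_cong)
    have R_cong: "R ** B ** transpose R = (\<chi> i k. B $ j $ j)" for B
      by (simp add: R_def vec_eq_iff matrix_matrix_mult_def transpose_def if_distrib[where f="\<lambda>t. t * _"]
          if_distrib[where f="\<lambda>t. _ * t"] cong: if_cong)
    have R_rank: "rank R = CARD(1)"
    proof -
      have "R *v (y $ 1 *\<^sub>R axis j 1) = y" for y :: "real ^ 1"
        unfolding R_mult by (simp add: vec_eq_iff forall_1)
      then have "surj ((*v) R)" by (rule surjI)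
      then show ?thesis by (simp only: full_rank_surjective)
    qed
    have "weak_conv_m (\<lambda>n. distr M borel (W n)) (chi_squared CARD(1))"
    proof (rule wald_statistic_weak_conv[OF prob mu_hat_meas r_lim cf G_sym \<mu>_dom J_pos[unfolded J_def] Ghat R_rank W_meas])
      fix n \<omega>
      assume \<omega>: "\<omega> \<in> space M" "mu_hat n \<omega> \<in> dom_D"
        and inv: "invertible (R ** ?Sh n \<omega> ** transpose R)"
      let ?B = "Sigma_beta_hat n \<omega>"
      have B: "?Sh n \<omega> = ?B" using Sigma_beta_hat_eq[OF \<omega>] by simp
      have nz: "?B $ j $ j \<noteq> 0"
        using inv unfolding B R_cong by (simp add: invertible_det_nz det_1)
      have "((\<chi> i k. ?B $ j $ j) :: real ^ 1 ^ 1) ** (\<chi> i k. 1 / (?B $ j $ j)) = (mat 1 :: real ^ 1 ^ 1)"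
        using nz by (simp add: vec_eq_iff matrix_matrix_mult_def mat_def forall_1)
      then have I: "matrix_inv ((\<chi> i k. ?B $ j $ j) :: real ^ 1 ^ 1) = (\<chi> i k. 1 / (?B $ j $ j))"
        by (rule matrix_inv_eqI)
      show "W n \<omega> = r n * ((R *v (g_map (mu_hat n \<omega>) - g_map \<mu>)) \<bullet>
        (matrix_inv (R ** ?Sh n \<omega> ** transpose R) *v (R *v (g_map (mu_hat n \<omega>) - g_map \<mu>))))"
        unfolding B R_cong I R_mult g_\<mu> using nz beta_hat_eq[OF \<omega>]
        by (simp add: W_def inner_vec_def matrix_vector_mult_def power2_eq_square)
    qed
    then have "(\<lambda>n. prob {\<omega> \<in> space M. W n \<omega> < ?z\<^sup>2}) \<longlonglongrightarrow> cdf (chi_squared 1) (?z\<^sup>2)"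
      using weak_conv_chi_squared_tail(2)[OF prob W_meas] by simp
    also have "cdf (chi_squared 1) (?z\<^sup>2) = 1 - \<alpha>"
      using cdf_chi_squared_1[of ?z] z by (simp add: cdf_z)
    finally have lim: "(\<lambda>n. prob {\<omega> \<in> space M. W n \<omega> < ?z\<^sup>2}) \<longlonglongrightarrow> 1 - \<alpha>" .
    have "J ** G ** transpose J = ?Sb \<mu> G" by (simp only: J_def)
    \<comment> \<open>A diagonal entry is the quadratic form at a coordinate vector, hence positive
      by \<open>J_pos\<close>.\<close>
    then have S_lim_pos: "?Sb \<mu> G $ j $ j > 0"
      using J_pos[of "axis j 1"] by (simp add: inner_axis' matrix_vector_mul_component inner_axis axis_eq_0_iff)
    have f: "((\<lambda>p. fst p) \<longlongrightarrow> \<mu>) (nhds (\<mu>, G))" and s: "((\<lambda>p. snd p) \<longlongrightarrow> G) (nhds (\<mu>, G))"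
      using tendsto_fst[OF filterlim_ident, of "(\<mu>, G)"] tendsto_snd[OF filterlim_ident, of "(\<mu>, G)"] by simp_all
    have "((\<lambda>p. ?Sb (fst p) (snd p) $ j $ j) \<longlongrightarrow> ?Sb \<mu> G $ j $ j) (nhds (\<mu>, G))"
      by (intro tendsto_vec_nth tendsto_matrix_matrix_mult tendsto_transpose tendsto_jacobian_g_map \<mu>_dom f s)
    then have ev: "\<forall>\<^sub>F p in nhds (\<mu>, G). ?Sb (fst p) (snd p) $ j $ j > 0"
      using S_lim_pos by (rule order_tendstoD)
    have mu_conv: "whp M (\<lambda>n \<omega>. dist (mu_hat n \<omega>) \<mu> < e)" if "e > 0" for e
      by (rule whp_scaled_tight[OF _ r_lim that], rule cf_imp_tight[OF prob _ cf]) measurable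
    \<comment> \<open>A positive variance estimate is what makes the interval and the inequality
      \<open>W n \<omega> < ?z\<^sup>2\<close> describe the same event.\<close>
    have good: "whp M (\<lambda>n \<omega>. mu_hat n \<omega> \<in> dom_D \<and> ?Sh n \<omega> $ j $ j > 0)"
      using whp_nhds_Pair[OF mu_conv Ghat eventually_conj[OF eventually_dom_D[OF \<mu>_dom f] ev]] by simp
    show ?thesis
    proof (rule whp_prob_diff[OF _ _ _ lim])
      have "\<forall>\<^sub>F n in sequentially. r n > 0" using r_lim unfolding filterlim_at_top_dense by blast
      then have "\<forall>\<^sub>F n in sequentially. \<forall>\<omega>\<in>space M.
          mu_hat n \<omega> \<in> dom_D \<and> ?Sh n \<omega> $ j $ j > 0 \<longrightarrow>
          (\<omega> \<in> ?C n \<longleftrightarrow> \<omega> \<in> {\<omega> \<in> space M. W n \<omega> < ?z\<^sup>2})"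
      proof (eventually_elim, intro ballI impI)
        fix n \<omega>
        assume rn: "r n > 0" and \<omega>: "\<omega> \<in> space M"
          and g: "mu_hat n \<omega> \<in> dom_D \<and> ?Sh n \<omega> $ j $ j > 0"
        let ?s = "Sigma_beta_hat n \<omega> $ j $ j" and ?d = "beta_hat n \<omega> $ j - beta $ j"
        have s: "?s > 0" using g Sigma_beta_hat_eq[OF \<omega>] by simp
        \<comment> \<open>The half-width is positive because \<open>?z\<close>, \<open>?s\<close>
          and \<open>r n\<close> are, so comparing absolute values is comparing squares.\<close>
        have "\<bar>?d\<bar> < ?z * sqrt (?s / r n) \<longleftrightarrow> \<not> \<bar>?z * sqrt (?s / r n)\<bar> \<le> \<bar>?d\<bar>"
          using z s rn by (simp add: not_le)
        also have "\<dots> \<longleftrightarrow> ?d\<^sup>2 < ?z\<^sup>2 * (?s / r n)"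
          unfolding abs_le_square_iff using s rn by (simp add: power_mult_distrib not_le)
        also have "\<dots> \<longleftrightarrow> W n \<omega> < ?z\<^sup>2"
          unfolding W_def using s rn by (simp add: field_simps)
        finally have "\<bar>?d\<bar> < ?z * sqrt (?s / r n) \<longleftrightarrow> W n \<omega> < ?z\<^sup>2" .
        moreover have "beta $ j \<in> {beta_hat n \<omega> $ j - ?z * sqrt (?s / r n) <..< beta_hat n \<omega> $ j + ?z * sqrt (?s / r n)}
          \<longleftrightarrow> \<bar>?d\<bar> < ?z * sqrt (?s / r n)" by auto
        ultimately show "\<omega> \<in> ?C n \<longleftrightarrow> \<omega> \<in> {\<omega> \<in> space M. W n \<omega> < ?z\<^sup>2}"
          using \<omega> by (simp add: r_def)
      qed
      then show "whp M (\<lambda>n \<omega>. \<omega> \<in> ?C n \<longleftrightarrow> \<omega> \<in> {\<omega> \<in> space M. W n \<omega> < ?z\<^sup>2})"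
        by (rule whp_mono[OF good])
      show "?C n \<in> events" for n unfolding greaterThanLessThan_iff by measurable
      show "{\<omega> \<in> space M. W n \<omega> < ?z\<^sup>2} \<in> events" for n by measurable
    qed
  qed
  have part_b: "weak_conv_m (\<lambda>n. distr M borel (W n)) (chi_squared CARD('k))"
    if R: "rank R = CARD('k)" and W: "\<And>n. W n \<in> borel_measurable M" and rR: "R *v beta = \<rho>"
      and W_eq: "\<forall>n. \<forall>\<omega>\<in>space M. mu_hat n \<omega> \<in> dom_D \<and> invertible (R ** Sigma_beta_hat n \<omega> ** transpose R) \<longrightarrow>
           W n \<omega> = real n * h n *
             ((R *v beta_hat n \<omega> - \<rho>) \<bullet>
              (matrix_inv (R ** Sigma_beta_hat n \<omega> ** transpose R) *v (R *v beta_hat n \<omega> - \<rho>)))"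
    for R :: "real ^ 'p option ^ 'k" and \<rho> W
  proof (rule wald_statistic_weak_conv[OF prob mu_hat_meas r_lim cf G_sym \<mu>_dom J_pos[unfolded J_def] Ghat R W])
    fix n \<omega>
    assume \<omega>: "\<omega> \<in> space M" "mu_hat n \<omega> \<in> dom_D"
      and inv: "invertible (R ** ?Sh n \<omega> ** transpose R)"
    have B: "?Sh n \<omega> = Sigma_beta_hat n \<omega>" using Sigma_beta_hat_eq[OF \<omega>] by simp
    \<comment> \<open>The null hypothesis enters here: it lets \<open>\<rho>\<close> be replaced by
      the image of the true coefficient.\<close>
    have d: "R *v (g_map (mu_hat n \<omega>) - g_map \<mu>) = R *v beta_hat n \<omega> - \<rho>"
      using beta_hat_eq[OF \<omega>] by (simp add: g_\<mu> matrix_vector_mult_diff_distrib rR)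
    show "W n \<omega> = r n * ((R *v (g_map (mu_hat n \<omega>) - g_map \<mu>)) \<bullet>
      (matrix_inv (R ** ?Sh n \<omega> ** transpose R) *v (R *v (g_map (mu_hat n \<omega>) - g_map \<mu>))))"
      unfolding d B r_def using W_eq \<omega> inv unfolding B by blast
  qed
  let ?q = "quantile (chi_squared CARD('k)) (1 - \<alpha>)"
  have quant: "x > quantile (chi_squared CARD('k)) (1 - \<alpha>) \<longleftrightarrow> 1 - cdf (chi_squared CARD('k)) x < \<alpha>" for x
    using \<alpha> by (intro chi_squared_quantile_iff) auto
  have cdf_q: "1 - cdf (chi_squared CARD('k)) ?q = \<alpha>"
    using \<alpha> cdf_quantile[OF real_distribution_chi_squared isCont_cdf_chi_squared, of "CARD('k)" "1 - \<alpha>"] by simp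
  show ?thesis
  proof (intro conjI allI impI, goal_cases)
    case (1 j)
    show ?case by (rule part_a)
  next
    case 2
    show ?case using quant by blast
  next
    case (3 R \<rho> W)
    then show ?case using part_b[of R W \<rho>] by blast
  next
    case (4 R \<rho> W)
    then have "weak_conv_m (\<lambda>n. distr M borel (W n)) (chi_squared CARD('k))" using part_b[of R W \<rho>] by blast
    then show ?case
      using weak_conv_chi_squared_tail(1)[OF prob, of W "CARD('k)" ?q] 4
      unfolding cdf_q by simp
  qed
qed

end
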